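(* Let $n$ be a positive integer, let $\mathbf{n}=(n_1,\dots,n_d)$ be any partition of $n$ with $n_1\ge\cdots\ge n_d\ge 1$, and let $\kappa\in\mathbb{C}\setminus\mathbb{Z}_{<n}$. Let $G^{(1)}(s_1)\in\mathbb{C}[[s_1]]$ be an arbitrary power series all of whose coefficients are non-zero, and put $$G^{(n)}(s_1,\dots,s_n)=\mathbb{J}_{\kappa-n}(s_n\mathcal{M}_n)\,\mathbb{J}_{\kappa-n+1}(s_{n-1}\mathcal{M}_{n-1})\cdots\mathbb{J}_{\kappa-2}(s_2\mathcal{M}_2)\bigl(G^{(1)}(s_1)\bigr).$$ Then $\widetilde{G^{(n)}}(X,T)=G^{(n)}(\sigma_1(X\,{}^tT),\dots,\sigma_n(X\,{}^tT))$ is a generating function for the descending basis of $\mathcal{P}^{\mathbf{n}}(\kappa)$; that is, writing $\widetilde{G^{(n)}}(X,T)=\sum_{\nu\in\mathcal{N}^{\mathbf{n}}_0}P_\nu(T)X^\nu$, there are constants $c_\nu$ such that $$D_{ij}P_\nu=c_\nu P_{\nu-e_{ij}}\qquad\text{for all }1\le i,j\le n\text{ and all non-zero }\nu\in\mathcal{N}^{\mathbf{n}}_0 ,$$ where $P_{\nu-e_{ij}}:=0$ if $\nu_{ij}=0$.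
   Context: $T=(t_{ij})$ is an $n\times n$ matrix of independent variables, $\partial_{ij}=\partial/\partial t_{ij}$, and $$D_{ij}=D_{ij}^{(\kappa)}=\kappa\,\partial_{ij}+\sum_{k,l=1}^n t_{kl}\,\partial_{il}\partial_{kj}\qquad(1\le i,j\le n).$$ For the partition $\mathbf{n}$, let $I(\mathbf{n})$ be the set of pairs $(i,j)$ with $i,j$ in the same block, i.e. $n_1+\cdots+n_{s-1}+1\le i,j\le n_1+\cdots+n_s$ for some $s$. Put $\mathcal{P}^{\mathbf{n}}(\kappa)=\{P\in\mathbb{C}[T]\mid D_{ij}P=0\text{ for all }(i,j)\in I(\mathbf{n})\}$. Let $\mathcal{N}^{\mathbf{n}}_0$ be the set of $\nu=(\nu_{ij})\in M_n(\mathbb{Z}_{\ge0})$ with $\nu_{ij}=0$ for all $(i,j)\in I(\mathbf{n})$; $e_{ij}$ is the matrix unit. $X=(x_{ij})$ is an $n\times n$ matrix of variables with $x_{ij}=0$ for $(i,j)\in I(\mathbf{n})$ (zero diagonal blocks) and the other entries independent; $X^\nu=\prod x_{ij}^{\nu_{ij}}$. The polynomials $\sigma_i(X\,{}^tT)$ are defined by $\det(I_n+\lambda X\,{}^tT)=\sum_{i=0}^n\sigma_i(X\,{}^tT)\lambda^i$. Put $\partial_a=\partial/\partial s_a$, $s_0=1$, and $$\mathcal{M}_r=\sum_{\substack{0<a,b<r\\ a+b\ge r}}s_{a+b-r}\,\partial_a\partial_b\quad(r\ge2),\qquad \mathbb{J}_\nu(x)=\sum_{r=0}^\infty\frac{x^r}{r!\,(\nu+1)^{(r)}},\qquad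 (x)^{(r)}=x(x+1)\cdots(x+r-1).$$ Multiplication by $s_r$ commutes with $\mathcal{M}_r$, and the operator $\mathbb{J}_{\kappa-r}(s_r\mathcal{M}_r)$ is applied to power series in $s_1,\dots,s_{r-1}$. For $n=1$ no operator is applied. The descending basis of $\mathcal{P}^{\mathbf{n}}(\kappa)$ is the basis $\{P^D_{\nu}\}_{\nu\in\mathcal{N}_0^{\mathbf n}}$ characterized by $P^D_0=1$ and $D_{ij}P^D_\nu=P^D_{\nu-e_{ij}}$ ($0$ if $\nu_{ij}=0$), with $P^D_\nu$ homogeneous in row $i$ of $T$ of degree $\sum_j\nu_{ij}$ and in column $j$ of degree $\sum_i\nu_{ij}$. A generating function for the descending basis is by definition a series $\sum_\nu P_\nu(T)X^\nu$ satisfying the displayed relation $D_{ij}P_\nu=c_\nu P_{\nu-e_{ij}}$ with some constants $c_\nu$. *)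

theory Defs
  imports Complex_Main "HOL-Library.Poly_Mapping" "HOL-Computational_Algebra.Formal_Power_Series"
    "Jordan_Normal_Form.Determinant"
begin

text \<open>
  Matrix indices run over \<open>0, \<dots>, n - 1\<close> (as in the matrix library used here), whereas the
  variables \<open>s\<^sub>1, s\<^sub>2, \<dots>\<close> keep their indices.  An exponent, and also a matrix \<open>\<nu>\<close> of
  non-negative integers, is a finitely supported function; the matrix unit \<open>e\<^sub>i\<^sub>j\<close> is
  \<open>Poly_Mapping.single (i, j) 1\<close>.
\<close>

type_synonym 'v expo = "'v \<Rightarrow>\<^sub>0 nat"
type_synonym idx = "nat \<times> nat"
type_synonym tpoly = "idx expo \<Rightarrow>\<^sub>0 complex"    \<comment> \<open>polynomials in the \<open>t\<^sub>i\<^sub>j\<close>\<close>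
type_synonym xtpoly = "idx expo \<Rightarrow>\<^sub>0 tpoly"     \<comment> \<open>polynomials in the \<open>x\<^sub>i\<^sub>j\<close> over those\<close>
type_synonym 'v mseries = "'v expo \<Rightarrow> complex" \<comment> \<open>power series, given by their coefficients\<close>


section \<open>The operators \<open>D\<^sub>i\<^sub>j\<close>\<close>

definition tconst :: "complex \<Rightarrow> tpoly" where
  "tconst c = Poly_Mapping.single 0 c"

definition tvar :: "idx \<Rightarrow> tpoly" where
  "tvar v = Poly_Mapping.single (Poly_Mapping.single v 1) 1"

text \<open>The truncated subtraction is harmless: if \<open>v\<close> does not occur in \<open>m\<close>, the factor in front is \<open>0\<close>.\<close>

definition tpderiv :: "idx \<Rightarrow> tpoly \<Rightarrow> tpoly" where
  "tpderiv v p = (\<Sum>m\<in>Poly_Mapping.keys p.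
     Poly_Mapping.single (m - Poly_Mapping.single v 1)
       (of_nat (Poly_Mapping.lookup m v) * Poly_Mapping.lookup p m))"

definition Dop :: "nat \<Rightarrow> complex \<Rightarrow> nat \<Rightarrow> nat \<Rightarrow> tpoly \<Rightarrow> tpoly" where
  "Dop n \<kappa> i j P = tconst \<kappa> * tpderiv (i, j) P
     + (\<Sum>k<n. \<Sum>l<n. tvar (k, l) * tpderiv (i, l) (tpderiv (k, j) P))"


section \<open>Partitions and blocks\<close>

definition is_partition :: "nat list \<Rightarrow> nat \<Rightarrow> bool" where
  "is_partition ns n \<longleftrightarrow> sum_list ns = n \<and> sorted_wrt (\<ge>) ns \<and> (\<forall>m\<in>set ns. m \<ge> 1)"

definition same_block :: "nat list \<Rightarrow> idx set" where
  "same_block ns = {(i, j). \<exists>s<length ns.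
     sum_list (take s ns) \<le> i \<and> i < sum_list (take (Suc s) ns) \<and>
     sum_list (take s ns) \<le> j \<and> j < sum_list (take (Suc s) ns)}"

definition N0 :: "nat \<Rightarrow> nat list \<Rightarrow> idx expo set" where
  "N0 n ns = {\<nu>. Poly_Mapping.keys \<nu> \<subseteq> {..<n} \<times> {..<n} - same_block ns}"


section \<open>The polynomials \<open>\<sigma>\<^sub>i(X\<^sup>tT)\<close>\<close>

definition Tmat :: "nat \<Rightarrow> xtpoly mat" where
  "Tmat n = mat n n (\<lambda>v. Poly_Mapping.single 0 (tvar v))"

definition Xmat :: "nat \<Rightarrow> nat list \<Rightarrow> xtpoly mat" where
  "Xmat n ns = mat n n (\<lambda>v. if v \<in> same_block ns then 0
     else Poly_Mapping.single (Poly_Mapping.single v 1) 1)"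

definition sigma :: "nat \<Rightarrow> nat list \<Rightarrow> nat \<Rightarrow> xtpoly" where
  "sigma n ns i = poly.coeff
     (Determinant.det (1\<^sub>m n + [:0, 1:] \<cdot>\<^sub>m map_mat (\<lambda>p. [:p:]) (Xmat n ns * transpose_mat (Tmat n)))) i"


section \<open>The series \<open>G\<^sup>(\<^sup>n\<^sup>)\<close>\<close>

definition mderiv :: "nat \<Rightarrow> nat mseries \<Rightarrow> nat mseries" where
  "mderiv a F = (\<lambda>m. of_nat (Poly_Mapping.lookup m a + 1) * F (m + Poly_Mapping.single a 1))"

text \<open>Multiplication by \<open>s\<^sub>c\<close>, where \<open>s\<^sub>0 = 1\<close>.\<close>

definition smult_var :: "nat \<Rightarrow> nat mseries \<Rightarrow> nat mseries" where
  "smult_var c F = (if c = 0 then F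
     else (\<lambda>m. if Poly_Mapping.lookup m c = 0 then 0 else F (m - Poly_Mapping.single c 1)))"

definition Mop :: "nat \<Rightarrow> nat mseries \<Rightarrow> nat mseries" where
  "Mop r F = (\<lambda>m. \<Sum>(a, b)\<in>{(a, b). 0 < a \<and> a < r \<and> 0 < b \<and> b < r \<and> r \<le> a + b}.
     smult_var (a + b - r) (mderiv a (mderiv b F)) m)"

text \<open>
  The operator \<open>\<J>\<^sub>\<nu>(A)\<close>, summed coefficientwise.  For \<open>A = s\<^sub>r M\<^sub>r\<close> the sum over \<open>k\<close> has only
  finitely many non-zero terms at every exponent, see \<open>finite_Jop\<close> below.
\<close>

definition Jop :: "complex \<Rightarrow> (nat mseries \<Rightarrow> nat mseries) \<Rightarrow> nat mseries \<Rightarrow> nat mseries" where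
  "Jop \<nu> A F = (\<lambda>m. Sum_any (\<lambda>k. (A ^^ k) F m / (fact k * pochhammer (\<nu> + 1) k)))"

definition in_s1 :: "complex fps \<Rightarrow> nat mseries" where
  "in_s1 G = (\<lambda>m. if Poly_Mapping.keys m \<subseteq> {1} then fps_nth G (Poly_Mapping.lookup m 1) else 0)"

definition Gser :: "complex \<Rightarrow> complex fps \<Rightarrow> nat \<Rightarrow> nat mseries" where
  "Gser \<kappa> G1 n = fold (\<lambda>r. Jop (\<kappa> - of_nat r) (\<lambda>F. smult_var r (Mop r F))) [2..<Suc n] (in_s1 G1)"

lemma finite_Jop:
  assumes "r > 0"
  shows "finite {k. ((\<lambda>F. smult_var r (Mop r F)) ^^ k) F m \<noteq> 0}"
proof -
  let ?A = "\<lambda>F. smult_var r (Mop r F)"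
  have "\<forall>m. Poly_Mapping.lookup m r < k \<longrightarrow> (?A ^^ k) F m = 0" for k
  proof (induction k)
    case 0
    then show ?case by simp
  next
    case (Suc k)
    show ?case
    proof (intro allI impI)
      fix m :: "nat expo"
      assume m: "Poly_Mapping.lookup m r < Suc k"
      show "(?A ^^ Suc k) F m = 0"
      proof (cases "Poly_Mapping.lookup m r = 0")
        case True
        then show ?thesis using assms by (simp add: smult_var_def)
      next
        case False
        define m' where "m' = m - Poly_Mapping.single r 1"
        have m': "Poly_Mapping.lookup m' r < k"
          using m False by (simp add: m'_def lookup_minus)
        have "smult_var (a + b - r) (mderiv a (mderiv b ((?A ^^ k) F))) m' = 0"
          if "0 < a" "a < r" "0 < b" "b < r" "r \<le> a + b" for a b
          using that Suc.IH m'
          by (auto simp: smult_var_def mderiv_def lookup_minus lookup_add lookup_single when_def)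
        then have "Mop r ((?A ^^ k) F) m' = 0"
          unfolding Mop_def by (intro sum.neutral) auto
        then show ?thesis using assms False by (simp add: smult_var_def m'_def)
      qed
    qed
  qed
  then have "{k. (?A ^^ k) F m \<noteq> 0} \<subseteq> {..Poly_Mapping.lookup m r}"
    by (auto simp: not_less[symmetric])
  then show ?thesis by (rule finite_subset) simp
qed


section \<open>Substitution and generating functions\<close>

text \<open>
  The coefficient of \<open>X\<^sup>\<nu>\<close> in \<open>G(\<sigma>\<^sub>1, \<dots>, \<sigma>\<^sub>n)\<close>, a polynomial in \<open>T\<close>.  As \<open>\<sigma>\<^sub>i\<close> is homogeneous of
  degree \<open>i\<close> in \<open>X\<close>, only the finitely many monomials of \<open>G\<close> in \<open>s\<^sub>1, \<dots>, s\<^sub>n\<close> of weight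
  \<open>\<Sum>i. i * m\<^sub>i = |\<nu>|\<close> contribute.
\<close>

definition subst_coeff :: "nat mseries \<Rightarrow> (nat \<Rightarrow> xtpoly) \<Rightarrow> idx expo \<Rightarrow> tpoly" where
  "subst_coeff G \<sigma> \<nu> = Sum_any (\<lambda>m. tconst (G m) *
     Poly_Mapping.lookup (\<Prod>i\<in>Poly_Mapping.keys m. \<sigma> i ^ Poly_Mapping.lookup m i) \<nu>)"

definition Gtilde_coeff :: "nat \<Rightarrow> nat list \<Rightarrow> complex \<Rightarrow> complex fps \<Rightarrow> idx expo \<Rightarrow> tpoly" where
  "Gtilde_coeff n ns \<kappa> G1 = subst_coeff (Gser \<kappa> G1 n) (sigma n ns)"

text \<open>
  A series in \<open>X\<close> over the polynomials in \<open>T\<close> is given by its coefficients \<open>P \<nu>\<close>.  The first conjunct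
  says that it has the shape \<open>\<Sum>\<nu>\<in>N0 n ns. P \<nu> X\<^sup>\<nu>\<close>.
\<close>

definition descending_generating_function ::
    "nat \<Rightarrow> nat list \<Rightarrow> complex \<Rightarrow> (idx expo \<Rightarrow> tpoly) \<Rightarrow> bool" where
  "descending_generating_function n ns \<kappa> P \<longleftrightarrow>
     (\<forall>\<nu>. \<nu> \<notin> N0 n ns \<longrightarrow> P \<nu> = 0) \<and>
     (\<exists>c :: idx expo \<Rightarrow> complex. \<forall>\<nu>\<in>N0 n ns. \<nu> \<noteq> 0 \<longrightarrow>
        (\<forall>i<n. \<forall>j<n. Dop n \<kappa> i j (P \<nu>) =
           tconst (c \<nu>) * (if Poly_Mapping.lookup \<nu> (i, j) = 0 then 0
                            else P (\<nu> - Poly_Mapping.single (i, j) 1))))"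

end

theory Submission
  imports Defs
begin

text \<open>
  For a function \<open>F\<close> of \<open>\<sigma>\<^sub>1, \<dots>, \<sigma>\<^sub>n\<close> the chain rule gives
  \<open>D\<^sub>i\<^sub>j F(\<sigma>) = \<Sum>r. Z\<^sub>r\<^sub>-\<^sub>1(i, j) (L\<^sub>r F)(\<sigma>)\<close>, where \<open>Z\<^sub>p\<close> is the coefficient of \<open>\<lambda>\<^sup>p\<close> in
  \<open>adj(1 + \<lambda> X T\<^sup>t) X\<close>, so \<open>Z\<^sub>0 = X\<close>, and \<open>L\<^sub>r\<close> is a second order operator in the variables
  \<open>s\<^sub>1, \<dots>, s\<^sub>n\<close>.  Since \<open>L\<^sub>n = (\<kappa> - n + 1) \<partial>\<^sub>n + s\<^sub>n \<partial>\<^sub>n\<^sup>2 - M\<^sub>n\<close>, the operator \<open>L\<^sub>n\<close> kills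
  \<open>\<J>\<^sub>\<kappa>\<^sub>-\<^sub>n(s\<^sub>n M\<^sub>n) H\<close> for every series \<open>H\<close> in \<open>s\<^sub>1, \<dots>, s\<^sub>n\<^sub>-\<^sub>1\<close>.  The commutator of \<open>L\<^sub>r\<close> with
  \<open>M\<^sub>n\<close> shows that \<open>\<J>\<^sub>\<kappa>\<^sub>-\<^sub>n(s\<^sub>n M\<^sub>n)\<close> intertwines the operators \<open>L\<^sub>r\<close> in \<open>n - 1\<close> and in \<open>n\<close>
  variables, as long as \<open>L\<^sub>b H = 0\<close> for \<open>r < b < n\<close>.  Hence \<open>L\<^sub>r G\<^sup>(\<^sup>n\<^sup>) = 0\<close> for \<open>r \<ge> 2\<close>, and \<open>L\<^sub>1 G\<^sup>(\<^sup>n\<^sup>)\<close>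
  is built from \<open>(\<kappa> \<partial>\<^sub>1 + s\<^sub>1 \<partial>\<^sub>1\<^sup>2) G\<^sup>(\<^sup>1\<^sup>)\<close> in the same way as \<open>G\<^sup>(\<^sup>n\<^sup>)\<close> from \<open>G\<^sup>(\<^sup>1\<^sup>)\<close>.  The part of
  weight \<open>w\<close> of such a series depends on its starting series only through a scalar factor, the
  coefficient of \<open>s\<^sub>1\<^sup>w\<close>; so \<open>D\<^sub>i\<^sub>j\<close> amounts to multiplication by \<open>x\<^sub>i\<^sub>j\<close> and a rescaling of each weight.
\<close>

subsection \<open>Commutation relations in a Weyl algebra\<close>

text \<open>Two infinities shape the argument. The ring in which the commutators are computed has
  only finite sums, so \<open>J\<close> is replaced by partial sums; telescoping leaves a single
  remainder, divisible by a high power of \<open>s_n\<close>, which no coefficient of smaller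
  \<open>s_n\<close>-degree sees. And only finitely supported series can be evaluated at the
  \<sigma>'s, so each weight is treated separately. The restriction \<open>r < b < n\<close> in the
  intertwining property comes from the commutator: it contains the products \<open>d_a L_b\<close>
  with \<open>a + b = n + r\<close>, and \<open>a < n\<close> means \<open>b > r\<close>. For
  \<open>r >= 1\<close> all these \<open>b\<close> are at least 2, so the previous stage already
  gives \<open>L_b H = 0\<close>; this is why \<open>L_1\<close> is the one operator that may
  survive. Stage \<open>m\<close> divides by the numbers \<open>\<kappa> - m + k\<close> with
  \<open>k >= 1\<close> and \<open>m <= n\<close>; they are nonzero because \<kappa> is not an
  integer below \<open>n\<close>. The constant in weight \<open>w\<close> is
  \<open>w (\<kappa> + w - 1) g_w / g_(w-1)\<close>, where \<open>g_w\<close> are the coefficients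
  of the starting series: \<open>\<kappa> \<partial> + s \<partial>^2\<close> sends
  \<open>s^w\<close> to \<open>w (\<kappa> + w - 1) s^(w-1)\<close>, and comparison with the
  original series divides by \<open>g_(w-1)\<close>.\<close>

text \<open>
  The coefficient of \<open>s\<^sub>a\<^sub>+\<^sub>b\<^sub>-\<^sub>r \<partial>\<^sub>a \<partial>\<^sub>b\<close> in \<open>L\<^sub>r\<close>: it is \<open>1\<close> if \<open>a, b \<ge> r\<close>, it is \<open>-1\<close> if
  \<open>a, b < r\<close> (the part \<open>-M\<^sub>r\<close>), and it is \<open>0\<close> otherwise.
\<close>

definition eps :: "nat \<Rightarrow> nat \<Rightarrow> nat \<Rightarrow> nat \<Rightarrow> int" where
  "eps N r a b = (if r \<le> a + b \<and> a + b \<le> r + N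
     then of_bool (r \<le> a) + of_bool (r \<le> b) - 1 else 0)"

section \<open>Signs of the second and third order coefficients\<close>

lemma eps_commute: "eps N r a b = eps N r b a"
  by (simp add: eps_def add.commute)

text \<open>
  The coefficient of \<open>s\<^sub>q \<partial>\<^sub>x \<partial>\<^sub>y \<partial>\<^sub>z\<close> with \<open>q = x + y + z - n - r\<close> in the third order part of the
  relation \<open>commutator_L_M\<close> below, before symmetrization.
\<close>

definition third_kernel :: "nat \<Rightarrow> nat \<Rightarrow> nat \<Rightarrow> nat \<Rightarrow> nat \<Rightarrow> int" where
  "third_kernel n r x y z =
     (if n < y + z then eps (n - 1) r (y + z - n) x else 0)
     - (if r < y + z \<and> y + z < n + r \<and> n + r \<le> x + y + z then eps (n - 1) r y z else 0)
     + (if x = r \<and> n \<le> y + z then 1 else 0)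
     - (if r < x then eps (n - 1) (n + r - x) y z else 0)"

text \<open>Since \<open>x + y + z = q + n + r\<close>, a condition on the sum of two indices is a
  comparison of the third one with \<open>q\<close>; for instance \<open>r <= y + z - n\<close>
  means \<open>x <= q\<close>. Only the truth values of \<open>r <= i\<close>, \<open>r < i\<close>
  and \<open>q < i\<close> remain, which makes the cyclic sum a matter of algebra.\<close>

lemma third_kernel_eq:
  assumes "0 < r" "r < n" "x \<in> {1..<n}" "y \<in> {1..<n}" "z \<in> {1..<n}"
    and q: "x + y + z = q + n + r" "q < n"
  shows "third_kernel n r x y z =
    of_bool (r \<le> x) - of_bool (q < x) - of_bool (q < x) * (of_bool (r \<le> y) + of_bool (r \<le> z) - 1)
    + (of_bool (r \<le> x) - of_bool (r < x))
    - of_bool (r < x) * (1 - of_bool (q < y) - of_bool (q < z))"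
proof -
  have xyz: "0 < x" "x < n" "0 < y" "y < n" "0 < z" "z < n" using assms(3-5) by simp_all
  have A: "(if n < y + z then eps (n - 1) r (y + z - n) x else 0) = of_bool (r \<le> x) - of_bool (q < x)"
  proof (cases "n < y + z")
    case True
    have "(r \<le> y + z - n) = (\<not> q < x)" "r \<le> y + z - n + x" "y + z - n + x \<le> r + (n - 1)"
      using xyz True q assms(1,2) by linarith+
    then show ?thesis using True by (simp add: eps_def of_bool_not_iff)
  next
    case False
    then have "r \<le> x" "q < x" using xyz q assms(1,2) by linarith+
    then show ?thesis using False by simp
  qed
  have B: "(if r < y + z \<and> y + z < n + r \<and> n + r \<le> x + y + z then eps (n - 1) r y z else 0)
     = of_bool (q < x) * (of_bool (r \<le> y) + of_bool (r \<le> z) - 1)"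
  proof (cases "q < x")
    case True
    have "r < y + z" "y + z < n + r" "n + r \<le> x + y + z" "r \<le> y + z" "y + z \<le> r + (n - 1)"
      using xyz True q assms(1,2) by linarith+
    then show ?thesis using True by (simp add: eps_def)
  next
    case False
    then have "\<not> y + z < n + r" using q by linarith
    then show ?thesis using False by simp
  qed
  have C: "(if x = r \<and> n \<le> y + z then 1 else 0 :: int) = of_bool (r \<le> x) - of_bool (r < x)"
  proof (cases "x = r")
    case True
    then have "n \<le> y + z" using q by linarith
    then show ?thesis using True by simp
  next
    case False
    then have "(r \<le> x) = (r < x)" by linarith
    then show ?thesis using False by simp
  qed
  have D: "(if r < x then eps (n - 1) (n + r - x) y z else 0)
    = of_bool (r < x) * (1 - of_bool (q < y) - of_bool (q < z))"
  proof (cases "r < x")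
    case True
    have "(n + r - x \<le> y) = (\<not> q < z)" "(n + r - x \<le> z) = (\<not> q < y)"
      "n + r - x \<le> y + z" "y + z \<le> n + r - x + (n - 1)"
      using xyz True q assms(1,2) by linarith+
    then show ?thesis using True by (simp add: eps_def of_bool_not_iff)
  next
    case False
    then show ?thesis by simp
  qed
  show ?thesis unfolding third_kernel_def A B C D by simp
qed

text \<open>The bounds in \<open>eps\<close> and the side conditions of the kernel all confine the
  index \<open>q = x + y + z - n - r\<close> of the variable in front to
  \<open>0 <= q < n\<close>.\<close>

lemma third_kernel_eq_0:
  assumes "0 < r" "r < n" "x \<in> {1..<n}" "y \<in> {1..<n}" "z \<in> {1..<n}"
    and "\<not> (n + r \<le> x + y + z \<and> x + y + z < n + r + n)"
  shows "third_kernel n r x y z = 0"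
proof -
  have xyz: "0 < x" "x < n" "0 < y" "y < n" "0 < z" "z < n" using assms(3-5) by simp_all
  have A: "eps (n - 1) r (y + z - n) x = 0" if "n < y + z"
    using xyz that assms(1,2,6) by (auto simp del: add_diff_assoc simp: eps_def)
  have B: "eps (n - 1) r y z = 0" if "r < y + z" "y + z < n + r" "n + r \<le> x + y + z"
    using xyz that assms(1,2,6) by (auto simp: eps_def)
  have C: "\<not> (x = r \<and> n \<le> y + z)" using xyz assms(1,2,6) by linarith
  have D: "eps (n - 1) (n + r - x) y z = 0" if "r < x"
    using xyz that assms(1,2,6) by (auto simp: eps_def)
  show ?thesis unfolding third_kernel_def using A B C D by auto
qed

text \<open>Written with indicators, the mixed products of \<open>r <= i\<close> and
  \<open>q < j\<close> occur with both signs and cancel over the three rotations. What is left are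
  the terms with an index equal to \<open>r\<close>, which need a separate argument.\<close>

lemma third_kernel_cyclic:
  assumes "0 < r" "r < n" "x \<in> {1..<n}" "y \<in> {1..<n}" "z \<in> {1..<n}"
  shows "third_kernel n r x y z + third_kernel n r y z x + third_kernel n r z x y = 0"
proof (cases "n + r \<le> x + y + z \<and> x + y + z < n + r + n")
  case False
  then have "\<not> (n + r \<le> y + z + x \<and> y + z + x < n + r + n)"
    "\<not> (n + r \<le> z + x + y \<and> z + x + y < n + r + n)" by (simp_all add: add_ac)
  then show ?thesis
    using False third_kernel_eq_0[OF assms(1-3,4,5)] third_kernel_eq_0[OF assms(1,2,4,5,3)]
      third_kernel_eq_0[OF assms(1,2,5,3,4)] by simp
next
  case True
  define q where "q = x + y + z - (n + r)"
  have q: "x + y + z = q + n + r" "q < n" using True by (auto simp: q_def)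
  define u where "u i = (of_bool (q < i) :: int)" for i
  define p where "p i = (of_bool (r \<le> i) :: int)" for i
  define e where "e i = (of_bool (i = r) :: int)" for i
  have p': "of_bool (r < i) = p i - e i" for i by (auto simp: p_def e_def)
  \<comment> \<open>If \<open>x = r\<close>, then \<open>y + z = q + n\<close> with
    \<open>y, z < n\<close>, so \<open>y\<close> and \<open>z\<close> both exceed \<open>q\<close>;
    likewise for the other indices.\<close>
  have e: "e x * u y = e x" "e x * u z = e x" "e y * u x = e y" "e y * u z = e y"
     "e z * u x = e z" "e z * u y = e z" using assms q by (auto simp: e_def u_def)
  have *: "third_kernel n r i j k = p i - u i - u i * (p j + p k - 1) + e i - (p i - e i) * (1 - u j - u k)"
    if "i \<in> {1..<n}" "j \<in> {1..<n}" "k \<in> {1..<n}" "i + j + k = q + n + r" for i j k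
    unfolding u_def[symmetric] p_def[symmetric]
      third_kernel_eq[OF assms(1,2) that(1,2,3,4) q(2)] p' by simp
  show ?thesis
    using *[OF assms(3,4,5)] *[OF assms(4,5,3)] *[OF assms(5,3,4)] q e
    by (simp add: algebra_simps)
qed

text \<open>The condition \<open>0 < a\<close> in \<open>d_s\<close> is essential: as
  \<open>s 0 = 1\<close>, the case \<open>a = c = 0\<close> would read \<open>d 0 = d 0 + 1\<close>.
  Cancelling the factor 3 undoes the cyclic symmetrization of third order terms.\<close>

locale weyl_ring =
  fixes s d :: "nat \<Rightarrow> 'a::ring_1" and \<kappa> :: 'a
  assumes s_0: "s 0 = 1"
    and s_commute: "s a * s b = s b * s a"
    and d_commute: "d a * d b = d b * d a"
    and d_s: "0 < a \<Longrightarrow> d a * s c = s c * d a + of_bool (a = c)"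
    and central: "\<kappa> * x = x * \<kappa>"
    and torsion_free: "3 * x = 0 \<Longrightarrow> (x :: 'a) = 0"
begin

section \<open>Commutators with \<open>M_n\<close>\<close>

definition Mr :: "nat \<Rightarrow> 'a" where
  "Mr n = (\<Sum>a\<in>{1..<n}. \<Sum>b\<in>{1..<n}. of_bool (n \<le> a + b) * (s (a + b - n) * d a * d b))"

text \<open>This is the commutator of \<open>d r\<close> with \<open>M_n\<close>: \<open>d r\<close>
  meets the variable \<open>s (a + b - n)\<close> exactly when \<open>a + b = n + r\<close>.\<close>

definition Nr :: "nat \<Rightarrow> nat \<Rightarrow> 'a" where
  "Nr n r = (\<Sum>a\<in>{1..<n}. \<Sum>b\<in>{1..<n}. of_bool (a + b = n + r) * (d a * d b))"

definition Tr :: "nat \<Rightarrow> nat \<Rightarrow> 'a" where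
  "Tr N r = (\<Sum>a\<in>{1..N}. \<Sum>b\<in>{1..N}. of_int (eps N r a b) * (s (a + b - r) * d a * d b))"

text \<open>The correction \<open>1 - r\<close> to \<kappa> arises when a derivative hits the factor
  \<open>Z_(r-1)\<close> in the chain rule; see \<open>sum_t_D_Z\<close>.\<close>

definition Lr :: "nat \<Rightarrow> nat \<Rightarrow> 'a" where
  "Lr N r = (\<kappa> + 1 - of_nat r) * d r + Tr N r"

lemma d_s_left: "0 < a \<Longrightarrow> d a * (s c * x) = s c * (d a * x) + of_bool (a = c) * x"
  by (simp only: mult.assoc[symmetric] d_s distrib_right)

lemma d_left_commute: "d a * (d b * x) = d b * (d a * x)"
  by (simp only: mult.assoc[symmetric] d_commute)

lemma s_left_commute: "s a * (s b * x) = s b * (s a * x)"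
  by (simp only: mult.assoc[symmetric] s_commute)

lemma of_bool_left_commute: "x * (of_bool P * y) = of_bool P * (x * y :: 'a)"
  by (cases P) simp_all

lemma of_int_left_commute: "x * (of_int i * y) = of_int i * (x * y :: 'a)"
  by (simp only: mult.assoc[symmetric] mult_of_int_commute[of i x])

lemma commutator_d_M:
  assumes "0 < r" "r < n"
  shows "d r * Mr n = Mr n * d r + Nr n r"
proof -
  have "d r * Mr n = (\<Sum>a\<in>{1..<n}. \<Sum>b\<in>{1..<n}.
      of_bool (n \<le> a + b) * (s (a + b - n) * d a * d b) * d r + of_bool (a + b = n + r) * (d a * d b))"
    unfolding Mr_def sum_distrib_left sum_distrib_right
  proof (intro sum.cong refl, goal_cases)
    case (1 a b)
    have eq: "(n \<le> a + b \<and> r = a + b - n) = (a + b = n + r)" using assms by auto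
    then have "d r * (s (a + b - n) * d a * d b) = s (a + b - n) * d a * d b * d r
        + of_bool (r = a + b - n) * (d a * d b)"
      using assms(1) by (simp only: mult.assoc d_s_left d_left_commute d_commute)
    then show ?case using eq
      by (cases "n \<le> a + b") (auto simp: mult.assoc)
  qed
  then show ?thesis by (simp only: Mr_def Nr_def sum.distrib sum_distrib_right)
qed

text \<open>Each operator is linear in its variable, so only single contractions survive: one
  derivative of one factor with the variable of the other.\<close>

lemma commutator_quadratic:
  assumes "0 < a" "0 < b" "0 < p" "0 < q"
  shows "(s c * d a * d b) * (s f * d p * d q) - (s f * d p * d q) * (s c * d a * d b) =
    of_bool (a = f) * (s c * (d b * d p * d q)) + of_bool (b = f) * (s c * (d a * d p * d q))
    - of_bool (p = c) * (s f * (d q * d a * d b)) - of_bool (q = c) * (s f * (d p * d a * d b))"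
  using assms
  by (simp add: mult.assoc d_s_left distrib_left s_left_commute d_left_commute d_commute)

lemma Nr_d_commute: "Nr n r * d a = d a * Nr n r"
  unfolding Nr_def by (simp add: sum_distrib_left sum_distrib_right mult.assoc d_left_commute d_commute)

lemma commutator_N_M:
  assumes "0 < r" "r < n"
  shows "Nr n r * Mr n = Mr n * Nr n r
    + 2 * (\<Sum>a\<in>{1..<n}. \<Sum>b\<in>{1..<n}. of_bool (a + b = n + r) * (d a * Nr n b))"
proof -
  let ?I = "{1..<n}"
  have "Nr n r * Mr n = (\<Sum>a\<in>?I. \<Sum>b\<in>?I. of_bool (a + b = n + r) * (d a * d b * Mr n))"
    unfolding Nr_def by (simp add: sum_distrib_right mult.assoc)
  also have "\<dots> = (\<Sum>a\<in>?I. \<Sum>b\<in>?I. Mr n * (of_bool (a + b = n + r) * (d a * d b))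
      + of_bool (a + b = n + r) * (d a * Nr n b) + of_bool (a + b = n + r) * (d b * Nr n a))"
  proof (intro sum.cong refl, goal_cases)
    case (1 a b)
    have "d a * (d b * Mr n) = Mr n * (d a * d b) + d b * Nr n a + d a * Nr n b"
      using 1 by (simp add: commutator_d_M distrib_left mult.assoc[symmetric] Nr_d_commute)
        (simp add: mult.assoc[symmetric] commutator_d_M distrib_right Nr_d_commute)
    then show ?case by (simp add: mult.assoc)
  qed
  also have "\<dots> = Mr n * Nr n r + (\<Sum>a\<in>?I. \<Sum>b\<in>?I. of_bool (a + b = n + r) * (d a * Nr n b))
    + (\<Sum>a\<in>?I. \<Sum>b\<in>?I. of_bool (a + b = n + r) * (d b * Nr n a))"
    unfolding Nr_def[of n r] by (simp only: sum.distrib sum_distrib_left)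
  also have "(\<Sum>a\<in>?I. \<Sum>b\<in>?I. of_bool (a + b = n + r) * (d b * Nr n a)) =
     (\<Sum>a\<in>?I. \<Sum>b\<in>?I. of_bool (a + b = n + r) * (d a * Nr n b))"
    by (subst sum.swap) (simp add: add.commute)
  finally show ?thesis by (simp add: mult_2 add.assoc)
qed

definition D3 :: "nat \<Rightarrow> nat \<Rightarrow> nat \<Rightarrow> nat \<Rightarrow> 'a" where
  "D3 c x y z = s (x + y + z - c) * (d x * d y * d z)"

lemma D3_cyclic: "D3 c y z x = D3 c x y z" 
  by (simp add: D3_def add.commute add.left_commute mult.assoc d_left_commute d_commute)

lemma sum3_cyclic:
  "(\<Sum>x\<in>A. \<Sum>y\<in>A. \<Sum>z\<in>A. f y z x) = (\<Sum>x\<in>A. \<Sum>y\<in>A. \<Sum>z\<in>A. (f x y z :: 'a))"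
  by (subst sum.swap) (rule sum.cong[OF refl], rule sum.swap)

text \<open>\<open>D3\<close> does not change under rotation of its three indices. Three times the
  sum is therefore the sum against the cyclic symmetrization of the kernel, which vanishes.\<close>

lemma third_kernel_sum:
  assumes "0 < r" "r < n"
  shows "(\<Sum>x\<in>{1..<n}. \<Sum>y\<in>{1..<n}. \<Sum>z\<in>{1..<n}.
     of_int (third_kernel n r x y z) * D3 (n + r) x y z) = 0" (is "?S = 0")
proof (rule torsion_free)
  define f where "f x y z = of_int (third_kernel n r x y z) * D3 (n + r) x y z" for x y z
  define S where "S g = (\<Sum>x\<in>{1..<n}. \<Sum>y\<in>{1..<n}. \<Sum>z\<in>{1..<n}. (g x y z :: 'a))" for g
  have cyc: "S (\<lambda>x y z. g y z x) = S g" for g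
    unfolding S_def by (rule sum3_cyclic)
  have "(3::'a) = 1 + 1 + 1" by simp
  then have "3 * S f = S f + S f + S f" by (simp only: distrib_right mult_1_left)
  then have "3 * S f = S f + S (\<lambda>x y z. f y z x) + S (\<lambda>x y z. f z x y)"
    using cyc[of f] cyc[of "\<lambda>x y z. f z x y"] by simp
  also have "\<dots> = S (\<lambda>x y z. f x y z + f y z x + f z x y)"
    by (simp add: S_def sum.distrib)
  also have "\<dots> = 0"
    unfolding S_def
  proof (intro sum.neutral ballI)
    fix x y z assume xyz: "x \<in> {1..<n}" "y \<in> {1..<n}" "z \<in> {1..<n}"
    have "D3 (n + r) y z x = D3 (n + r) x y z" "D3 (n + r) z x y = D3 (n + r) x y z"
      by (metis D3_cyclic)+
    then have "f x y z + f y z x + f z x y =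
       of_int (third_kernel n r x y z + third_kernel n r y z x + third_kernel n r z x y) * D3 (n + r) x y z"
      by (simp add: f_def algebra_simps)
    then show "f x y z + f y z x + f z x y = 0"
      using third_kernel_cyclic[OF assms xyz] by simp
  qed
  finally show "3 * ?S = 0" by (simp add: S_def f_def)
qed

lemma of_int_mult_mult: "(of_int i * x) * (of_int j * y) = of_int (i * j) * (x * y :: 'a)"
  by (simp only: of_int_mult mult.assoc of_int_left_commute[of x j y])

lemma of_int_mult_mult': "(of_int j * y) * (of_int i * x) = of_int (i * j) * (y * x :: 'a)"
  by (simp only: of_int_mult_mult mult.commute)

lemma sum_commutator:
  "(\<Sum>i\<in>A. of_int (e i) * X i) * (\<Sum>j\<in>B. of_int (m j) * Y j)
     - (\<Sum>j\<in>B. of_int (m j) * Y j) * (\<Sum>i\<in>A. of_int (e i) * X i)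
   = (\<Sum>i\<in>A. \<Sum>j\<in>B. of_int (e i * m j) * (X i * Y j - Y j * X i :: 'a))"
proof -
  have "(\<Sum>i\<in>A. of_int (e i) * X i) * (\<Sum>j\<in>B. of_int (m j) * Y j)
     = (\<Sum>i\<in>A. \<Sum>j\<in>B. of_int (e i * m j) * (X i * Y j))"
    by (simp only: sum_product of_int_mult_mult)
  moreover have "(\<Sum>j\<in>B. of_int (m j) * Y j) * (\<Sum>i\<in>A. of_int (e i) * X i)
     = (\<Sum>i\<in>A. \<Sum>j\<in>B. of_int (e i * m j) * (Y j * X i))"
    by (subst sum.swap) (simp only: sum_product of_int_mult_mult')
  ultimately show ?thesis
    by (simp only: right_diff_distrib sum_subtractf)
qed

lemma sum4_rotate:
  "(\<Sum>a\<in>A. \<Sum>b\<in>A. \<Sum>p\<in>A. \<Sum>q\<in>A. f a b p q) =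
   (\<Sum>b\<in>A. \<Sum>p\<in>A. \<Sum>q\<in>A. \<Sum>a\<in>A. (f a b p q :: 'a))"
  by (subst sum.swap, rule sum.cong[OF refl], subst sum.swap, rule sum.cong[OF refl], rule sum.swap)

lemma Mr_eq: "Mr n = (\<Sum>a\<in>{1..<n}. \<Sum>b\<in>{1..<n}. of_int (of_bool (n \<le> a + b)) * (s (a + b - n) * d a * d b))"
  by (simp only: Mr_def of_int_of_bool)

lemma Tr_eq: "0 < n \<Longrightarrow> Tr (n - 1) r =
  (\<Sum>a\<in>{1..<n}. \<Sum>b\<in>{1..<n}. of_int (eps (n - 1) r a b) * (s (a + b - r) * d a * d b))"
  unfolding Tr_def by (intro sum.cong) auto

text \<open>Contract the quadratic summands pairwise and eliminate the contracted index. The factors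
  2 count the two interchangeable derivatives in each summand.\<close>

lemma commutator_T_M:
  assumes "0 < r" "r < n"
  shows "Tr (n - 1) r * Mr n - Mr n * Tr (n - 1) r =
    2 * (\<Sum>x\<in>{1..<n}. \<Sum>y\<in>{1..<n}. \<Sum>z\<in>{1..<n}.
      of_int (if n < y + z then eps (n - 1) r (y + z - n) x else 0) * D3 (n + r) x y z)
   - 2 * (\<Sum>x\<in>{1..<n}. \<Sum>y\<in>{1..<n}. \<Sum>z\<in>{1..<n}.
      of_int (if r < y + z \<and> y + z < n + r \<and> n + r \<le> x + y + z then eps (n - 1) r y z else 0)
        * D3 (n + r) x y z)" (is "?L = 2 * ?S1 - 2 * ?S2")
proof -
  let ?I = "{1..<n}"
  define e where "e a b = eps (n - 1) r a b" for a b
  define m where "m p q = (of_bool (n \<le> p + q) :: int)" for p q :: nat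
  \<comment> \<open>In \<open>g1\<close> a derivative of \<open>T\<close> hits the variable of
    \<open>M_n\<close>; in \<open>g2\<close> a derivative of \<open>M_n\<close> hits the variable of
    \<open>T\<close>.\<close>
  define g1 where "g1 a b p q = of_int (e a b * m p q) * (of_bool (a = p + q - n) *
      (s (a + b - r) * (d b * d p * d q)))" for a b p q
  define g2 where "g2 a b p q = of_int (e a b * m p q) * (of_bool (p = a + b - r) *
      (s (p + q - n) * (d q * d a * d b)))" for a b p q
  have "?L = (\<Sum>a\<in>?I. \<Sum>b\<in>?I. \<Sum>p\<in>?I. \<Sum>q\<in>?I. of_int (e a b * m p q) *
     ((s (a + b - r) * d a * d b) * (s (p + q - n) * d p * d q)
      - (s (p + q - n) * d p * d q) * (s (a + b - r) * d a * d b)))"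
    using sum_commutator[where A = "?I \<times> ?I" and B = "?I \<times> ?I" and e = "\<lambda>(a, b). e a b"
      and X = "\<lambda>(a, b). s (a + b - r) * d a * d b" and m = "\<lambda>(a, b). m a b"
      and Y = "\<lambda>(a, b). s (a + b - n) * d a * d b"] assms
    by (simp only: sum.cartesian_product' Tr_eq Mr_eq case_prod_conv e_def m_def)
  also have "\<dots> = (\<Sum>a\<in>?I. \<Sum>b\<in>?I. \<Sum>p\<in>?I. \<Sum>q\<in>?I.
      g1 a b p q + g1 b a p q - g2 a b p q - g2 a b q p)"
  proof (intro sum.cong refl, goal_cases)
    case (1 a b p q)
    have sym: "e b a = e a b" "m q p = m p q"
      by (simp_all add: e_def m_def eps_commute add.commute)
    show ?case using 1 unfolding g1_def g2_def sym
      by (subst commutator_quadratic)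
        (simp_all only: distrib_left right_diff_distrib add.commute atLeastLessThan_iff less_eq_Suc_le One_nat_def)
  qed
  also have "\<dots> = (\<Sum>a\<in>?I. \<Sum>b\<in>?I. \<Sum>p\<in>?I. \<Sum>q\<in>?I. g1 a b p q)
      + (\<Sum>a\<in>?I. \<Sum>b\<in>?I. \<Sum>p\<in>?I. \<Sum>q\<in>?I. g1 b a p q)
      - (\<Sum>a\<in>?I. \<Sum>b\<in>?I. \<Sum>p\<in>?I. \<Sum>q\<in>?I. g2 a b p q)
      - (\<Sum>a\<in>?I. \<Sum>b\<in>?I. \<Sum>p\<in>?I. \<Sum>q\<in>?I. g2 a b q p)"
    by (simp only: sum.distrib sum_subtractf)
  also have "(\<Sum>a\<in>?I. \<Sum>b\<in>?I. \<Sum>p\<in>?I. \<Sum>q\<in>?I. g1 b a p q) =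
     (\<Sum>a\<in>?I. \<Sum>b\<in>?I. \<Sum>p\<in>?I. \<Sum>q\<in>?I. g1 a b p q)"
    by (rule sum.swap)
  also have "(\<Sum>a\<in>?I. \<Sum>b\<in>?I. \<Sum>p\<in>?I. \<Sum>q\<in>?I. g2 a b q p) =
     (\<Sum>a\<in>?I. \<Sum>b\<in>?I. \<Sum>p\<in>?I. \<Sum>q\<in>?I. g2 a b p q)"
    by (rule sum.cong[OF refl], rule sum.cong[OF refl], rule sum.swap)
  also have "(\<Sum>a\<in>?I. \<Sum>b\<in>?I. \<Sum>p\<in>?I. \<Sum>q\<in>?I. g1 a b p q) = ?S1"
    unfolding sum4_rotate[of g1]
  proof (intro sum.cong refl, goal_cases)
    case (1 b p q)
    have "(\<Sum>a\<in>?I. g1 a b p q) = (\<Sum>a\<in>?I. if a = p + q - n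
        then of_int (e a b * m p q) * (s (a + b - r) * (d b * d p * d q)) else 0)"
      by (intro sum.cong) (simp_all add: g1_def)
    also have "\<dots> = of_int (if n < p + q then eps (n - 1) r (p + q - n) b else 0) * D3 (n + r) b p q"
    proof (cases "n < p + q")
      case True
      then have "p + q - n \<in> ?I" "p + q - n + b - r = b + p + q - (n + r)" using 1 by auto
      then show ?thesis using True by (simp add: D3_def e_def m_def sum.delta)
    next
      case False
      then show ?thesis by (simp add: sum.delta)
    qed
    finally show ?case .
  qed
  also have "(\<Sum>a\<in>?I. \<Sum>b\<in>?I. \<Sum>p\<in>?I. \<Sum>q\<in>?I. g2 a b p q) = ?S2"
  proof -
    have "(\<Sum>a\<in>?I. \<Sum>b\<in>?I. \<Sum>p\<in>?I. \<Sum>q\<in>?I. g2 a b p q) =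
       (\<Sum>q\<in>?I. \<Sum>a\<in>?I. \<Sum>b\<in>?I. \<Sum>p\<in>?I. g2 a b p q)"
      by (simp only: sum4_rotate[of g2] sum4_rotate[of "\<lambda>b p q a. g2 a b p q"]
          sum4_rotate[of "\<lambda>p q a b. g2 a b p q"])
    also have "\<dots> = ?S2"
    proof (intro sum.cong refl, goal_cases)
      case (1 q a b)
      have "(\<Sum>p\<in>?I. g2 a b p q) = (\<Sum>p\<in>?I. if p = a + b - r
          then of_int (e a b * m p q) * (s (p + q - n) * (d q * d a * d b)) else 0)"
        by (intro sum.cong) (simp_all add: g2_def)
      \<comment> \<open>The eliminated index \<open>a + b - r\<close> must lie below
        \<open>n\<close>, which is a genuine condition here; for \<open>p + q - n\<close> in the
        first sum it was automatic.\<close>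
      also have "\<dots> = of_int (if r < a + b \<and> a + b < n + r \<and> n + r \<le> q + a + b
          then eps (n - 1) r a b else 0) * D3 (n + r) q a b"
      proof (cases "r < a + b \<and> a + b < n + r")
        case True
        then have "a + b - r \<in> ?I" "a + b - r + q - n = q + a + b - (n + r)"
          "n \<le> a + b - r + q \<longleftrightarrow> n + r \<le> q + a + b" using 1 by auto
        then show ?thesis using True by (simp add: D3_def e_def m_def sum.delta)
      next
        case False
        then have "a + b - r \<notin> ?I" by auto
        then show ?thesis using False by (auto simp: sum.delta)
      qed
      finally show ?case .
    qed
    finally show ?thesis .
  qed
  finally show ?thesis by (simp only: mult_2 diff_diff_eq)
qed

lemma commutator_d_T:
  assumes "0 < a"
  shows "d a * Tr N b = Tr N b * d a
    + (\<Sum>x\<in>{1..N}. \<Sum>y\<in>{1..N}. of_int (eps N b x y) * (of_bool (a = x + y - b) * (d x * d y)))"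
proof -
  have "d a * Tr N b = (\<Sum>x\<in>{1..N}. \<Sum>y\<in>{1..N}. of_int (eps N b x y) * (s (x + y - b) * d x * d y) * d a
      + of_int (eps N b x y) * (of_bool (a = x + y - b) * (d x * d y)))"
    unfolding Tr_def sum_distrib_left
  proof (intro sum.cong refl, goal_cases)
    case (1 x y)
    have "d a * (s (x + y - b) * d x * d y) = s (x + y - b) * d x * d y * d a
        + of_bool (a = x + y - b) * (d x * d y)"
      using assms by (simp only: mult.assoc d_s_left d_left_commute d_commute)
    then show ?case
      by (simp only: of_int_left_commute[of "d a"] distrib_left mult.assoc)
  qed
  then show ?thesis
    by (simp only: Tr_def sum.distrib sum_distrib_right)
qed

text \<open>Moving \<open>d a\<close> to the right of \<open>T\<close> costs the contractions with
  \<open>a = x + y - b\<close>. As \<open>a + b = n + r\<close>, they have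
  \<open>x + y = n + r\<close>, and the signs, summed over \<open>b\<close>, leave every
  \<open>d x * d y\<close> exactly once.\<close>

lemma sum_d_T:
  assumes "0 < r" "r < n"
  shows "(\<Sum>a\<in>{1..<n}. \<Sum>b\<in>{1..<n}. of_bool (a + b = n + r) * (d a * Tr (n - 1) b)) =
    (\<Sum>x\<in>{1..<n}. \<Sum>y\<in>{1..<n}. \<Sum>z\<in>{1..<n}.
       of_int (if r < x then eps (n - 1) (n + r - x) y z else 0) * D3 (n + r) x y z) + Nr n r"
    (is "?L = ?R1 + _")
proof -
  let ?I = "{1..<n}"
  let ?e = "eps (n - 1)"
  have I: "{1..n - 1} = ?I" using assms by auto
  have "?L = (\<Sum>a\<in>?I. \<Sum>b\<in>?I. of_bool (a + b = n + r) * (Tr (n - 1) b * d a))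
     + (\<Sum>a\<in>?I. \<Sum>b\<in>?I. \<Sum>x\<in>?I. \<Sum>y\<in>?I.
         of_bool (a + b = n + r) * (of_int (?e b x y) * (of_bool (a = x + y - b) * (d x * d y))))"
    unfolding sum.distrib[symmetric]
  proof (intro sum.cong refl, goal_cases)
    case (1 a b)
    then have "0 < a" by simp
    show ?case
      unfolding commutator_d_T[OF \<open>0 < a\<close>] I distrib_left sum_distrib_left ..
  qed
  also have "(\<Sum>a\<in>?I. \<Sum>b\<in>?I. of_bool (a + b = n + r) * (Tr (n - 1) b * d a)) = ?R1"
  proof (rule sum.cong[OF refl], goal_cases)
    case (1 a)
    have "(\<Sum>b\<in>?I. of_bool (a + b = n + r) * (Tr (n - 1) b * d a)) =
      (\<Sum>b\<in>?I. if b = n + r - a then Tr (n - 1) b * d a else 0)"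
      using 1 by (intro sum.cong) auto
    also have "\<dots> = (if r < a then Tr (n - 1) (n + r - a) * d a else 0)"
      using 1 assms by (auto simp: sum.delta)
    also have "\<dots> = (\<Sum>y\<in>?I. \<Sum>z\<in>?I. of_int (if r < a then ?e (n + r - a) y z else 0) * D3 (n + r) a y z)"
    proof (cases "r < a")
      case True
      have "y + z - (n + r - a) = a + y + z - (n + r)" for y z using 1 by auto
      then show ?thesis using True
        by (simp only: if_True Tr_def I sum_distrib_right D3_def mult.assoc d_commute d_left_commute)
    qed simp
    finally show ?case .
  qed
  also have "(\<Sum>a\<in>?I. \<Sum>b\<in>?I. \<Sum>x\<in>?I. \<Sum>y\<in>?I.
         of_bool (a + b = n + r) * (of_int (?e b x y) * (of_bool (a = x + y - b) * (d x * d y)))) =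
     (\<Sum>x\<in>?I. \<Sum>y\<in>?I. \<Sum>a\<in>?I. \<Sum>b\<in>?I.
         of_bool (a + b = n + r) * (of_int (?e b x y) * (of_bool (a = x + y - b) * (d x * d y))))"
    by (simp only: sum4_rotate[of "\<lambda>a b x y. of_bool (a + b = n + r) * (of_int (?e b x y) * (of_bool (a = x + y - b) * (d x * d y)))"]
      sum4_rotate[of "\<lambda>b x y a. of_bool (a + b = n + r) * (of_int (?e b x y) * (of_bool (a = x + y - b) * (d x * d y)))"])
  also have "\<dots> = Nr n r"
    unfolding Nr_def
  proof (intro sum.cong refl, goal_cases)
    case (1 x y)
    have "(\<Sum>a\<in>?I. \<Sum>b\<in>?I. of_bool (a + b = n + r) * (of_int (?e b x y) * (of_bool (a = x + y - b) * (d x * d y))))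
      = (\<Sum>b\<in>?I. \<Sum>a\<in>?I. of_bool (a + b = n + r) * (of_int (?e b x y) * (of_bool (a = x + y - b) * (d x * d y))))"
      by (rule sum.swap)
    \<comment> \<open>The condition \<open>r < b\<close> is what \<open>a < n\<close> becomes for
      \<open>a = n + r - b\<close>.\<close>
    also have "\<dots> = (\<Sum>b\<in>?I. of_int (of_bool (x + y = n + r \<and> r < b) * (of_bool (b \<le> x) + of_bool (b \<le> y) - 1)) * (d x * d y))"
    proof (intro sum.cong refl, goal_cases)
      case (1 b)
      have "(\<Sum>a\<in>?I. of_bool (a + b = n + r) * (of_int (?e b x y) * (of_bool (a = x + y - b) * (d x * d y))))
        = (\<Sum>a\<in>?I. if a = x + y - b then of_bool (a + b = n + r) * (of_int (?e b x y) * (d x * d y)) else 0)"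
        by (intro sum.cong) auto
      also have "\<dots> = (if x + y - b \<in> ?I then of_bool (x + y - b + b = n + r) * (of_int (?e b x y) * (d x * d y)) else 0)"
        by (simp add: sum.delta)
      also have "\<dots> = of_int (of_bool (x + y = n + r \<and> r < b) * (of_bool (b \<le> x) + of_bool (b \<le> y) - 1)) * (d x * d y)"
      proof (cases "x + y = n + r \<and> r < b")
        case True
        then have "x + y - b \<in> ?I" "x + y - b + b = n + r" "b \<le> x + y" "x + y \<le> b + (n - 1)"
          using 1 \<open>x \<in> ?I\<close> \<open>y \<in> ?I\<close> by auto
        then show ?thesis using True by (simp only: eps_def if_True of_bool_eq mult_1_left simp_thms)
      next
        case False
        then have "\<not> (x + y - b \<in> ?I \<and> x + y - b + b = n + r)"
          using 1 \<open>x \<in> ?I\<close> \<open>y \<in> ?I\<close> by auto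
        then show ?thesis using False by auto
      qed
      finally show ?case .
    qed
    also have "\<dots> = of_int (\<Sum>b\<in>?I. of_bool (x + y = n + r \<and> r < b) * (of_bool (b \<le> x) + of_bool (b \<le> y) - 1)) * (d x * d y)"
      by (simp only: of_int_sum sum_distrib_right)
    also have "(\<Sum>b\<in>?I. of_bool (x + y = n + r \<and> r < b) * (of_bool (b \<le> x) + of_bool (b \<le> y) - 1)) = (of_bool (x + y = n + r) :: int)"
    proof (cases "x + y = n + r")
      case True
      then have "r \<le> x" "r \<le> y" using 1 by auto
      have "(\<Sum>b\<in>?I. of_bool (x + y = n + r \<and> r < b) * (of_bool (b \<le> x) + of_bool (b \<le> y) - 1)) =
        (\<Sum>b\<in>?I. of_bool (b \<in> {r<..x}) + of_bool (b \<in> {r<..y}) - (of_bool (b \<in> {r<..<n}) :: int))"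
        using True 1 by (intro sum.cong) (auto simp: of_bool_def)
      also have "\<dots> = int (card (?I \<inter> {r<..x})) + int (card (?I \<inter> {r<..y})) - int (card (?I \<inter> {r<..<n}))"
        by (simp only: sum.distrib sum_subtractf sum_of_bool_eq finite_atLeastLessThan Collect_mem_eq)
      also have "?I \<inter> {r<..x} = {r<..x}" using 1 by auto
      also have "?I \<inter> {r<..y} = {r<..y}" using 1 by auto
      also have "?I \<inter> {r<..<n} = {r<..<n}" by auto
      \<comment> \<open>The count is \<open>(x - r) + (y - r) - (n - 1 - r)\<close>, and
        \<open>x + y = n + r\<close>.\<close>
      also have "int (card {r<..x}) + int (card {r<..y}) - int (card {r<..<n}) = 1"
        using True \<open>r \<le> x\<close> \<open>r \<le> y\<close> assms by simp
      finally show ?thesis using True by simp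
    qed simp
    finally show ?case by (simp only: of_int_of_bool)
  qed
  finally show ?thesis .
qed

lemma scalar_commute: "x * (\<kappa> + of_nat i - of_nat j) = (\<kappa> + of_nat i - of_nat j) * x"
  by (simp add: distrib_left distrib_right right_diff_distrib left_diff_distrib central mult_of_nat_commute)

text \<open>Exchanging \<open>a\<close> and \<open>b\<close> replaces
  \<open>\<kappa> + 1 - b\<close> by \<open>\<kappa> + 1 - a\<close>; the two add up to a scalar
  depending on \<open>a + b = n + r\<close> only. Doubling avoids a division by 2.\<close>

lemma sum_d_linear:
  assumes "r < n"
  shows "2 * (\<Sum>a\<in>{1..<n}. \<Sum>b\<in>{1..<n}. of_bool (a + b = n + r) * (d a * ((\<kappa> + 1 - of_nat b) * d b)))
    = (2 * \<kappa> + 2 - of_nat (n + r)) * Nr n r" (is "2 * ?S = _")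
proof -
  let ?I = "{1..<n}"
  have "?S = (\<Sum>a\<in>?I. \<Sum>b\<in>?I. of_bool (a + b = n + r) * ((\<kappa> + 1 - of_nat b) * (d a * d b)))"
    using scalar_commute[of _ 1] by (simp only: mult.assoc[symmetric] of_nat_1)
  then have S: "?S = (\<Sum>a\<in>?I. \<Sum>b\<in>?I. of_bool (a + b = n + r) * ((\<kappa> + 1 - of_nat b) * (d a * d b)))" .
  also have "\<dots> = (\<Sum>a\<in>?I. \<Sum>b\<in>?I. of_bool (a + b = n + r) * ((\<kappa> + 1 - of_nat a) * (d a * d b)))"
    by (subst sum.swap) (simp only: add.commute d_commute)
  finally have "2 * ?S = (\<Sum>a\<in>?I. \<Sum>b\<in>?I. of_bool (a + b = n + r) * ((\<kappa> + 1 - of_nat b) * (d a * d b))) +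
     (\<Sum>a\<in>?I. \<Sum>b\<in>?I. of_bool (a + b = n + r) * ((\<kappa> + 1 - of_nat a) * (d a * d b)))"
    using S by (simp only: mult_2)
  also have "\<dots> = (\<Sum>a\<in>?I. \<Sum>b\<in>?I. (2 * \<kappa> + 2 - of_nat (n + r)) * (of_bool (a + b = n + r) * (d a * d b)))"
    unfolding sum.distrib[symmetric]
  proof (intro sum.cong refl, goal_cases)
    case (1 a b)
    show ?case
    proof (cases "a + b = n + r")
      case True
      have "(\<kappa> + 1 - of_nat b) + (\<kappa> + 1 - of_nat a) = 2 * \<kappa> + 2 - (of_nat (a + b) :: 'a)"
        by (simp add: mult_2 algebra_simps)
      then show ?thesis
        by (simp add: True distrib_right[symmetric] del: of_nat_add)
    qed simp
  qed
  finally show ?thesis by (simp only: Nr_def sum_distrib_left)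
qed

text \<open>The right side is arranged so that the error is controllable: in the last sum
  \<open>a < n\<close> gives \<open>b > r\<close>, so it involves only operators \<open>L_b\<close>
  of higher index. The third order terms cancel by \<open>third_kernel_sum\<close>, and the
  multiples of \<open>Nr n r\<close> are compared directly.\<close>

lemma commutator_L_M:
  assumes "0 < r" "r < n"
  shows "Lr (n - 1) r * Mr n = Mr n * Lr (n - 1) r - 2 * (d r * Mr n)
    - (\<kappa> + 1 - of_nat n) * Nr n r
    + 2 * (\<Sum>a\<in>{1..<n}. \<Sum>b\<in>{1..<n}. of_bool (a + b = n + r) * (d a * Lr (n - 1) b))"
proof -
  let ?I = "{1..<n}"
  let ?T = "Tr (n - 1) r" and ?M = "Mr n" and ?N = "Nr n r" and ?c = "\<kappa> + 1 - of_nat r :: 'a"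
  define S where "S K = (\<Sum>x\<in>?I. \<Sum>y\<in>?I. \<Sum>z\<in>?I. of_int (K x y z) * D3 (n + r) x y z)" for K
  define A where "A = S (\<lambda>x y z. if n < y + z then eps (n - 1) r (y + z - n) x else 0)"
  define B where "B = S (\<lambda>x y z. if r < y + z \<and> y + z < n + r \<and> n + r \<le> x + y + z then eps (n - 1) r y z else 0)"
  define C where "C = S (\<lambda>x y z. if x = r \<and> n \<le> y + z then 1 else 0)"
  define E where "E = S (\<lambda>x y z. if r < x then eps (n - 1) (n + r - x) y z else 0)"
  \<comment> \<open>\<open>A\<close> and \<open>B\<close> are the contractions in the commutator of
    \<open>T\<close> and \<open>M_n\<close>, \<open>C\<close> is \<open>M_n d_r\<close>, and
    \<open>E\<close> is the part of the sum of the \<open>d_a T_b\<close> with all derivatives moved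
    to the right.\<close>
  have 0: "A - B + C - E = 0"
    using third_kernel_sum[OF assms] unfolding third_kernel_def A_def B_def C_def E_def S_def
    by (simp only: of_int_add of_int_diff left_diff_distrib distrib_right sum.distrib sum_subtractf)
  have "?T * ?M - ?M * ?T = 2 * A - 2 * B"
    using commutator_T_M[OF assms] by (simp only: A_def B_def S_def)
  then have TM: "?T * ?M = ?M * ?T + (2 * A - 2 * B)"
    by (simp only: diff_eq_eq add.commute)
  have dM: "d r * ?M = ?M * d r + ?N" by (rule commutator_d_M[OF assms])
  have C: "?M * d r = C"
  proof -
    have "C = (\<Sum>x\<in>?I. if x = r then \<Sum>y\<in>?I. \<Sum>z\<in>?I. of_bool (n \<le> y + z) * D3 (n + r) x y z else 0)"
      unfolding C_def S_def
    proof (rule sum.cong[OF refl], goal_cases)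
      case (1 x)
      show ?case
        by (cases "x = r") (simp_all only: simp_thms if_False of_int_0 mult_zero_left sum.neutral_const
            if_True of_bool_def[symmetric] of_int_of_bool of_bool_eq)
    qed
    also have "\<dots> = (\<Sum>y\<in>?I. \<Sum>z\<in>?I. of_bool (n \<le> y + z) * D3 (n + r) r y z)"
      using assms by (simp add: sum.delta)
    also have "\<dots> = ?M * d r"
      unfolding Mr_def sum_distrib_right
    proof (intro sum.cong refl, goal_cases)
      case (1 y z)
      have "r + y + z - (n + r) = y + z - n" by auto
      then show ?case by (simp only: D3_def mult.assoc d_left_commute d_commute)
    qed
    finally show ?thesis by simp
  qed
  have R: "2 * (\<Sum>a\<in>?I. \<Sum>b\<in>?I. of_bool (a + b = n + r) * (d a * Lr (n - 1) b)) =
    (2 * \<kappa> + 2 - of_nat (n + r)) * ?N + 2 * (E + ?N)"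
    unfolding Lr_def distrib_left sum.distrib sum_d_linear[OF assms(2)] sum_d_T[OF assms]
    by (simp only: E_def S_def)
  have cM: "?M * ?c = ?c * ?M" using scalar_commute[of ?M 1 r] by simp
  have "Lr (n - 1) r * ?M = ?c * (d r * ?M) + ?T * ?M"
    by (simp only: Lr_def distrib_right mult.assoc)
  also have "\<dots> = ?c * (?M * d r) + ?c * ?N + ?M * ?T + 2 * A - 2 * B"
    by (simp only: dM TM distrib_left add.assoc add_diff_eq)
  also have "?c * (?M * d r) = ?M * (?c * d r)"
    by (simp only: mult.assoc[symmetric] cM)
  finally have "Lr (n - 1) r * ?M = ?M * Lr (n - 1) r + ?c * ?N + 2 * A - 2 * B"
    by (simp add: Lr_def distrib_left)
  moreover have "A = B - C + E" using 0 by (simp add: algebra_simps)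
  ultimately show ?thesis
    unfolding R dM C by (simp add: algebra_simps mult_2)
qed

text \<open>Induction on \<open>k\<close> for all \<open>r\<close> at once: although
  \<open>L_b h = 0\<close>, the next commutator applies \<open>L_b\<close> with \<open>b > r\<close>
  to \<open>M_n^k h\<close>, and the induction hypothesis for \<open>b\<close> supplies the
  resulting terms. The sums \<open>W\<close> that appear there cancel against those from moving
  \<open>M_n\<close> past \<open>Nr n r\<close>.\<close>

lemma L_M_power:
  assumes "0 < r" "r < n" "\<And>b. r < b \<Longrightarrow> b < n \<Longrightarrow> Lr (n - 1) b * h = 0"
  shows "Lr (n - 1) r * (Mr n ^ k * h) = Mr n ^ k * (Lr (n - 1) r * h)
    - 2 * of_nat k * (d r * (Mr n ^ k * h))
    - of_nat k * (\<kappa> + of_nat k - of_nat n) * (Nr n r * (Mr n ^ (k - 1) * h))"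
  using assms
proof (induction k arbitrary: r)
  case 0
  then show ?case by simp
next
  case (Suc k)
  let ?M = "Mr n" and ?N = "Nr n r" and ?I = "{1..<n}"
  define v where "v = ?M ^ k * h"
  define u where "u = ?M ^ (k - 1) * h"
  define c where "c = of_nat k * (\<kappa> + of_nat k - of_nat n :: 'a)"
  have c_commute: "x * c = c * x" for x
    unfolding c_def mult.assoc[symmetric] add_diff_eq[symmetric] mult_of_nat_commute[of k x, symmetric]
    unfolding mult.assoc add_diff_eq scalar_commute[of x] ..
  have k: "y * (2 * of_nat k * x) = 2 * of_nat k * (y * x)" for x y :: 'a
    using mult_of_nat_commute[of "2 * k" y] by (simp only: of_nat_mult of_nat_numeral mult.assoc[symmetric])
  have c: "y * (c * x) = c * (y * x)" for x y
    by (simp only: mult.assoc[symmetric] c_commute[of y])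
  \<comment> \<open>\<open>M_n u = v\<close> may fail for \<open>k = 0\<close>, where
    \<open>k - 1\<close> is truncated, but then \<open>c = 0\<close>.\<close>
  have Mu: "c * (?N * (?M * u)) = c * (?N * v)"
    by (cases k) (simp_all add: u_def v_def c_def mult.assoc)
  define W where "W = (\<Sum>a\<in>?I. \<Sum>b\<in>?I. of_bool (a + b = n + r) * (d a * Nr n b))"
  have IH: "Lr (n - 1) r * v = ?M ^ k * (Lr (n - 1) r * h) - 2 * of_nat k * (d r * v) - c * (?N * u)"
    using Suc.IH[of r] Suc.prems by (simp add: v_def u_def c_def)
  have IHb: "Lr (n - 1) b * v = - (2 * of_nat k * (d b * v)) - c * (Nr n b * u)"
    if "r < b" "b < n" for b
    using Suc.IH[of b] Suc.prems that by (simp add: v_def u_def c_def)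
  have S: "(\<Sum>a\<in>?I. \<Sum>b\<in>?I. of_bool (a + b = n + r) * (d a * Lr (n - 1) b)) * v
    = - (2 * of_nat k * (?N * v)) - c * (W * u)"
  proof -
    have "(\<Sum>a\<in>?I. \<Sum>b\<in>?I. of_bool (a + b = n + r) * (d a * Lr (n - 1) b)) * v
      = (\<Sum>a\<in>?I. \<Sum>b\<in>?I. - (2 * of_nat k * (of_bool (a + b = n + r) * (d a * d b) * v))
           - c * (of_bool (a + b = n + r) * (d a * Nr n b) * u))"
      unfolding sum_distrib_right
    proof (intro sum.cong refl, goal_cases)
      case (1 a b)
      show ?case
      proof (cases "a + b = n + r")
        case True
        then have "r < b" "b < n" using 1 by auto
        have "d a * (Lr (n - 1) b * v) = - (2 * of_nat k * (d a * (d b * v))) - c * (d a * (Nr n b * u))"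
          unfolding IHb[OF \<open>r < b\<close> \<open>b < n\<close>] right_diff_distrib mult_minus_right c k ..
        then show ?thesis
          by (simp only: True simp_thms of_bool_eq mult_1_left mult.assoc)
      qed simp
    qed
    then show ?thesis
      by (simp only: sum_subtractf sum_negf sum_distrib_left[symmetric] sum_distrib_right[symmetric]
          Nr_def[symmetric] W_def[symmetric])
  qed
  have "d r * ?M * v = (?M * d r + ?N) * v"
    using commutator_d_M[OF Suc.prems(1,2)] by simp
  then have Md: "?M * (d r * v) = d r * (?M * v) - ?N * v"
    by (simp add: mult.assoc distrib_right)
  have "?N * ?M * u = (?M * ?N + 2 * W) * u"
    using commutator_N_M[OF Suc.prems(1,2)] unfolding W_def[symmetric] by simp
  then have MN: "?M * (?N * u) = ?N * (?M * u) - 2 * (W * u)"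
    by (simp add: mult.assoc distrib_right)
  have "Lr (n - 1) r * (?M * v) = ?M * (Lr (n - 1) r * v) - 2 * (d r * (?M * v))
     - (\<kappa> + 1 - of_nat n) * (?N * v) + 2 * (- (2 * of_nat k * (?N * v)) - c * (W * u))"
    unfolding mult.assoc[symmetric] commutator_L_M[OF Suc.prems(1,2)] distrib_right left_diff_distrib
    by (simp only: mult.assoc S)
  also have "?M * (Lr (n - 1) r * v) = ?M ^ Suc k * (Lr (n - 1) r * h)
     - 2 * of_nat k * (?M * (d r * v)) - c * (?M * (?N * u))"
    unfolding IH right_diff_distrib k c power_Suc by (simp only: mult.assoc)
  also have "\<dots> - 2 * (d r * (?M * v)) - (\<kappa> + 1 - of_nat n) * (?N * v)
      + 2 * (- (2 * of_nat k * (?N * v)) - c * (W * u))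
    = ?M ^ Suc k * (Lr (n - 1) r * h) - 2 * of_nat (Suc k) * (d r * (?M * v))
     - (c + (\<kappa> + 1 - of_nat n) + 2 * of_nat k) * (?N * v)"
    unfolding Md MN right_diff_distrib Mu
    by (simp add: algebra_simps mult_2)
  \<comment> \<open>Here \<open>k (\<kappa> + k - n)\<close> grows to its value at
    \<open>k + 1\<close>; this recursion fixes the coefficients of \<open>J\<close>.\<close>
  also have "c + (\<kappa> + 1 - of_nat n) + 2 * of_nat k = of_nat (Suc k) * (\<kappa> + of_nat (Suc k) - of_nat n)"
    by (simp add: c_def algebra_simps mult_2)
  finally show ?case by (simp only: v_def mult.assoc power_Suc diff_Suc_1)
qed

section \<open>Splitting off the last variable\<close>

lemma sum_atLeastAtMost_split:
  "0 < (n::nat) \<Longrightarrow> (\<Sum>a\<in>{1..n}. f a) = (\<Sum>a\<in>{1..<n}. f a) + (f n :: 'a)"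
  using sum.atLeastLessThan_Suc[of 1 n f] by (simp add: atLeastLessThanSuc_atLeastAtMost)

lemma Tr_split:
  assumes "0 < n"
  shows "Tr n r = (\<Sum>a\<in>{1..<n}. \<Sum>b\<in>{1..<n}. of_int (eps n r a b) * (s (a + b - r) * d a * d b))
    + 2 * (\<Sum>b\<in>{1..<n}. of_int (eps n r n b) * (s (n + b - r) * d n * d b))
    + of_int (eps n r n n) * (s (n + n - r) * d n * d n)"
proof -
  have "(\<Sum>a\<in>{1..<n}. of_int (eps n r a n) * (s (a + n - r) * d a * d n)) =
    (\<Sum>b\<in>{1..<n}. of_int (eps n r n b) * (s (n + b - r) * d n * d b))"
    by (intro sum.cong refl) (simp only: eps_commute[of n r _ n] add.commute mult.assoc d_commute)
  then show ?thesis
    unfolding Tr_def sum_atLeastAtMost_split[OF assms] sum.distrib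
    by (simp only: mult_2 add.assoc)
qed

text \<open>A pair \<open>(n, b)\<close> passes the bound in \<open>eps\<close> with nonzero sign
  only for \<open>b = r\<close>, and \<open>(n, n)\<close> never does. Among the old pairs, raising
  the bound admits exactly those with \<open>a + b = n + r\<close>, whose variable is
  \<open>s n\<close>.\<close>

lemma Lr_split:
  assumes "0 < r" "r < n"
  shows "Lr n r = Lr (n - 1) r + 2 * (s n * (d n * d r)) + s n * Nr n r"
proof -
  let ?I = "{1..<n}"
  have "(\<Sum>a\<in>?I. \<Sum>b\<in>?I. of_int (eps n r a b) * (s (a + b - r) * d a * d b)) =
    (\<Sum>a\<in>?I. \<Sum>b\<in>?I. of_int (eps (n - 1) r a b) * (s (a + b - r) * d a * d b)
        + s n * (of_bool (a + b = n + r) * (d a * d b)))"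
  proof (intro sum.cong refl, goal_cases)
    case (1 a b)
    show ?case
    proof (cases "a + b = n + r")
      case True
      then have "a + b - r = n" "r \<le> a" "r \<le> b" "\<not> a + b \<le> r + (n - 1)" using 1 by auto
      then have "eps n r a b = 1" "eps (n - 1) r a b = 0" using True by (simp_all add: eps_def)
      then show ?thesis using True by (simp only: mult.assoc \<open>a + b - r = n\<close>) simp
    next
      case False
      then have "eps n r a b = eps (n - 1) r a b" using assms by (auto simp: eps_def)
      then show ?thesis using False by simp
    qed
  qed
  also have "\<dots> = Tr (n - 1) r + s n * Nr n r"
    using assms Tr_eq[of n r] by (simp only: sum.distrib sum_distrib_left Nr_def)
  finally have 1: "(\<Sum>a\<in>?I. \<Sum>b\<in>?I. of_int (eps n r a b) * (s (a + b - r) * d a * d b))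
    = Tr (n - 1) r + s n * Nr n r" .
  have "(\<Sum>b\<in>?I. of_int (eps n r n b) * (s (n + b - r) * d n * d b)) =
    (\<Sum>b\<in>?I. if b = r then s n * d n * d r else 0)"
    using assms by (intro sum.cong) (auto simp: eps_def)
  also have "\<dots> = s n * d n * d r"
    using assms by (simp add: sum.delta)
  finally have 2: "(\<Sum>b\<in>?I. of_int (eps n r n b) * (s (n + b - r) * d n * d b)) = s n * d n * d r" .
  have 3: "eps n r n n = 0" using assms by (simp add: eps_def)
  have "0 < n" using assms by simp
  show ?thesis
    unfolding Lr_def Tr_split[OF \<open>0 < n\<close>, of r] 1 2 3
    by (simp only: of_int_0 mult_zero_left add_0_left add_0_right mult.assoc add_ac)
qed

lemma Lr_top:
  assumes "0 < n"
  shows "Lr n n = (\<kappa> + 1 - of_nat n) * d n + s n * (d n * d n) - Mr n"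
proof -
  let ?I = "{1..<n}"
  have "(\<Sum>a\<in>?I. \<Sum>b\<in>?I. of_int (eps n n a b) * (s (a + b - n) * d a * d b)) =
    (\<Sum>a\<in>?I. \<Sum>b\<in>?I. - (of_bool (n \<le> a + b) * (s (a + b - n) * d a * d b)))"
    by (intro sum.cong) (auto simp: eps_def)
  then have 1: "(\<Sum>a\<in>?I. \<Sum>b\<in>?I. of_int (eps n n a b) * (s (a + b - n) * d a * d b)) = - Mr n"
    by (simp only: sum_negf Mr_def)
  have 2: "(\<Sum>b\<in>?I. of_int (eps n n n b) * (s (n + b - n) * d n * d b)) = 0"
    by (intro sum.neutral) (auto simp: eps_def)
  have 3: "eps n n n n = 1" by (simp add: eps_def)
  show ?thesis
    unfolding Lr_def Tr_split[OF assms, of n] 1 2 3 by (simp add: mult.assoc)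
qed

section \<open>Action of \<open>L_r\<close> on partial sums of \<open>J\<close>\<close>

lemma of_nat_left_commute: "x * (of_nat k * y) = of_nat k * (x * y :: 'a)"
  by (simp only: mult.assoc[symmetric] mult_of_nat_commute[of k x])

lemma s_power_Suc: "of_nat k * (s n * (s n ^ (k - 1) * x)) = of_nat k * (s n ^ k * x)"
  by (cases k) (simp_all add: mult.assoc)

lemma d_s_power:
  assumes "0 < n"
  shows "d n * (s n ^ k * x) = s n ^ k * (d n * x) + of_nat k * (s n ^ (k - 1) * x)"
proof (induction k)
  case (Suc k)
  have "d n * (s n ^ Suc k * x) = s n * (d n * (s n ^ k * x)) + s n ^ k * x"
    using assms by (simp add: mult.assoc d_s_left)
  then show ?case
    by (simp add: Suc.IH distrib_left of_nat_left_commute[of "s n"] s_power_Suc distrib_right mult.assoc del: One_nat_def)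
qed simp

lemma commute_power_left:
  assumes "x * y = y * (x :: 'a)"
  shows "x * (y ^ k * z) = y ^ k * (x * z)"
proof -
  have "y ^ k * x = x * y ^ k" using assms[symmetric] by (rule power_commuting_commutes)
  then show ?thesis by (simp only: mult.assoc[symmetric])
qed

lemma sdd_s_commute:
  "0 < a \<Longrightarrow> a \<noteq> n \<Longrightarrow> 0 < b \<Longrightarrow> b \<noteq> n \<Longrightarrow> s c * d a * d b * s n = s n * (s c * d a * d b)"
  by (simp add: mult.assoc d_s d_s_left s_left_commute)

lemma Mr_s_commute: "Mr n * s n = s n * Mr n"
  unfolding Mr_def sum_distrib_left sum_distrib_right
proof (intro sum.cong refl, goal_cases)
  case (1 a b)
  then have "s (a + b - n) * d a * d b * s n = s n * (s (a + b - n) * d a * d b)"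
    by (intro sdd_s_commute) auto
  then show ?case by (simp only: mult.assoc of_bool_left_commute[of "s n"])
qed

lemma Nr_s_commute: "Nr n r * s n = s n * Nr n r"
  unfolding Nr_def sum_distrib_left sum_distrib_right
proof (intro sum.cong refl, goal_cases)
  case (1 a b)
  then have "s 0 * d a * d b * s n = s n * (s 0 * d a * d b)"
    by (intro sdd_s_commute) auto
  then show ?case by (simp only: s_0 mult_1_left mult.assoc of_bool_left_commute[of "s n"])
qed

lemma Lr_s_commute:
  assumes "0 < r" "r < n"
  shows "Lr (n - 1) r * s n = s n * Lr (n - 1) r"
proof -
  have "Tr (n - 1) r * s n = s n * Tr (n - 1) r"
    unfolding Tr_def sum_distrib_left sum_distrib_right
  proof (intro sum.cong refl, goal_cases)
    case (1 a b)
    then have "s (a + b - r) * d a * d b * s n = s n * (s (a + b - r) * d a * d b)"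
      by (intro sdd_s_commute) auto
    then show ?case by (simp only: mult.assoc of_int_left_commute[of "s n"])
  qed
  moreover have "(\<kappa> + 1 - of_nat r) * d r * s n = s n * ((\<kappa> + 1 - of_nat r) * d r)"
  proof -
    have "d r * s n = s n * d r" using assms by (simp add: d_s)
    moreover have "s n * (\<kappa> + 1 - of_nat r) = (\<kappa> + 1 - of_nat r) * s n"
      using scalar_commute[of "s n" 1 r] by simp
    ultimately show ?thesis by (metis mult.assoc)
  qed
  ultimately show ?thesis by (simp only: Lr_def distrib_left distrib_right)
qed

lemma Mr_d_commute:
  assumes "0 < n"
  shows "Mr n * d n = d n * Mr n"
  unfolding Mr_def sum_distrib_left sum_distrib_right
proof (intro sum.cong refl, goal_cases)
  case (1 a b)
  then have "n \<noteq> a + b - n" by auto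
  then have "d n * (s (a + b - n) * d a * d b) = s (a + b - n) * d a * d b * d n"
    using assms by (simp add: mult.assoc d_s_left d_commute d_left_commute)
  then show ?case by (simp only: mult.assoc of_bool_left_commute[of "d n"])
qed

lemma d_M_power_eq_0:
  assumes "0 < n" "d n * h = 0"
  shows "d n * (Mr n ^ k * h) = 0"
  using commute_power_left[OF Mr_d_commute[OF assms(1), symmetric]] assms(2) by simp

text \<open>A partial sum of \<open>J\<close> with the cutoff \<open>K\<close>. As
  \<open>s n\<close> commutes with \<open>M_n\<close>, the power of \<open>s_n M_n\<close> splits
  into \<open>s n ^ k\<close> and \<open>Mr n ^ k\<close>. The coefficients stay abstract: only
  centrality and their recursion are used.\<close>

definition Jpart :: "(nat \<Rightarrow> 'a) \<Rightarrow> nat \<Rightarrow> nat \<Rightarrow> 'a \<Rightarrow> 'a" where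
  "Jpart c n K h = (\<Sum>k\<le>K. c k * (s n ^ k * (Mr n ^ k * h)))"

lemma central_left_commute: "(\<And>x. x * c = c * x) \<Longrightarrow> x * (c * y) = c * (x * y :: 'a)"
  by (metis mult.assoc)

text \<open>The term \<open>2 s_n d_n d_r\<close> of \<open>Lr_split\<close> acts on
  \<open>s_n^k\<close> as \<open>2 k s_n^k d_r\<close> and cancels the first correction in
  \<open>L_M_power\<close>. The second correction of the \<open>k\<close>-th summand cancels the
  term \<open>s_n N\<close> of the previous summand by the recursion for \<open>c\<close>, so only
  the last such term survives.\<close>

lemma Lr_Jpart:
  assumes r: "0 < r" "r < n"
    and L: "\<And>b. r < b \<Longrightarrow> b < n \<Longrightarrow> Lr (n - 1) b * h = 0"
    and h: "d n * h = 0"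
    and c: "\<And>k x. x * c k = c k * x"
    and rec: "\<And>k. c k = of_nat (Suc k) * (\<kappa> + of_nat (Suc k) - of_nat n) * c (Suc k)"
  shows "Lr n r * Jpart c n K h = Jpart c n K (Lr (n - 1) r * h)
     + c K * (s n ^ Suc K * (Nr n r * (Mr n ^ K * h)))"
proof -
  let ?M = "Mr n" and ?N = "Nr n r"
  have "0 < n" using r by simp
  have dr: "d r * s n = s n * d r" using r by (simp add: d_s)
  have step: "Lr n r * (s n ^ k * v) = s n ^ k * (Lr (n - 1) r * v) + 2 * of_nat k * (s n ^ k * (d r * v))
      + s n ^ Suc k * (?N * v)" if v: "d n * v = 0" for k v
  proof -
    have "s n * (d n * d r) * (s n ^ k * v) = s n * (d r * (d n * (s n ^ k * v)))"
      by (simp only: mult.assoc d_left_commute)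
    also have "\<dots> = s n * (d r * (of_nat k * (s n ^ (k - 1) * v)))"
      by (simp add: d_s_power[OF \<open>0 < n\<close>] v)
    also have "\<dots> = of_nat k * (s n * (s n ^ (k - 1) * (d r * v)))"
      by (simp only: of_nat_left_commute commute_power_left[OF dr])
    finally have 1: "s n * (d n * d r) * (s n ^ k * v) = of_nat k * (s n ^ k * (d r * v))"
      by (simp only: s_power_Suc)
    show ?thesis
      unfolding Lr_split[OF r] distrib_right
      by (simp only: 1[unfolded mult.assoc] mult.assoc commute_power_left[OF Lr_s_commute[OF r]]
          commute_power_left[OF Nr_s_commute] power_Suc)
  qed
  have "Lr n r * (c k * (s n ^ k * (?M ^ k * h))) = c k * (s n ^ k * (?M ^ k * (Lr (n - 1) r * h)))
      - c k * (of_nat k * (\<kappa> + of_nat k - of_nat n) * (s n ^ k * (?N * (?M ^ (k - 1) * h))))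
      + c k * (s n ^ Suc k * (?N * (?M ^ k * h)))" for k
  proof -
    define e where "e = of_nat k * (\<kappa> + of_nat k - of_nat n :: 'a)"
    define g where "g = (2 * of_nat k :: 'a)"
    have e: "x * (e * y) = e * (x * y)" for x y
      unfolding e_def mult.assoc of_nat_left_commute[of x]
      using central_left_commute[OF scalar_commute] by simp
    have g: "x * (g * y) = g * (x * y)" for x y
      unfolding g_def using of_nat_left_commute[of x "2 * k"] by simp
    have "Lr n r * (c k * (s n ^ k * (?M ^ k * h))) = c k * (Lr n r * (s n ^ k * (?M ^ k * h)))"
      using c by (rule central_left_commute)
    also have "Lr n r * (s n ^ k * (?M ^ k * h)) = s n ^ k * (Lr (n - 1) r * (?M ^ k * h))
        + g * (s n ^ k * (d r * (?M ^ k * h))) + s n ^ Suc k * (?N * (?M ^ k * h))"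
      unfolding g_def by (rule step) (rule d_M_power_eq_0[OF \<open>0 < n\<close> h])
    also have "Lr (n - 1) r * (?M ^ k * h) = ?M ^ k * (Lr (n - 1) r * h)
        - g * (d r * (?M ^ k * h)) - e * (?N * (?M ^ (k - 1) * h))"
      unfolding g_def e_def using r L by (rule L_M_power)
    finally show ?thesis
      unfolding e_def[symmetric] by (simp add: right_diff_distrib distrib_left e g del: One_nat_def)
  qed
  then have "Lr n r * Jpart c n K h = Jpart c n K (Lr (n - 1) r * h)
     + (\<Sum>k\<le>K. c k * (s n ^ Suc k * (?N * (?M ^ k * h)))
        - c k * (of_nat k * (\<kappa> + of_nat k - of_nat n) * (s n ^ k * (?N * (?M ^ (k - 1) * h)))))"
    unfolding Jpart_def sum_distrib_left sum.distrib[symmetric]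
    by (intro sum.cong refl) (simp add: algebra_simps)
  also have "(\<Sum>k\<le>K. c k * (s n ^ Suc k * (?N * (?M ^ k * h)))
        - c k * (of_nat k * (\<kappa> + of_nat k - of_nat n) * (s n ^ k * (?N * (?M ^ (k - 1) * h)))))
      = c K * (s n ^ Suc K * (?N * (?M ^ K * h)))"
  proof (induction K)
    case (Suc K)
    have "c (Suc K) * (of_nat (Suc K) * (\<kappa> + of_nat (Suc K) - of_nat n) * y) = c K * y" for y
      unfolding rec[of K] c[of "of_nat (Suc K) * (\<kappa> + of_nat (Suc K) - of_nat n)" "Suc K"]
      by (simp only: mult.assoc)
    then show ?case using Suc.IH by simp
  qed simp
  finally show ?thesis .
qed

text \<open>On \<open>s_n^k v\<close> with \<open>d_n v = 0\<close>, the part of \<open>L_n\<close>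
  in \<open>s_n\<close> gives the factor
  \<open>k (\<kappa> + 1 - n) + k (k - 1) = k (\<kappa> + k - n)\<close>. By the recursion it
  cancels \<open>M_n\<close> applied to the previous summand, and the sum telescopes.\<close>

lemma Lr_top_Jpart:
  assumes "0 < n"
    and h: "d n * h = 0"
    and c: "\<And>k x. x * c k = c k * x"
    and rec: "\<And>k. c k = of_nat (Suc k) * (\<kappa> + of_nat (Suc k) - of_nat n) * c (Suc k)"
  shows "Lr n n * Jpart c n K h = - (c K * (s n ^ K * (Mr n ^ Suc K * h)))"
proof -
  let ?M = "Mr n"
  have step: "Lr n n * (s n ^ k * v) = of_nat k * (\<kappa> + of_nat k - of_nat n) * (s n ^ (k - 1) * v)
      - s n ^ k * (?M * v)" if v: "d n * v = 0" for k v
  proof -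
    have dv: "d n * (s n ^ k * v) = of_nat k * (s n ^ (k - 1) * v)" for k
      by (simp add: d_s_power[OF assms(1)] v)
    have "s n * (d n * (d n * (s n ^ k * v))) = of_nat k * (of_nat (k - 1) * (s n * (s n ^ (k - 1 - 1) * v)))"
      by (simp only: dv of_nat_left_commute[of "d n"] of_nat_left_commute[of "s n"])
    also have "\<dots> = of_nat k * (of_nat (k - 1) * (s n ^ (k - 1) * v))"
      by (simp only: s_power_Suc)
    finally have "Lr n n * (s n ^ k * v) = (\<kappa> + 1 - of_nat n) * (of_nat k * (s n ^ (k - 1) * v))
      + of_nat k * (of_nat (k - 1) * (s n ^ (k - 1) * v)) - s n ^ k * (?M * v)"
      unfolding Lr_top[OF assms(1)] left_diff_distrib distrib_right
      by (simp only: mult.assoc dv commute_power_left[OF Mr_s_commute] left_diff_distrib distrib_right)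
    also have "(\<kappa> + 1 - of_nat n) * (of_nat k * (s n ^ (k - 1) * v))
        + of_nat k * (of_nat (k - 1) * (s n ^ (k - 1) * v)) =
        of_nat k * ((\<kappa> + 1 - of_nat n + of_nat (k - 1)) * (s n ^ (k - 1) * v))"
      by (simp only: of_nat_left_commute[of "\<kappa> + 1 - of_nat n"] distrib_right distrib_left)
    also have "\<dots> = of_nat k * (\<kappa> + of_nat k - of_nat n) * (s n ^ (k - 1) * v)"
      by (cases k) (simp_all add: mult.assoc algebra_simps)
    finally show ?thesis .
  qed
  have "Lr n n * Jpart c n K h = (\<Sum>k\<le>K. c k * (of_nat k * (\<kappa> + of_nat k - of_nat n) * (s n ^ (k - 1) * (?M ^ k * h)))
     - c k * (s n ^ k * (?M ^ Suc k * h)))"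
    unfolding Jpart_def sum_distrib_left
  proof (intro sum.cong refl, goal_cases)
    case (1 k)
    have "Lr n n * (c k * (s n ^ k * (?M ^ k * h))) = c k * (Lr n n * (s n ^ k * (?M ^ k * h)))"
      using c by (rule central_left_commute)
    also have "Lr n n * (s n ^ k * (?M ^ k * h)) =
      of_nat k * (\<kappa> + of_nat k - of_nat n) * (s n ^ (k - 1) * (?M ^ k * h)) - s n ^ k * (?M * (?M ^ k * h))"
      by (rule step) (rule d_M_power_eq_0[OF assms(1) h])
    finally show ?case by (simp only: right_diff_distrib power_Suc mult.assoc)
  qed
  also have "\<dots> = - (c K * (s n ^ K * (?M ^ Suc K * h)))"
  proof (induction K)
    case (Suc K)
    have "c (Suc K) * (of_nat (Suc K) * (\<kappa> + of_nat (Suc K) - of_nat n) * y) = c K * y" for y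
      unfolding rec[of K] c[of "of_nat (Suc K) * (\<kappa> + of_nat (Suc K) - of_nat n)" "Suc K"]
      by (simp only: mult.assoc)
    then show ?case using Suc.IH by simp
  qed simp
  finally show ?thesis .
qed

end

subsection \<open>Linear operators on power series\<close>

declare One_nat_def [simp del]

definition lin :: "(nat mseries \<Rightarrow> nat mseries) \<Rightarrow> bool" where
  "lin f \<longleftrightarrow> (\<forall>c F G. f (\<lambda>m. c * F m + G m) = (\<lambda>m. c * f F m + f G m))"

text \<open>Linear operators form a noncommutative ring under composition, which is where the
  commutator identities are to be used; the series themselves are not elements of it.\<close>

typedef endo = "{f. lin f}" morphisms app Endo
  by (rule exI[of _ "\<lambda>F. F"]) (simp add: lin_def)

lemma app_linear: "app x (\<lambda>m. c * F m + G m) = (\<lambda>m. c * app x F m + app x G m)"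
  using app[of x] by (simp add: lin_def)

lemma app_Endo: "lin f \<Longrightarrow> app (Endo f) = f"
  by (simp add: Endo_inverse)

lemma app_add_arg: "app x (\<lambda>m. F m + G m) = (\<lambda>m. app x F m + app x G m)"
  using app_linear[of x 1] by simp

lemma app_0_arg: "app x (\<lambda>m. 0) = (\<lambda>m. 0)"
  using app_linear[of x "-1" "\<lambda>m. 0" "\<lambda>m. 0"] by simp

lemma app_scale_arg: "app x (\<lambda>m. c * F m) = (\<lambda>m. c * app x F m)"
  using app_linear[of x c F "\<lambda>m. 0"] by (simp add: app_0_arg)

lemma endo_eqI: "(\<And>F m. app x F m = app y F m) \<Longrightarrow> x = y"
  by (metis app_inject ext)

instantiation endo :: ring_1
begin

definition zero_endo :: endo where "0 = Endo (\<lambda>F m. 0)"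
definition one_endo :: endo where "1 = Endo (\<lambda>F. F)"
definition plus_endo :: "endo \<Rightarrow> endo \<Rightarrow> endo" where "x + y = Endo (\<lambda>F m. app x F m + app y F m)"
definition uminus_endo :: "endo \<Rightarrow> endo" where "- x = Endo (\<lambda>F m. - app x F m)"
definition minus_endo :: "endo \<Rightarrow> endo \<Rightarrow> endo" where "x - y = Endo (\<lambda>F m. app x F m - app y F m)"
definition times_endo :: "endo \<Rightarrow> endo \<Rightarrow> endo" where "x * y = Endo (\<lambda>F. app x (app y F))"

lemma app_zero [simp]: "app 0 F = (\<lambda>m. 0)"
  unfolding zero_endo_def by (subst app_Endo) (auto simp: lin_def)

lemma app_one [simp]: "app 1 F = F"
  unfolding one_endo_def by (subst app_Endo) (auto simp: lin_def)

lemma app_plus [simp]: "app (x + y) F = (\<lambda>m. app x F m + app y F m)"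
proof -
  have "lin (\<lambda>F m. app x F m + app y F m)"
    by (simp add: lin_def app_linear) (simp add: algebra_simps)
  then show ?thesis by (simp add: plus_endo_def app_Endo)
qed

lemma app_uminus [simp]: "app (- x) F = (\<lambda>m. - app x F m)"
proof -
  have "lin (\<lambda>F m. - app x F m)"
    by (simp add: lin_def app_linear)
  then show ?thesis by (simp add: uminus_endo_def app_Endo)
qed

lemma app_minus [simp]: "app (x - y) F = (\<lambda>m. app x F m - app y F m)"
proof -
  have "lin (\<lambda>F m. app x F m - app y F m)"
    by (simp add: lin_def app_linear) (simp add: algebra_simps)
  then show ?thesis by (simp add: minus_endo_def app_Endo)
qed

lemma app_times [simp]: "app (x * y) F = app x (app y F)"
  unfolding times_endo_def by (subst app_Endo) (auto simp: lin_def app_linear)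

instance
proof
  show "(0::endo) \<noteq> 1"
  proof
    assume "(0::endo) = 1"
    then have "app 0 (\<lambda>m. 1) 0 = app 1 (\<lambda>m. 1) 0" by simp
    then show False by simp
  qed
qed (rule endo_eqI, simp add: app_add_arg algebra_simps)+

end

lemma app_of_nat [simp]: "app (of_nat k) F = (\<lambda>m. of_nat k * F m)"
  by (induction k) (auto simp: algebra_simps)

lemma app_of_int [simp]: "app (of_int k) F = (\<lambda>m. of_int k * F m)"
  by (cases k rule: int_cases2) auto

lemma app_sum: "app (sum x A) F = (\<lambda>m. \<Sum>i\<in>A. app (x i) F m)"
  by (induction A rule: infinite_finite_induct) auto

lemma app_of_bool [simp]: "app (of_bool P) F = (\<lambda>m. of_bool P * F m)"
  by (cases P) auto

section \<open>The Weyl relations for operators on series\<close>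

definition svar :: "nat \<Rightarrow> endo" where "svar c = Endo (smult_var c)"
definition sder :: "nat \<Rightarrow> endo" where "sder a = Endo (mderiv a)"
definition scal :: "complex \<Rightarrow> endo" where "scal z = Endo (\<lambda>F m. z * F m)"

lemma app_svar [simp]: "app (svar c) F = smult_var c F"
  unfolding svar_def by (subst app_Endo) (auto simp: lin_def smult_var_def)

lemma app_sder [simp]: "app (sder c) F = mderiv c F"
  unfolding sder_def by (subst app_Endo) (auto simp: lin_def mderiv_def algebra_simps)

lemma app_scal [simp]: "app (scal z) F = (\<lambda>m. z * F m)"
  unfolding scal_def by (subst app_Endo) (auto simp: lin_def algebra_simps)

lemma scal_commute: "x * scal z = scal z * x"
  by (rule endo_eqI) (simp add: app_scale_arg)

lemma expo_diff_commute:
  "m - Poly_Mapping.single a 1 - Poly_Mapping.single b (1::nat) =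
    m - Poly_Mapping.single b 1 - Poly_Mapping.single a 1"
  by (rule poly_mapping_eqI) (simp add: lookup_minus)

lemma expo_add_diff:
  assumes "Poly_Mapping.lookup m a \<noteq> 0"
  shows "m - Poly_Mapping.single a (1::nat) + Poly_Mapping.single a 1 = m"
  using assms by (intro poly_mapping_eqI) (auto simp: lookup_minus lookup_add lookup_single when_def)

lemma expo_diff_add:
  assumes "Poly_Mapping.lookup m a \<noteq> 0"
  shows "m - Poly_Mapping.single a (1::nat) + x = m + x - Poly_Mapping.single a 1"
  using assms by (intro poly_mapping_eqI) (auto simp: lookup_minus lookup_add lookup_single when_def)

lemma smult_var_commute: "smult_var a (smult_var b F) = smult_var b (smult_var a F)"
proof (cases "a = b")
  case False
  have "smult_var a (smult_var b F) m = smult_var b (smult_var a F) m" for m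
    using False
    by (auto simp: smult_var_def lookup_minus lookup_single when_def expo_diff_commute[of _ a b])
  then show ?thesis by blast
qed simp

lemma mderiv_commute: "mderiv a (mderiv b F) = mderiv b (mderiv a F)"
proof (cases "a = b")
  case False
  then show ?thesis
    by (auto simp: mderiv_def lookup_add lookup_single when_def add.assoc add.commute add.left_commute mult.left_commute)
qed simp

lemma mderiv_smult_var:
  assumes "0 < a"
  shows "mderiv a (smult_var c F) = (\<lambda>m. smult_var c (mderiv a F) m + of_bool (a = c) * F m)"
proof (cases "c = 0")
  case True
  then show ?thesis using assms by (simp add: smult_var_def)
next
  case c: False
  show ?thesis
  proof (cases "a = c")
    case True
    have "mderiv a (smult_var c F) m = smult_var c (mderiv a F) m + of_bool (a = c) * F m" for m
      using c True
      by (cases "Poly_Mapping.lookup m c = 0")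
        (simp_all add: smult_var_def mderiv_def lookup_add lookup_minus expo_add_diff expo_add_diff[unfolded add.commute[of "_ - _"]] algebra_simps of_nat_diff)
    then show ?thesis by blast
  next
    case False
    have "mderiv a (smult_var c F) m = smult_var c (mderiv a F) m + of_bool (a = c) * F m" for m
      using c False
      by (cases "Poly_Mapping.lookup m c = 0")
        (simp_all add: smult_var_def mderiv_def lookup_add lookup_minus lookup_single expo_diff_add)
    then show ?thesis by blast
  qed
qed

lemma weyl_ring_endo: "weyl_ring svar sder (scal \<kappa>)"
proof
  show "svar 0 = 1" by (rule endo_eqI) (simp add: smult_var_def)
  show "svar a * svar b = svar b * svar a" for a b
    by (rule endo_eqI) (simp add: smult_var_commute)
  show "sder a * sder b = sder b * sder a" for a b
    by (rule endo_eqI) (simp add: mderiv_commute)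
  show "sder a * svar c = svar c * sder a + of_bool (a = c)" if "0 < a" for a c
    using that by (intro endo_eqI) (simp add: mderiv_smult_var)
  show "scal \<kappa> * x = x * scal \<kappa>" for x by (rule scal_commute[symmetric])
  show "x = 0" if "3 * x = 0" for x :: endo
  proof (rule endo_eqI)
    fix F m
    have "app (3 * x) F m = 0" using that by simp
    moreover have "(3::endo) = 1 + 1 + 1" by simp
    then have "3 * x = x + x + x" by (simp only: distrib_right mult_1_left)
    ultimately show "app x F m = app 0 F m" by simp
  qed
qed

interpretation endo: weyl_ring svar sder "scal \<kappa>" for \<kappa>
  by (rule weyl_ring_endo)

definition Lop :: "complex \<Rightarrow> nat \<Rightarrow> nat \<Rightarrow> nat mseries \<Rightarrow> nat mseries" where
  "Lop \<kappa> N r F = (\<lambda>m. (\<kappa> + 1 - of_nat r) * mderiv r F m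
     + (\<Sum>a\<in>{1..N}. \<Sum>b\<in>{1..N}. of_int (eps N r a b) * smult_var (a + b - r) (mderiv a (mderiv b F)) m))"

lemma app_Lr: "app (endo.Lr \<kappa> N r) F = Lop \<kappa> N r F"
  by (simp add: endo.Lr_def endo.Tr_def Lop_def app_sum algebra_simps)

lemma app_Mr: "app (endo.Mr n) F = Mop n F"
proof
  fix m
  let ?f = "\<lambda>(a, b). smult_var (a + b - n) (mderiv a (mderiv b F)) m"
  have "{(a, b). 0 < a \<and> a < n \<and> 0 < b \<and> b < n \<and> n \<le> a + b} =
      {p \<in> {1..<n} \<times> {1..<n}. case p of (a, b) \<Rightarrow> n \<le> a + b}" by auto
  then have "Mop n F m = (\<Sum>p\<in>{1..<n} \<times> {1..<n}. if (case p of (a, b) \<Rightarrow> n \<le> a + b) then ?f p else 0)"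
    unfolding Mop_def by (simp only:) (rule sum.inter_filter, simp)
  also have "\<dots> = (\<Sum>a\<in>{1..<n}. \<Sum>b\<in>{1..<n}. of_bool (n \<le> a + b) * ?f (a, b))"
    unfolding sum.cartesian_product by (intro sum.cong) auto
  also have "\<dots> = app (endo.Mr n) F m"
    unfolding endo.Mr_def app_sum by (simp only: app_times app_of_bool app_svar app_sder case_prod_conv)
  finally show "app (endo.Mr n) F m = Mop n F m" ..
qed

section \<open>From partial sums to the full operator \<open>J\<close>\<close>

definition jcoeff :: "complex \<Rightarrow> nat \<Rightarrow> nat \<Rightarrow> endo" where
  "jcoeff \<kappa> n k = scal (1 / (fact k * pochhammer (\<kappa> - of_nat n + 1) k))"

lemma jcoeff_commute: "x * jcoeff \<kappa> n k = jcoeff \<kappa> n k * x"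
  by (simp add: jcoeff_def scal_commute)

text \<open>Passing from \<open>k\<close> to \<open>k + 1\<close> multiplies the denominator by
  \<open>(k + 1) (\<kappa> - n + k + 1)\<close>. The hypothesis makes this factor nonzero, so that
  multiplying by it undoes the division.\<close>

lemma jcoeff_rec:
  assumes "\<And>k. \<kappa> + of_nat (Suc k) - of_nat n \<noteq> 0"
  shows "jcoeff \<kappa> n k = of_nat (Suc k) * (scal \<kappa> + of_nat (Suc k) - of_nat n) * jcoeff \<kappa> n (Suc k)"
proof -
  let ?p = "pochhammer (\<kappa> - of_nat n + 1)"
  have "?p (Suc k) = ?p k * (\<kappa> + of_nat (Suc k) - of_nat n)"
    by (simp add: pochhammer_Suc algebra_simps)
  moreover have "(of_nat (Suc k) :: complex) \<noteq> 0" by (simp del: of_nat_Suc)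
  ultimately have eq: "1 / (fact k * ?p k) =
      of_nat (Suc k) * (\<kappa> + of_nat (Suc k) - of_nat n) * (1 / (fact (Suc k) * ?p (Suc k)))"
    using assms[of k] by (simp add: divide_simps del: of_nat_Suc)
  define y where "y = 1 / (fact (Suc k) * ?p (Suc k))"
  show ?thesis
    unfolding jcoeff_def eq y_def[symmetric]
    by (intro endo_eqI) (simp add: algebra_simps)
qed

lemma Jpart_1: "endo.Jpart c n K h = endo.Jpart c n K 1 * h"
  by (simp add: endo.Jpart_def sum_distrib_right mult.assoc)

text \<open>This removes the remainders: each carries a power of \<open>s n\<close> larger than the
  \<open>s n\<close>-degree of the exponent under consideration.\<close>

lemma app_svar_power_eq_0:
  assumes "0 < n" "Poly_Mapping.lookup m n < k"
  shows "app (svar n ^ k * x) F m = 0"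
  using assms(2)
proof (induction k arbitrary: m)
  case (Suc k)
  then show ?case
    using assms(1) by (auto simp: smult_var_def lookup_minus mult.assoc)
qed simp

lemma funpow_sM: "((\<lambda>F. smult_var n (Mop n F)) ^^ k) F = app (svar n ^ k * endo.Mr n ^ k) F"
proof (induction k)
  case (Suc k)
  have "svar n ^ Suc k * endo.Mr n ^ Suc k = svar n * (svar n ^ k * (endo.Mr n * endo.Mr n ^ k))"
    by (simp add: mult.assoc)
  also have "svar n ^ k * (endo.Mr n * endo.Mr n ^ k) = endo.Mr n * (svar n ^ k * endo.Mr n ^ k)"
    by (rule endo.commute_power_left[symmetric]) (rule endo.Mr_s_commute)
  finally show ?case
    using Suc by (simp add: app_Mr)
qed simp

definition Jstep :: "complex \<Rightarrow> nat \<Rightarrow> nat mseries \<Rightarrow> nat mseries" where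
  "Jstep \<kappa> n = Jop (\<kappa> - of_nat n) (\<lambda>F. smult_var n (Mop n F))"

lemma Jstep_eq:
  assumes "0 < n" "Poly_Mapping.lookup m n \<le> K"
  shows "Jstep \<kappa> n F m = app (endo.Jpart (jcoeff \<kappa> n) n K 1) F m"
proof -
  let ?g = "\<lambda>k. ((\<lambda>F. smult_var n (Mop n F)) ^^ k) F m / (fact k * pochhammer (\<kappa> - of_nat n + 1) k)"
  have "?g k = 0" if "k \<notin> {..K}" for k
    using that assms by (simp add: funpow_sM app_svar_power_eq_0 del: app_times)
  then have "{k. ?g k \<noteq> 0} \<subseteq> {..K}" by blast
  then have "Jstep \<kappa> n F m = (\<Sum>k\<le>K. ?g k)"
    unfolding Jstep_def Jop_def by (intro Sum_any.expand_superset) auto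
  also have "\<dots> = app (endo.Jpart (jcoeff \<kappa> n) n K 1) F m"
    by (simp add: endo.Jpart_def app_sum funpow_sM jcoeff_def)
  finally show ?thesis .
qed

definition agree :: "nat \<Rightarrow> nat \<Rightarrow> nat mseries \<Rightarrow> nat mseries \<Rightarrow> bool" where
  "agree n K F G \<longleftrightarrow> (\<forall>m. Poly_Mapping.lookup m n \<le> K \<longrightarrow> F m = G m)"

lemma agree_mderiv: "agree n (Suc K) F G \<Longrightarrow> agree n K (mderiv a F) (mderiv a G)"
  by (auto simp: agree_def mderiv_def lookup_add lookup_single when_def)

lemma agree_smult_var: "agree n K F G \<Longrightarrow> agree n K (smult_var c F) (smult_var c G)"
  by (auto simp: agree_def smult_var_def lookup_minus)

lemma agree_mono: "agree n K F G \<Longrightarrow> K' \<le> K \<Longrightarrow> agree n K' F G"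
  by (auto simp: agree_def)

text \<open>Two derivatives can raise the exponent of \<open>s n\<close> that is read off by two,
  hence the margin of 2.\<close>

lemma agree_Lop:
  assumes "agree n (Suc (Suc K)) F G" "Poly_Mapping.lookup m n \<le> K"
  shows "Lop \<kappa> N r F m = Lop \<kappa> N r G m"
proof -
  have "agree n K (mderiv r F) (mderiv r G)"
    by (rule agree_mderiv) (rule agree_mono[OF assms(1)], simp)
  moreover have "agree n K (smult_var c (mderiv a (mderiv b F))) (smult_var c (mderiv a (mderiv b G)))" for a b c
    by (intro agree_smult_var agree_mderiv assms(1))
  ultimately show ?thesis
    using assms(2) by (simp add: agree_def Lop_def)
qed

text \<open>
  Multiplying by this operator from the right turns statements about the series \<open>H\<close> into
  identities between operators, to which the results on Weyl algebras apply.
\<close>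

definition rank1 :: "nat mseries \<Rightarrow> endo" where
  "rank1 H = Endo (\<lambda>F m. F 0 * H m)"

lemma app_rank1 [simp]: "app (rank1 H) F = (\<lambda>m. F 0 * H m)"
  unfolding rank1_def by (subst app_Endo) (auto simp: lin_def algebra_simps)

lemma mult_rank1_eq_0: "app x H = (\<lambda>m. 0) \<Longrightarrow> x * rank1 H = 0"
  by (rule endo_eqI) (simp add: app_scale_arg)

lemma Lop_Jstep:
  assumes r: "0 < r" "r < n"
    and H: "mderiv n H = (\<lambda>m. 0)"
    and L: "\<And>b. r < b \<Longrightarrow> b < n \<Longrightarrow> Lop \<kappa> (n - 1) b H = (\<lambda>m. 0)"
    and \<kappa>: "\<And>k. \<kappa> + of_nat (Suc k) - of_nat n \<noteq> 0"
  shows "Lop \<kappa> n r (Jstep \<kappa> n H) = Jstep \<kappa> n (Lop \<kappa> (n - 1) r H)"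
proof
  fix m :: "nat expo"
  define K where "K = Poly_Mapping.lookup m n"
  \<comment> \<open>Two more terms than the exponent \<open>m\<close> itself needs, because
    \<open>Lop\<close> is of second order.\<close>
  let ?J = "endo.Jpart (jcoeff \<kappa> n) n (Suc (Suc K))"
  let ?h = "rank1 H"
  have n: "0 < n" using r by simp
  have eq: "endo.Lr \<kappa> n r * (?J 1 * ?h) = ?J 1 * (endo.Lr \<kappa> (n - 1) r * ?h)
     + jcoeff \<kappa> n (Suc (Suc K)) * (svar n ^ Suc (Suc (Suc K)) * (endo.Nr n r * (endo.Mr n ^ Suc (Suc K) * ?h)))"
    unfolding Jpart_1[symmetric]
  proof (rule endo.Lr_Jpart[OF r])
    show "endo.Lr \<kappa> (n - 1) b * ?h = 0" if "r < b" "b < n" for b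
      using L[OF that] by (simp add: mult_rank1_eq_0 app_Lr)
    show "sder n * ?h = 0"
      using H by (simp add: mult_rank1_eq_0)
  qed (rule jcoeff_commute jcoeff_rec[OF \<kappa>])+
  have "agree n (Suc (Suc K)) (Jstep \<kappa> n H) (app (?J 1) H)"
    by (simp add: agree_def Jstep_eq[OF n])
  then have "Lop \<kappa> n r (Jstep \<kappa> n H) m = Lop \<kappa> n r (app (?J 1) H) m"
    by (rule agree_Lop) (simp add: K_def)
  \<comment> \<open>The series with all coefficients 1 serves only for its constant coefficient 1:
    \<open>rank1 H\<close> maps it to \<open>H\<close>.\<close>
  also have "\<dots> = app (endo.Lr \<kappa> n r * (?J 1 * ?h)) (\<lambda>m. 1) m"
    by (simp add: app_Lr)
  also have "\<dots> = app (?J 1) (Lop \<kappa> (n - 1) r H) m"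
    unfolding eq by (simp only: app_plus app_times[of "?J 1"] app_times[of "jcoeff \<kappa> n (Suc (Suc K))"])
      (simp add: app_svar_power_eq_0[OF n] K_def jcoeff_def app_Lr del: power_Suc app_times add: app_times[of _ "rank1 H"])
  also have "\<dots> = Jstep \<kappa> n (Lop \<kappa> (n - 1) r H) m"
    by (rule Jstep_eq[OF n, symmetric]) (simp add: K_def)
  finally show "Lop \<kappa> n r (Jstep \<kappa> n H) m = Jstep \<kappa> n (Lop \<kappa> (n - 1) r H) m" .
qed

lemma Lop_top_Jstep:
  assumes n: "0 < n"
    and H: "mderiv n H = (\<lambda>m. 0)"
    and \<kappa>: "\<And>k. \<kappa> + of_nat (Suc k) - of_nat n \<noteq> 0"
  shows "Lop \<kappa> n n (Jstep \<kappa> n H) = (\<lambda>m. 0)"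
proof
  fix m :: "nat expo"
  define K where "K = Poly_Mapping.lookup m n"
  let ?J = "endo.Jpart (jcoeff \<kappa> n) n (Suc (Suc K))"
  let ?h = "rank1 H"
  have eq: "endo.Lr \<kappa> n n * (?J 1 * ?h) =
     - (jcoeff \<kappa> n (Suc (Suc K)) * (svar n ^ Suc (Suc K) * (endo.Mr n ^ Suc (Suc (Suc K)) * ?h)))"
    unfolding Jpart_1[symmetric]
  proof (rule endo.Lr_top_Jpart[OF n])
    show "sder n * ?h = 0"
      using H by (simp add: mult_rank1_eq_0)
  qed (rule jcoeff_commute jcoeff_rec[OF \<kappa>])+
  have "agree n (Suc (Suc K)) (Jstep \<kappa> n H) (app (?J 1) H)"
    by (simp add: agree_def Jstep_eq[OF n])
  then have "Lop \<kappa> n n (Jstep \<kappa> n H) m = Lop \<kappa> n n (app (?J 1) H) m"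
    by (rule agree_Lop) (simp add: K_def)
  also have "\<dots> = app (endo.Lr \<kappa> n n * (?J 1 * ?h)) (\<lambda>m. 1) m"
    by (simp add: app_Lr)
  also have "\<dots> = 0"
    unfolding eq by (simp only: app_uminus app_times[of "jcoeff \<kappa> n (Suc (Suc K))"])
      (simp add: app_svar_power_eq_0[OF n] K_def jcoeff_def del: power_Suc app_times)
  finally show "Lop \<kappa> n n (Jstep \<kappa> n H) m = 0" .
qed

subsection \<open>The series \<open>G\<^sup>(\<^sup>n\<^sup>)\<close>\<close>

definition indep :: "nat \<Rightarrow> nat mseries \<Rightarrow> bool" where
  "indep a F \<longleftrightarrow> (\<forall>m. Poly_Mapping.lookup m a \<noteq> 0 \<longrightarrow> F m = 0)"

lemma indep_mderiv: "indep a F \<Longrightarrow> indep a (mderiv b F)"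
  by (auto simp: indep_def mderiv_def lookup_add)

lemma indep_smult_var: "indep a F \<Longrightarrow> c \<noteq> a \<or> c = 0 \<Longrightarrow> indep a (smult_var c F)"
  by (auto simp: indep_def smult_var_def lookup_minus lookup_single when_def)

lemma indep_sum: "(\<And>i. i \<in> I \<Longrightarrow> indep a (F i)) \<Longrightarrow> indep a (\<lambda>m. \<Sum>i\<in>I. F i m)"
  by (auto simp: indep_def intro!: sum.neutral)

text \<open>The variables in \<open>Mop n\<close> have index \<open>x + y - n < n\<close>; index 0
  stands for the factor 1 and brings in no variable.\<close>

lemma indep_Mop:
  assumes "indep a F" "a = 0 \<or> n \<le> a"
  shows "indep a (Mop n F)"
  unfolding Mop_def
proof (rule indep_sum, clarify, goal_cases)
  case (1 x y)
  then have "x + y - n \<noteq> a \<or> x + y - n = 0" using assms(2) by auto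
  then show ?case by (intro indep_smult_var indep_mderiv assms(1))
qed

lemma indep_Jstep:
  assumes "indep a F" "a = 0 \<or> n < a"
  shows "indep a (Jstep \<kappa> n F)"
proof -
  have "indep a (((\<lambda>F. smult_var n (Mop n F)) ^^ k) F)" for k
  proof (induction k)
    case (Suc k)
    have "indep a (Mop n (((\<lambda>F. smult_var n (Mop n F)) ^^ k) F))"
      using assms(2) by (intro indep_Mop Suc.IH) auto
    then show ?case
      using assms(2) by (auto intro!: indep_smult_var)
  qed (use assms in simp)
  then show ?thesis
    unfolding Jstep_def Jop_def indep_def by simp
qed

lemma indep_mderiv_eq_0: "indep a F \<Longrightarrow> mderiv a F = (\<lambda>m. 0)"
  by (auto simp: indep_def mderiv_def lookup_add)

lemma Gser_1: "Gser \<kappa> G 1 = in_s1 G"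
  by (simp add: Gser_def numeral_2_eq_2 One_nat_def)

lemma Gser_Suc: "0 < n \<Longrightarrow> Gser \<kappa> G (Suc n) = Jstep \<kappa> (Suc n) (Gser \<kappa> G n)"
  by (simp add: Gser_def Jstep_def)

text \<open>Exponents may formally contain the index 0, so it has to be excluded along with the
  indices above \<open>n\<close> to confine the support to \<open>s_1, ..., s_n\<close>.\<close>

lemma indep_Gser:
  assumes "0 < n" "a = 0 \<or> n < a"
  shows "indep a (Gser \<kappa> G n)"
  using assms
proof (induction n rule: nat_induct_non_zero)
  case 1
  have "Poly_Mapping.lookup m a = 0" if "Poly_Mapping.keys m \<subseteq> {1}" for m :: "nat expo"
  proof -
    have "a \<notin> {1}" using 1 by auto
    then have "a \<notin> Poly_Mapping.keys m" using that by blast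
    then show ?thesis by (simp add: in_keys_iff)
  qed
  then show ?case by (auto simp: Gser_1 indep_def in_s1_def)
next
  case (Suc n)
  then show ?case by (auto simp: Gser_Suc intro!: indep_Jstep)
qed

text \<open>The coefficients of \<open>\<kappa> G' + s G''\<close>, the value of \<open>L_1\<close>
  in one variable.\<close>

definition L1_shift :: "complex \<Rightarrow> complex fps \<Rightarrow> complex fps" where
  "L1_shift \<kappa> G = Abs_fps (\<lambda>k. of_nat (k + 1) * (\<kappa> + of_nat k) * fps_nth G (k + 1))"

lemma keys_add_nat: "Poly_Mapping.keys (m + m' :: 'a expo) = Poly_Mapping.keys m \<union> Poly_Mapping.keys m'"
  by (auto simp: in_keys_iff lookup_add)

lemma Lop_in_s1: "Lop \<kappa> 1 1 (in_s1 G) = in_s1 (L1_shift \<kappa> G)"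
proof
  fix m :: "nat expo"
  have L: "Lop \<kappa> 1 1 F m = \<kappa> * mderiv 1 F m + smult_var 1 (mderiv 1 (mderiv 1 F)) m" for F
    unfolding Lop_def atLeastAtMost_singleton
    by (simp only: sum.insert sum.empty finite.emptyI empty_iff simp_thms add_diff_cancel_right') (simp add: eps_def)
  show "Lop \<kappa> 1 1 (in_s1 G) m = in_s1 (L1_shift \<kappa> G) m"
  proof (cases "Poly_Mapping.lookup m 1 = 0")
    case True
    then show ?thesis
      by (auto simp: L smult_var_def mderiv_def in_s1_def L1_shift_def keys_add_nat lookup_add)
  next
    case False
    then obtain k where k: "Poly_Mapping.lookup m 1 = Suc k" by (cases "Poly_Mapping.lookup m 1") auto
    have "1 \<in> Poly_Mapping.keys m" using k by (simp add: in_keys_iff)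
    have "m - Poly_Mapping.single 1 1 + Poly_Mapping.single 1 1 = m"
      by (rule expo_add_diff[OF False])
    then have *: "mderiv 1 (mderiv 1 (in_s1 G)) (m - Poly_Mapping.single 1 1) =
      of_nat (Suc k) * (of_nat (Suc (Suc k)) * in_s1 G (m + Poly_Mapping.single 1 1))"
      by (simp add: mderiv_def lookup_minus k)
    show ?thesis
      by (simp add: L smult_var_def k *)
        (auto simp: mderiv_def k in_s1_def L1_shift_def keys_add_nat lookup_add algebra_simps)
  qed
qed

lemma Jstep_0: "0 < n \<Longrightarrow> Jstep \<kappa> n (\<lambda>m. 0) = (\<lambda>m. 0)"
  by (rule ext) (simp add: Jstep_eq[OF _ order_refl] app_0_arg)

lemma Lop_Gser:
  assumes "0 < n" "\<And>z. z < int n \<Longrightarrow> \<kappa> \<noteq> of_int z"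
  shows "Lop \<kappa> n 1 (Gser \<kappa> G n) = Gser \<kappa> (L1_shift \<kappa> G) n"
    and "2 \<le> r \<Longrightarrow> r \<le> n \<Longrightarrow> Lop \<kappa> n r (Gser \<kappa> G n) = (\<lambda>m. 0)"
proof -
  have "Lop \<kappa> n 1 (Gser \<kappa> G n) = Gser \<kappa> (L1_shift \<kappa> G) n \<and>
    (\<forall>r. 2 \<le> r \<and> r \<le> n \<longrightarrow> Lop \<kappa> n r (Gser \<kappa> G n) = (\<lambda>m. 0))"
    using assms
  proof (induction n rule: nat_induct_non_zero)
    case 1
    then show ?case by (auto simp: Gser_1 Lop_in_s1)
  next
    case (Suc n)
    let ?H = "Gser \<kappa> G n"
    have IH: "Lop \<kappa> n 1 ?H = Gser \<kappa> (L1_shift \<kappa> G) n"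
      "2 \<le> r \<Longrightarrow> r \<le> n \<Longrightarrow> Lop \<kappa> n r ?H = (\<lambda>m. 0)" for r
      using Suc by auto
    \<comment> \<open>Otherwise \<kappa> would be the integer \<open>n - k\<close>, which is less
      than \<open>n + 1\<close>.\<close>
    have \<kappa>: "\<kappa> + of_nat (Suc k) - of_nat (Suc n) \<noteq> 0" for k
      using Suc.prems[of "int n - int k"] by (auto simp: algebra_simps)
    have H: "mderiv (Suc n) ?H = (\<lambda>m. 0)"
      by (rule indep_mderiv_eq_0[OF indep_Gser[OF \<open>0 < n\<close>]]) simp
    \<comment> \<open>From \<open>0 < r < b\<close> follows \<open>b >= 2\<close>, so the operators
      that must annihilate \<open>?H\<close> are covered by the induction hypothesis.\<close>
    have step: "Lop \<kappa> (Suc n) r (Jstep \<kappa> (Suc n) ?H) = Jstep \<kappa> (Suc n) (Lop \<kappa> n r ?H)"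
      if "0 < r" "r < Suc n" for r
      using Lop_Jstep[OF that H _ \<kappa>] IH(2) that by simp
    have "Lop \<kappa> (Suc n) r (Gser \<kappa> G (Suc n)) = (\<lambda>m. 0)" if "2 \<le> r" "r \<le> Suc n" for r
    proof (cases "r = Suc n")
      case True
      then show ?thesis using Lop_top_Jstep[OF _ H \<kappa>] Suc by (simp add: Gser_Suc)
    next
      case False
      then show ?thesis using step[of r] IH(2)[of r] that Suc by (simp add: Gser_Suc Jstep_0)
    qed
    moreover have "Lop \<kappa> (Suc n) 1 (Gser \<kappa> G (Suc n)) = Gser \<kappa> (L1_shift \<kappa> G) (Suc n)"
      using step[of 1] IH(1) Suc by (simp add: Gser_Suc)
    ultimately show ?case by blast
  qed
  then show "Lop \<kappa> n 1 (Gser \<kappa> G n) = Gser \<kappa> (L1_shift \<kappa> G) n"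
    "2 \<le> r \<Longrightarrow> r \<le> n \<Longrightarrow> Lop \<kappa> n r (Gser \<kappa> G n) = (\<lambda>m. 0)" by blast+
qed

section \<open>Weights, and rescaling by a function of the weight\<close>

definition weight :: "('v \<Rightarrow> nat) \<Rightarrow> 'v expo \<Rightarrow> nat" where
  "weight f m = (\<Sum>i\<in>Poly_Mapping.keys m. f i * Poly_Mapping.lookup m i)"

lemma weight_superset:
  "finite A \<Longrightarrow> Poly_Mapping.keys m \<subseteq> A \<Longrightarrow> weight f m = (\<Sum>i\<in>A. f i * Poly_Mapping.lookup m i)"
  unfolding weight_def by (rule sum.mono_neutral_left) (auto simp: in_keys_iff)

lemma weight_add: "weight f (m + m') = weight f m + weight f m'"
proof -
  let ?A = "Poly_Mapping.keys m \<union> Poly_Mapping.keys m'"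
  have "weight f (m + m') = (\<Sum>i\<in>?A. f i * Poly_Mapping.lookup (m + m') i)"
    by (rule weight_superset) (auto simp: keys_add_nat)
  also have "\<dots> = (\<Sum>i\<in>?A. f i * Poly_Mapping.lookup m i) + (\<Sum>i\<in>?A. f i * Poly_Mapping.lookup m' i)"
    by (simp add: lookup_add algebra_simps sum.distrib)
  also have "\<dots> = weight f m + weight f m'"
    by (subst (1 2) weight_superset[of ?A]) auto
  finally show ?thesis .
qed

lemma weight_0 [simp]: "weight f 0 = 0"
  by (simp add: weight_def)

lemma weight_single [simp]: "weight f (Poly_Mapping.single a k) = f a * k"
  by (simp add: weight_def)

lemma weight_diff_single:
  "Poly_Mapping.lookup m a \<noteq> 0 \<Longrightarrow> weight f (m - Poly_Mapping.single a 1) + f a = weight f m"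
  using weight_add[of f "m - Poly_Mapping.single a 1" "Poly_Mapping.single a 1"] expo_add_diff[of m a]
  by simp

abbreviation wt :: "nat expo \<Rightarrow> nat" where "wt \<equiv> weight (\<lambda>i. i)"

text \<open>The scalar belongs to the weight before any operator has acted; \<open>j\<close> is the
  amount by which the weight has been lowered since.\<close>

definition graded_eq :: "(nat \<Rightarrow> complex) \<Rightarrow> nat \<Rightarrow> nat mseries \<Rightarrow> nat mseries \<Rightarrow> bool" where
  "graded_eq g j F F' \<longleftrightarrow> (\<forall>m. F m = g (wt m + j) * F' m)"

lemma graded_eq_mderiv:
  "graded_eq g j F F' \<Longrightarrow> graded_eq g (j + a) (mderiv a F) (mderiv a F')"
  by (auto simp: graded_eq_def mderiv_def weight_add add.assoc add.commute add.left_commute)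

lemma graded_eq_smult_var:
  assumes "graded_eq g (j + c) F F'"
  shows "graded_eq g j (smult_var c F) (smult_var c F')"
  unfolding graded_eq_def
proof
  fix m
  show "smult_var c F m = g (wt m + j) * smult_var c F' m"
  proof (cases "c = 0 \<or> Poly_Mapping.lookup m c = 0")
    case False
    then have "wt (m - Poly_Mapping.single c 1) + (j + c) = wt m + j"
      using weight_diff_single[of m c "\<lambda>i. i"] by simp
    then have "F (m - Poly_Mapping.single c 1) = g (wt m + j) * F' (m - Poly_Mapping.single c 1)"
      using assms[unfolded graded_eq_def, rule_format, of "m - Poly_Mapping.single c 1"] by (simp only:)
    then show ?thesis using False by (simp add: smult_var_def)
  qed (use assms in \<open>auto simp: graded_eq_def smult_var_def\<close>)
qed

lemma graded_eq_sum:
  "(\<And>i. i \<in> I \<Longrightarrow> graded_eq g j (F i) (F' i)) \<Longrightarrow> graded_eq g j (\<lambda>m. \<Sum>i\<in>I. F i m) (\<lambda>m. \<Sum>i\<in>I. F' i m)"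
  by (auto simp: graded_eq_def sum_distrib_left)

lemma graded_eq_Mop:
  assumes "graded_eq g 0 F F'"
  shows "graded_eq g n (Mop n F) (Mop n F')"
  unfolding Mop_def
proof (rule graded_eq_sum, clarify, goal_cases)
  case (1 a b)
  have "graded_eq g (0 + b + a) (mderiv a (mderiv b F)) (mderiv a (mderiv b F'))"
    by (intro graded_eq_mderiv assms)
  moreover have "0 + b + a = n + (a + b - n)" using 1 by simp
  ultimately show ?case by (intro graded_eq_smult_var) simp
qed

lemma graded_eq_Jstep:
  assumes "0 < n" "graded_eq g 0 F F'"
  shows "graded_eq g 0 (Jstep \<kappa> n F) (Jstep \<kappa> n F')"
proof -
  let ?A = "\<lambda>F. smult_var n (Mop n F)"
  have "graded_eq g 0 ((?A ^^ k) F) ((?A ^^ k) F')" for k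
  proof (induction k)
    case (Suc k)
    have "graded_eq g (0 + n) (Mop n ((?A ^^ k) F)) (Mop n ((?A ^^ k) F'))"
      using graded_eq_Mop[OF Suc.IH] by simp
    then show ?case by (simp add: graded_eq_smult_var)
  qed (use assms in simp)
  then have A: "(?A ^^ k) F m = g (wt m) * (?A ^^ k) F' m" for k m
    by (simp add: graded_eq_def)
  have "Jstep \<kappa> n F m = g (wt m) * Jstep \<kappa> n F' m" for m
    using A by (simp add: Jstep_eq[OF assms(1) order_refl] endo.Jpart_def app_sum jcoeff_def
      sum_distrib_left mult.left_commute funpow_sM[unfolded app_times, symmetric])
  then show ?thesis by (simp add: graded_eq_def)
qed

text \<open>\<open>M_n\<close> lowers the weight by \<open>n\<close> and \<open>s_n\<close> restores
  it, so every step is compatible with rescaling by weight. The starting series with all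
  coefficients 1 serves as a common reference.\<close>

lemma Gser_graded:
  assumes "0 < n"
  shows "Gser \<kappa> G n m = fps_nth G (wt m) * Gser \<kappa> (Abs_fps (\<lambda>_. 1)) n m"
proof -
  have "graded_eq (fps_nth G) 0 (Gser \<kappa> G n) (Gser \<kappa> (Abs_fps (\<lambda>_. 1)) n)"
    using assms
  proof (induction n rule: nat_induct_non_zero)
    case 1
    have "wt m = Poly_Mapping.lookup m 1" if "Poly_Mapping.keys m \<subseteq> {1}" for m
      using weight_superset[OF _ that, of "\<lambda>i. i"] by simp
    then show ?case by (simp add: graded_eq_def Gser_1 in_s1_def)
  next
    case (Suc n)
    then show ?case by (simp add: Gser_Suc graded_eq_Jstep)
  qed
  then show ?thesis by (simp add: graded_eq_def)
qed

subsection \<open>Derivatives of the coefficients of a characteristic polynomial\<close>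

definition derivation :: "('r::comm_ring_1 \<Rightarrow> 'r) \<Rightarrow> bool" where
  "derivation \<delta> \<longleftrightarrow> (\<forall>x y. \<delta> (x + y) = \<delta> x + \<delta> y) \<and> (\<forall>x y. \<delta> (x * y) = \<delta> x * y + x * \<delta> y)"

lemma derivation_add: "derivation \<delta> \<Longrightarrow> \<delta> (x + y) = \<delta> x + \<delta> y"
  and derivation_mult: "derivation \<delta> \<Longrightarrow> \<delta> (x * y) = \<delta> x * y + x * \<delta> y"
  by (simp_all add: derivation_def)

lemma derivation_0: "derivation \<delta> \<Longrightarrow> \<delta> 0 = 0"
  using derivation_add[of \<delta> 0 0] by simp

lemma derivation_1: "derivation \<delta> \<Longrightarrow> \<delta> 1 = 0"
  using derivation_mult[of \<delta> 1 1] by simp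

lemma derivation_minus: "derivation \<delta> \<Longrightarrow> \<delta> (- x) = - \<delta> x"
  using derivation_add[of \<delta> x "- x"] by (simp add: derivation_0 eq_neg_iff_add_eq_0 add.commute)

lemma derivation_sum: "derivation \<delta> \<Longrightarrow> \<delta> (sum f A) = (\<Sum>i\<in>A. \<delta> (f i))"
  by (induction A rule: infinite_finite_induct) (simp_all add: derivation_0 derivation_add)

lemma derivation_of_nat: "derivation \<delta> \<Longrightarrow> \<delta> (of_nat k) = 0"
  by (induction k) (simp_all add: derivation_0 derivation_add derivation_1)

lemma derivation_of_int: "derivation \<delta> \<Longrightarrow> \<delta> (of_int k) = 0"
  by (cases k rule: int_cases2) (simp_all add: derivation_of_nat derivation_minus)

lemma derivation_prod:
  assumes "derivation \<delta>" "finite A"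
  shows "\<delta> (prod f A) = (\<Sum>i\<in>A. \<delta> (f i) * prod f (A - {i}))"
  using assms(2)
proof (induction A rule: finite_induct)
  case (insert a A)
  have "(\<Sum>i\<in>A. \<delta> (f i) * prod f (insert a A - {i})) = f a * (\<Sum>i\<in>A. \<delta> (f i) * prod f (A - {i}))"
    unfolding sum_distrib_left
  proof (intro sum.cong refl, goal_cases)
    case (1 i)
    then have "insert a A - {i} = insert a (A - {i})" using insert by auto
    then show ?case using insert by (simp add: mult.left_commute)
  qed
  then show ?case
    using insert assms(1) by (simp add: derivation_mult)
qed (simp add: derivation_1 assms(1))

text \<open>Jacobi's formula. The product rule in the Leibniz expansion gives the sum of the
  determinants of \<open>R i\<close>, in which only row \<open>i\<close> is differentiated;
  expanding along that row leaves cofactors of \<open>A\<close>.\<close>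

lemma derivation_det:
  assumes \<delta>: "derivation \<delta>" and A: "A \<in> carrier_mat n n"
  shows "\<delta> (Determinant.det A) = (\<Sum>i<n. \<Sum>j<n. \<delta> (A $$ (i, j)) * cofactor A i j)"
proof -
  let ?P = "{p. p permutes {0..<n}}"
  define R where "R i = mat n n (\<lambda>(k, j). if k = i then \<delta> (A $$ (k, j)) else A $$ (k, j))" for i
  have R: "R i \<in> carrier_mat n n" for i by (simp add: R_def)
  have "\<delta> (Determinant.det A) = (\<Sum>p\<in>?P. signof p * (\<Sum>i<n. \<delta> (A $$ (i, p i)) * (\<Prod>k\<in>{0..<n} - {i}. A $$ (k, p k))))"
    unfolding det_def'[OF A] derivation_sum[OF \<delta>]
    by (simp add: derivation_mult[OF \<delta>] derivation_of_int[OF \<delta>] derivation_prod[OF \<delta>] atLeast0LessThan)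
  also have "\<dots> = (\<Sum>i<n. \<Sum>p\<in>?P. signof p * (\<delta> (A $$ (i, p i)) * (\<Prod>k\<in>{0..<n} - {i}. A $$ (k, p k))))"
    unfolding sum_distrib_left by (rule sum.swap)
  also have "\<dots> = (\<Sum>i<n. Determinant.det (R i))"
  proof (intro sum.cong refl, goal_cases)
    case (1 i)
    show ?case
      unfolding det_def'[OF R]
    proof (intro sum.cong refl, goal_cases)
      case (1 p)
      then have p: "p permutes {0..<n}" by simp
      have pk: "p k < n" if "k < n" for k using permutes_in_image[OF p, of k] that by simp
      have "(\<Prod>k\<in>{0..<n}. R i $$ (k, p k)) = R i $$ (i, p i) * (\<Prod>k\<in>{0..<n} - {i}. R i $$ (k, p k))"
        using \<open>i \<in> {..<n}\<close> by (intro prod.remove) auto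
      also have "(\<Prod>k\<in>{0..<n} - {i}. R i $$ (k, p k)) = (\<Prod>k\<in>{0..<n} - {i}. A $$ (k, p k))"
        by (intro prod.cong) (auto simp: R_def pk)
      also have "R i $$ (i, p i) = \<delta> (A $$ (i, p i))"
        using \<open>i \<in> {..<n}\<close> by (simp add: R_def pk)
      finally show ?case by simp
    qed
  qed
  also have "\<dots> = (\<Sum>i<n. \<Sum>j<n. \<delta> (A $$ (i, j)) * cofactor A i j)"
  proof (rule sum.cong[OF refl], goal_cases)
    case (1 i)
    have "mat_delete (R i) i j = mat_delete A i j" if "j < n" for j
      using A that 1 unfolding mat_delete_def R_def by (intro eq_matI) auto
    then show ?case
      using 1 by (subst laplace_expansion_row[OF R, of i]) (auto simp: cofactor_def R_def intro!: sum.cong)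
  qed
  finally show ?thesis .
qed

lemma derivation_map_poly:
  assumes "derivation \<delta>"
  shows "derivation (map_poly \<delta>)"
proof -
  have c: "coeff (map_poly \<delta> p) i = \<delta> (coeff p i)" for p i
    by (rule coeff_map_poly) (rule derivation_0[OF assms])
  show ?thesis
    unfolding derivation_def
    by (auto intro!: poly_eqI simp: c derivation_add[OF assms] coeff_mult derivation_sum[OF assms]
        derivation_mult[OF assms] sum.distrib)
qed

text \<open>The Euler operator \<open>\<lambda> d/d\<lambda>\<close>, the derivation that will
  account for the factor \<open>r - 1\<close>.\<close>

definition euler_poly :: "'r::comm_ring_1 poly \<Rightarrow> 'r poly" where
  "euler_poly p = (\<Sum>i\<le>degree p. monom (of_nat i * coeff p i) i)"

lemma coeff_euler_poly: "coeff (euler_poly p) i = of_nat i * coeff p i"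
  by (auto simp: euler_poly_def coeff_sum coeff_eq_0 sum.delta)

lemma derivation_euler_poly: "derivation euler_poly"
proof -
  have "of_nat k * (\<Sum>i\<le>k. coeff p i * coeff q (k - i)) =
    (\<Sum>i\<le>k. of_nat i * coeff p i * coeff q (k - i)) + (\<Sum>i\<le>k. coeff p i * (of_nat (k - i) * coeff q (k - i)))"
    for p q :: "'a poly" and k
    unfolding sum_distrib_left sum.distrib[symmetric]
    by (intro sum.cong refl) (simp add: of_nat_diff algebra_simps)
  then show ?thesis
    unfolding derivation_def
    by (auto intro!: poly_eqI simp: coeff_euler_poly distrib_left coeff_mult)
qed

text \<open>The coefficients of \<open>q - r\<close> solve a triangular system with ones on the
  diagonal. This replaces division by a determinant in an arbitrary commutative ring.\<close>

lemma poly_mult_cancel_unit_constant: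
  assumes "coeff p 0 = (1::'r::comm_ring_1)" "p * q = p * r"
  shows "q = r"
proof -
  have "p * (q - r) = 0" using assms(2) by (simp add: algebra_simps)
  then have 0: "(\<Sum>i\<le>k. coeff p i * coeff (q - r) (k - i)) = 0" for k
    by (metis coeff_0 coeff_mult)
  have "coeff (q - r) k = 0" for k
  proof (induction k rule: less_induct)
    case (less k)
    have "(\<Sum>i\<le>k. coeff p i * coeff (q - r) (k - i)) = (\<Sum>i\<in>{0}. coeff p i * coeff (q - r) (k - i))"
      using less by (intro sum.mono_neutral_right) auto
    then show ?case using 0[of k] assms(1) by simp
  qed
  then have "q - r = 0" by (intro poly_eqI) simp
  then show ?thesis by simp
qed

section \<open>The matrix \<open>1 + \<lambda> X T^t\<close> and its adjugate\<close>

locale matrix_derivations =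
  fixes n :: nat and D :: "nat \<Rightarrow> nat \<Rightarrow> 'r::comm_ring_1 \<Rightarrow> 'r" and t x :: "nat \<Rightarrow> nat \<Rightarrow> 'r"
  assumes D: "derivation (D i j)"
    and D_t: "i < n \<Longrightarrow> j < n \<Longrightarrow> k < n \<Longrightarrow> l < n \<Longrightarrow> D i j (t k l) = of_bool (i = k \<and> j = l)"
    and D_x: "D i j (x k l) = 0"
begin

definition xt :: "nat \<Rightarrow> nat \<Rightarrow> 'r" where "xt i j = (\<Sum>k<n. x i k * t j k)"

definition Bm :: "'r poly mat" where "Bm = mat n n (\<lambda>(i, j). [:of_bool (i = j), xt i j:])"

definition sg :: "'r poly" where "sg = Determinant.det Bm"

definition adj :: "nat \<Rightarrow> nat \<Rightarrow> 'r poly" where "adj i j = adj_mat Bm $$ (i, j)"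

definition zp :: "nat \<Rightarrow> nat \<Rightarrow> 'r poly" where "zp i j = (\<Sum>p<n. adj i p * [:x p j:])"

definition ay :: "nat \<Rightarrow> nat \<Rightarrow> 'r poly" where "ay i k = (\<Sum>p<n. adj i p * [:xt p k:])"

lemma Bm_carrier: "Bm \<in> carrier_mat n n"
  by (simp add: Bm_def)

lemma Bm_index: "i < n \<Longrightarrow> j < n \<Longrightarrow> Bm $$ (i, j) = [:of_bool (i = j), xt i j:]"
  by (simp add: Bm_def)

lemma adj_eq_cofactor: "i < n \<Longrightarrow> j < n \<Longrightarrow> adj i j = cofactor Bm j i"
  using Bm_carrier by (simp add: adj_def adj_mat_def)

lemma adj_Bm: "i < n \<Longrightarrow> j < n \<Longrightarrow> (\<Sum>k<n. adj i k * Bm $$ (k, j)) = of_bool (i = j) * sg"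
  using arg_cong[OF adj_mat(3)[OF Bm_carrier], of "\<lambda>M. M $$ (i, j)"] adj_mat(1)[OF Bm_carrier] Bm_carrier
  by (simp add: scalar_prod_def adj_def sg_def atLeast0LessThan del: index_mult_mat(1)) (auto simp: scalar_prod_def atLeast0LessThan)

lemma Bm_adj: "i < n \<Longrightarrow> j < n \<Longrightarrow> (\<Sum>k<n. Bm $$ (i, k) * adj k j) = of_bool (i = j) * sg"
  using arg_cong[OF adj_mat(2)[OF Bm_carrier], of "\<lambda>M. M $$ (i, j)"] adj_mat(1)[OF Bm_carrier] Bm_carrier
  by (simp add: scalar_prod_def adj_def sg_def atLeast0LessThan del: index_mult_mat(1)) (auto simp: scalar_prod_def atLeast0LessThan)

lemma derivation_sg:
  assumes "derivation \<delta>"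
  shows "\<delta> sg = (\<Sum>p<n. \<Sum>q<n. \<delta> (Bm $$ (p, q)) * adj q p)"
  unfolding sg_def derivation_det[OF assms Bm_carrier] by (intro sum.cong refl) (simp add: adj_eq_cofactor)

text \<open>The derivative of an inverse matrix without denominators: differentiate
  \<open>Bm * adj = sg\<close> and multiply by the adjugate from the left.\<close>

lemma derivation_adj:
  assumes \<delta>: "derivation \<delta>" and "h < n" "j < n"
  shows "sg * \<delta> (adj h j) = \<delta> sg * adj h j - (\<Sum>p<n. \<Sum>q<n. adj h p * \<delta> (Bm $$ (p, q)) * adj q j)"
proof -
  have "(\<Sum>q<n. \<delta> (Bm $$ (p, q)) * adj q j + Bm $$ (p, q) * \<delta> (adj q j)) = of_bool (p = j) * \<delta> sg" if "p < n" for p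
  proof -
    have "\<delta> (of_bool (p = j) * sg) = of_bool (p = j) * \<delta> sg"
      by (simp add: derivation_0[OF \<delta>])
    then show ?thesis
      unfolding Bm_adj[OF that assms(3), symmetric] by (simp add: derivation_sum[OF \<delta>] derivation_mult[OF \<delta>])
  qed
  then have "(\<Sum>p<n. adj h p * (\<Sum>q<n. \<delta> (Bm $$ (p, q)) * adj q j + Bm $$ (p, q) * \<delta> (adj q j))) =
     (\<Sum>p<n. adj h p * (of_bool (p = j) * \<delta> sg))" by simp
  also have "\<dots> = adj h j * \<delta> sg"
  proof -
    have "(\<Sum>p<n. adj h p * (of_bool (p = j) * \<delta> sg)) = (\<Sum>p<n. if p = j then adj h p * \<delta> sg else 0)"
      by (intro sum.cong) auto
    then show ?thesis using assms(3) by (simp add: sum.delta)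
  qed
  also have "(\<Sum>p<n. adj h p * (\<Sum>q<n. \<delta> (Bm $$ (p, q)) * adj q j + Bm $$ (p, q) * \<delta> (adj q j))) =
    (\<Sum>p<n. \<Sum>q<n. adj h p * \<delta> (Bm $$ (p, q)) * adj q j) + (\<Sum>p<n. \<Sum>q<n. adj h p * Bm $$ (p, q) * \<delta> (adj q j))"
    by (simp add: sum.distrib sum_distrib_left distrib_left mult.assoc)
  also have "(\<Sum>p<n. \<Sum>q<n. adj h p * Bm $$ (p, q) * \<delta> (adj q j)) = (\<Sum>q<n. (\<Sum>p<n. adj h p * Bm $$ (p, q)) * \<delta> (adj q j))"
    unfolding sum_distrib_right by (rule sum.swap)
  also have "\<dots> = (\<Sum>q<n. if q = h then sg * \<delta> (adj q j) else 0)"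
    by (intro sum.cong refl) (auto simp: adj_Bm assms(2))
  also have "\<dots> = sg * \<delta> (adj h j)" using assms(2) by (simp add: sum.delta)
  finally show ?thesis by (simp add: algebra_simps)
qed

abbreviation lam :: "'r poly" where "lam \<equiv> [:0, 1:]"

definition Dp :: "nat \<Rightarrow> nat \<Rightarrow> 'r poly \<Rightarrow> 'r poly" where "Dp i j = map_poly (D i j)"

lemma coeff_Dp: "coeff (Dp i j p) k = D i j (coeff p k)"
  unfolding Dp_def by (rule coeff_map_poly) (rule derivation_0[OF D])

lemma derivation_Dp: "derivation (Dp i j)"
  unfolding Dp_def by (rule derivation_map_poly[OF D])

lemma Dp_const: "D i j c = 0 \<Longrightarrow> Dp i j [:c:] = 0"
  by (rule poly_eqI) (simp add: coeff_Dp coeff_pCons derivation_0[OF D] split: nat.split)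

lemma D_xt:
  assumes "i < n" "l < n" "q < n"
  shows "D i l (xt p q) = of_bool (q = i) * x p l"
proof -
  have "D i l (xt p q) = (\<Sum>k<n. if k = l then of_bool (q = i) * x p k else 0)"
    using assms by (auto simp: xt_def derivation_sum[OF D] derivation_mult[OF D] D_x D_t intro!: sum.cong)
  then show ?thesis using assms by (simp add: sum.delta)
qed

lemma Dp_Bm:
  assumes "i < n" "l < n" "p < n" "q < n"
  shows "Dp i l (Bm $$ (p, q)) = of_bool (q = i) * (lam * [:x p l:])"
proof -
  have "D i l (of_bool (p = q)) = 0" by (cases "p = q") (simp_all add: derivation_0[OF D] derivation_1[OF D])
  then show ?thesis
    using assms by (intro poly_eqI) (auto simp: coeff_Dp Bm_index coeff_pCons D_xt derivation_0[OF D] split: nat.split)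
qed

lemma euler_Bm:
  assumes "p < n" "q < n"
  shows "euler_poly (Bm $$ (p, q)) = lam * [:xt p q:]"
  using assms by (intro poly_eqI) (auto simp: coeff_euler_poly Bm_index coeff_pCons split: nat.split)

lemma euler_const: "euler_poly [:c:] = 0"
  by (rule poly_eqI) (simp add: coeff_euler_poly coeff_pCons split: nat.split)

lemma Dp_sg:
  assumes "i < n" "l < n"
  shows "Dp i l sg = lam * zp i l"
proof -
  have "Dp i l sg = (\<Sum>p<n. \<Sum>q<n. if q = i then lam * [:x p l:] * adj q p else 0)"
    unfolding derivation_sg[OF derivation_Dp] using assms by (intro sum.cong refl) (simp add: Dp_Bm)
  also have "\<dots> = lam * zp i l"
    unfolding zp_def sum_distrib_left using assms by (intro sum.cong refl) (simp add: sum.delta mult.commute mult.left_commute)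
  finally show ?thesis .
qed

lemma Dp_adj:
  assumes "i < n" "l < n" "h < n" "j < n"
  shows "sg * Dp i l (adj h j) = lam * (zp i l * adj h j - zp h l * adj i j)"
proof -
  have "(\<Sum>p<n. \<Sum>q<n. adj h p * Dp i l (Bm $$ (p, q)) * adj q j) =
      (\<Sum>p<n. \<Sum>q<n. if q = i then adj h p * (lam * [:x p l:]) * adj q j else 0)"
    using assms by (intro sum.cong refl) (simp add: Dp_Bm)
  also have "\<dots> = lam * (zp h l * adj i j)"
    unfolding zp_def sum_distrib_left sum_distrib_right
    using assms by (intro sum.cong refl) (simp add: sum.delta mult.commute mult.left_commute)
  finally have eq: "(\<Sum>p<n. \<Sum>q<n. adj h p * Dp i l (Bm $$ (p, q)) * adj q j) = lam * (zp h l * adj i j)" .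
  show ?thesis
    unfolding derivation_adj[OF derivation_Dp assms(3,4)] eq Dp_sg[OF assms(1,2)]
    by (simp only: right_diff_distrib mult.assoc)
qed

text \<open>Only column \<open>i\<close> of \<open>Bm\<close> contains \<open>t i l\<close>, so the
  matrix product in \<open>derivation_adj\<close> collapses to one term. The outcome is \<lambda>
  times a 2 by 2 minor of \<open>zp\<close>.\<close>

lemma Dp_zp:
  assumes "i < n" "l < n" "k < n" "j < n"
  shows "sg * Dp i l (zp k j) = lam * (zp i l * zp k j - zp k l * zp i j)"
proof -
  have "sg * Dp i l (zp k j) = (\<Sum>p<n. sg * Dp i l (adj k p) * [:x p j:])"
    by (simp only: zp_def derivation_sum[OF derivation_Dp] derivation_mult[OF derivation_Dp] Dp_const[OF D_x]
        mult_zero_right add_0_right sum_distrib_left mult.assoc)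
  also have "\<dots> = (\<Sum>p<n. lam * (zp i l * adj k p - zp k l * adj i p) * [:x p j:])"
    using assms by (intro sum.cong refl) (simp add: Dp_adj)
  also have "\<dots> = lam * (zp i l * zp k j - zp k l * zp i j)"
    unfolding zp_def[of k j] zp_def[of i j]
    by (simp only: sum_distrib_left sum_subtractf left_diff_distrib right_diff_distrib mult.assoc)
  finally show ?thesis .
qed

lemma ay_eq: "ay i k = (\<Sum>l<n. zp i l * [:t k l:])"
proof -
  have "ay i k = (\<Sum>p<n. \<Sum>l<n. adj i p * [:x p l:] * [:t k l:])"
  proof -
    have "[:xt p k:] = (\<Sum>l<n. [:x p l:] * [:t k l:])" for p
      by (rule poly_eqI) (auto simp add: coeff_sum xt_def coeff_pCons mult.commute split: nat.split)
    then show ?thesis by (simp only: ay_def sum_distrib_left mult.assoc)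
  qed
  also have "\<dots> = (\<Sum>l<n. zp i l * [:t k l:])"
    unfolding zp_def sum_distrib_right by (rule sum.swap)
  finally show ?thesis .
qed

lemma euler_sg: "euler_poly sg = lam * (\<Sum>k<n. ay k k)"
proof -
  have "euler_poly sg = (\<Sum>p<n. \<Sum>q<n. lam * (adj q p * [:xt p q:]))"
    unfolding derivation_sg[OF derivation_euler_poly] by (intro sum.cong refl) (simp add: euler_Bm)
  also have "\<dots> = (\<Sum>q<n. \<Sum>p<n. lam * (adj q p * [:xt p q:]))" by (rule sum.swap)
  finally show ?thesis by (simp only: ay_def sum_distrib_left)
qed

lemma euler_adj:
  assumes "h < n" "j < n"
  shows "sg * euler_poly (adj h j) = euler_poly sg * adj h j - lam * (\<Sum>q<n. ay h q * adj q j)"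
proof -
  have "(\<Sum>p<n. \<Sum>q<n. adj h p * euler_poly (Bm $$ (p, q)) * adj q j) =
      (\<Sum>p<n. \<Sum>q<n. lam * (adj h p * [:xt p q:] * adj q j))"
    by (intro sum.cong refl) (simp add: euler_Bm mult_ac)
  also have "\<dots> = (\<Sum>q<n. \<Sum>p<n. lam * (adj h p * [:xt p q:] * adj q j))" by (rule sum.swap)
  also have "\<dots> = lam * (\<Sum>q<n. ay h q * adj q j)"
    by (simp only: ay_def sum_distrib_left sum_distrib_right)
  finally show ?thesis
    using derivation_adj[OF derivation_euler_poly assms] by simp
qed

lemma euler_zp:
  assumes "i < n" "j < n"
  shows "sg * euler_poly (zp i j) = euler_poly sg * zp i j - lam * (\<Sum>k<n. ay i k * zp k j)"
proof -
  have "sg * euler_poly (zp i j) = (\<Sum>p<n. sg * euler_poly (adj i p) * [:x p j:])"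
    by (simp only: zp_def derivation_sum[OF derivation_euler_poly] derivation_mult[OF derivation_euler_poly] euler_const
        mult_zero_right add_0_right sum_distrib_left mult.assoc)
  also have "\<dots> = (\<Sum>p<n. (euler_poly sg * adj i p - lam * (\<Sum>q<n. ay i q * adj q p)) * [:x p j:])"
    using assms by (intro sum.cong refl) (simp add: euler_adj)
  also have "\<dots> = euler_poly sg * zp i j - lam * (\<Sum>p<n. \<Sum>q<n. ay i q * (adj q p * [:x p j:]))"
    unfolding zp_def[of i j]
    by (simp only: sum_distrib_left sum_distrib_right sum_subtractf left_diff_distrib mult.assoc)
  also have "(\<Sum>p<n. \<Sum>q<n. ay i q * (adj q p * [:x p j:])) = (\<Sum>q<n. \<Sum>p<n. ay i q * (adj q p * [:x p j:]))"
    by (rule sum.swap)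
  also have "\<dots> = (\<Sum>k<n. ay i k * zp k j)"
    by (simp only: zp_def sum_distrib_left)
  finally show ?thesis .
qed

lemma coeff_sg_0: "coeff sg 0 = 1"
proof -
  interpret h: comm_ring_hom "\<lambda>p. coeff (p :: 'r poly) 0"
    by unfold_locales (simp_all add: coeff_mult)
  have "coeff sg 0 = Determinant.det (map_mat (\<lambda>p. coeff p 0) Bm)"
    by (simp add: sg_def h.hom_det)
  also have "map_mat (\<lambda>p. coeff p 0) Bm = 1\<^sub>m n"
    by (rule eq_matI) (auto simp: Bm_def)
  finally show ?thesis by simp
qed

text \<open>
  Both sides become the same after multiplication by \<open>det (1 + \<lambda> X T\<^sup>t)\<close>, which has constant
  coefficient \<open>1\<close> and hence can be cancelled.
\<close>

lemma sum_t_Dp_zp: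
  assumes "i < n" "j < n"
  shows "(\<Sum>k<n. \<Sum>l<n. [:t k l:] * Dp i l (zp k j)) = - euler_poly (zp i j)"
proof (rule poly_mult_cancel_unit_constant[OF coeff_sg_0])
  have "sg * (\<Sum>k<n. \<Sum>l<n. [:t k l:] * Dp i l (zp k j)) =
     (\<Sum>k<n. \<Sum>l<n. [:t k l:] * (sg * Dp i l (zp k j)))"
    by (simp only: sum_distrib_left mult.left_commute)
  also have "\<dots> = (\<Sum>k<n. \<Sum>l<n. lam * (zp i l * [:t k l:] * zp k j) - lam * (zp k l * [:t k l:] * zp i j))"
    using assms by (intro sum.cong refl) (simp add: Dp_zp algebra_simps)
  also have "\<dots> = lam * (\<Sum>k<n. ay i k * zp k j) - lam * ((\<Sum>k<n. ay k k) * zp i j)"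
    unfolding ay_eq by (simp only: sum_distrib_left sum_distrib_right sum_subtractf)
  also have "\<dots> = sg * - euler_poly (zp i j)"
    using euler_zp[OF assms] by (simp add: euler_sg algebra_simps)
  finally show "sg * (\<Sum>k<n. \<Sum>l<n. [:t k l:] * Dp i l (zp k j)) = sg * - euler_poly (zp i j)" .
qed

section \<open>Comparing coefficients in \<lambda>\<close>

definition S :: "nat \<Rightarrow> 'r" where "S m = coeff sg m"
definition Z :: "nat \<Rightarrow> nat \<Rightarrow> nat \<Rightarrow> 'r" where "Z m i j = coeff (zp i j) m"
definition Ac :: "nat \<Rightarrow> nat \<Rightarrow> nat \<Rightarrow> 'r" where "Ac m i j = coeff (adj i j) m"
definition AY :: "nat \<Rightarrow> nat \<Rightarrow> nat \<Rightarrow> 'r" where "AY m i j = coeff (ay i j) m"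

lemma coeff_mult_const: "coeff (p * [:c:]) m = coeff p m * (c :: 'r)"
  by (simp add: mult.commute)

lemma coeff_const_mult: "coeff ([:c:] * p) m = (c :: 'r) * coeff p m"
  by simp

lemma coeff_lam_mult: "coeff (lam * p) (Suc m) = coeff p m" "coeff (lam * p) 0 = 0"
  by simp_all

lemma D_S: "i < n \<Longrightarrow> j < n \<Longrightarrow> D i j (S (Suc m)) = Z m i j"
  using arg_cong[OF Dp_sg, of i j "\<lambda>p. coeff p (Suc m)"]
  by (simp only: S_def Z_def coeff_Dp coeff_lam_mult)

lemma sum_t_D_Z:
  assumes "i < n" "j < n"
  shows "(\<Sum>k<n. \<Sum>l<n. t k l * D i l (Z m k j)) = - (of_nat m * Z m i j)"
  using arg_cong[OF sum_t_Dp_zp[OF assms], of "\<lambda>p. coeff p m"]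
  by (simp only: coeff_sum coeff_const_mult coeff_Dp coeff_minus coeff_euler_poly Z_def)

lemma AY_eq: "AY m i k = (\<Sum>l<n. Z m i l * t k l)"
  unfolding AY_def ay_eq Z_def by (simp only: coeff_sum coeff_mult_const)

lemma AY_Ac: "AY m i k = (\<Sum>p<n. Ac m i p * xt p k)"
  unfolding AY_def ay_def Ac_def by (simp only: coeff_sum coeff_mult_const)

lemma Z_Ac: "Z m i j = (\<Sum>p<n. Ac m i p * x p j)"
  unfolding Z_def zp_def Ac_def by (simp only: coeff_sum coeff_mult_const)

lemma coeff_Bm: "p < n \<Longrightarrow> q < n \<Longrightarrow> Bm $$ (p, q) = of_bool (p = q) + lam * [:xt p q:]"
  by (rule poly_eqI) (auto simp: Bm_index coeff_pCons split: nat.split)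

lemma Ac_0:
  assumes "i < n" "j < n"
  shows "Ac 0 i j = of_bool (i = j)"
proof -
  have "(\<Sum>k<n. coeff (adj i k * Bm $$ (k, j)) 0) = coeff (of_bool (i = j) * sg) 0"
    using arg_cong[OF adj_Bm[OF assms], of "\<lambda>p. coeff p 0"] by (simp only: coeff_sum)
  also have "(\<Sum>k<n. coeff (adj i k * Bm $$ (k, j)) 0) = (\<Sum>k<n. if k = j then Ac 0 i k else 0)"
    using assms by (intro sum.cong) (auto simp: coeff_mult Bm_index Ac_def)
  finally show ?thesis using assms by (auto simp: sum.delta coeff_sg_0)
qed

lemma Z_0: "i < n \<Longrightarrow> Z 0 i j = x i j"
proof -
  assume i: "i < n"
  have "Z 0 i j = (\<Sum>p<n. if p = i then x p j else 0)"
    unfolding Z_Ac using i by (intro sum.cong) (auto simp: Ac_0)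
  then show ?thesis using i by (simp add: sum.delta)
qed

lemma Ac_Suc_AY:
  assumes "i < n" "j < n"
  shows "Ac (Suc m) i j + AY m i j = of_bool (i = j) * S (Suc m)"
proof -
  have "of_bool (i = j) * sg = (\<Sum>k<n. adj i k * of_bool (k = j) + lam * (adj i k * [:xt k j:]))"
    unfolding adj_Bm[OF assms, symmetric] using assms
    by (intro sum.cong refl) (simp add: coeff_Bm algebra_simps)
  also have "\<dots> = (\<Sum>k<n. if k = j then adj i k else 0) + lam * ay i j"
    unfolding ay_def sum_distrib_left sum.distrib[symmetric] by (intro sum.cong) auto
  also have "\<dots> = adj i j + lam * ay i j" using assms by (simp add: sum.delta)
  finally have "coeff (of_bool (i = j) * sg) (Suc m) = coeff (adj i j) (Suc m) + coeff (lam * ay i j) (Suc m)"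
    by (simp only: coeff_add)
  then show ?thesis
    unfolding coeff_lam_mult Ac_def AY_def S_def by (cases "i = j") simp_all
qed

lemma xt_Z:
  assumes "i < n" "j < n"
  shows "(\<Sum>k<n. xt i k * Z m k j) = S (Suc m) * x i j - Z (Suc m) i j"
proof -
  have xtA: "(\<Sum>k<n. xt i k * Ac m k p) = of_bool (i = p) * S (Suc m) - Ac (Suc m) i p" if "p < n" for p
  proof -
    have "of_bool (i = p) * sg = (\<Sum>k<n. of_bool (i = k) * adj k p + lam * ([:xt i k:] * adj k p))"
      unfolding Bm_adj[OF assms(1) that, symmetric] using assms
      by (intro sum.cong refl) (simp add: coeff_Bm algebra_simps)
    also have "\<dots> = (\<Sum>k<n. if k = i then adj k p else 0) + lam * (\<Sum>k<n. [:xt i k:] * adj k p)"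
      unfolding sum_distrib_left sum.distrib[symmetric] by (intro sum.cong) auto
    also have "\<dots> = adj i p + lam * (\<Sum>k<n. [:xt i k:] * adj k p)" using assms by (simp add: sum.delta)
    finally have "coeff (of_bool (i = p) * sg) (Suc m) =
        coeff (adj i p) (Suc m) + coeff (lam * (\<Sum>k<n. [:xt i k:] * adj k p)) (Suc m)"
      by (simp only: coeff_add)
    also have "\<dots> = Ac (Suc m) i p + (\<Sum>k<n. xt i k * Ac m k p)"
      by (simp only: coeff_lam_mult coeff_sum coeff_const_mult Ac_def)
    also have "coeff (of_bool (i = p) * sg) (Suc m) = of_bool (i = p) * S (Suc m)"
      by (cases "i = p") (simp_all add: S_def)
    finally show ?thesis by (simp only: add_diff_cancel_left')
  qed
  have "(\<Sum>k<n. xt i k * Z m k j) = (\<Sum>k<n. \<Sum>p<n. xt i k * Ac m k p * x p j)"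
    unfolding Z_Ac by (simp only: sum_distrib_left mult.assoc)
  also have "\<dots> = (\<Sum>p<n. (\<Sum>k<n. xt i k * Ac m k p) * x p j)"
    unfolding sum_distrib_right by (rule sum.swap)
  also have "\<dots> = (\<Sum>p<n. (if p = i then S (Suc m) * x p j else 0) - Ac (Suc m) i p * x p j)"
    by (intro sum.cong refl) (auto simp: xtA left_diff_distrib)
  also have "\<dots> = S (Suc m) * x i j - Z (Suc m) i j"
    using assms unfolding Z_Ac[of "Suc m"] by (simp add: sum_subtractf sum.delta)
  finally show ?thesis .
qed

lemma AY_x:
  assumes "i < n"
  shows "(\<Sum>p<n. AY m i p * x p j) = S (Suc m) * x i j - Z (Suc m) i j"
proof -
  have "(\<Sum>p<n. AY m i p * x p j) = (\<Sum>p<n. (if p = i then S (Suc m) * x p j else 0) - Ac (Suc m) i p * x p j)"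
  proof (intro sum.cong refl, goal_cases)
    case (1 p)
    then have eq: "AY m i p = of_bool (i = p) * S (Suc m) - Ac (Suc m) i p"
      using Ac_Suc_AY[OF assms, of p m] by (simp add: algebra_simps)
    show ?case unfolding eq by (auto simp: left_diff_distrib)
  qed
  also have "\<dots> = S (Suc m) * x i j - Z (Suc m) i j"
    using assms unfolding Z_Ac[of "Suc m"] by (simp add: sum_subtractf sum.delta)
  finally show ?thesis .
qed

text \<open>By \<open>W_eq_t\<close> this is the factor in front of a second derivative of the
  substituted function in the chain rule; hence the aim is to express it through \<open>S\<close>
  and \<open>Z\<close> alone.\<close>

definition W :: "nat \<Rightarrow> nat \<Rightarrow> nat \<Rightarrow> nat \<Rightarrow> 'r" where
  "W u v i j = (\<Sum>k<n. AY u i k * Z v k j)"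

lemma W_eq_t: "W u v i j = (\<Sum>k<n. \<Sum>l<n. t k l * (Z u i l * Z v k j))"
  unfolding W_def AY_eq sum_distrib_right by (intro sum.cong refl) (simp only: mult_ac)

lemma W_0:
  assumes "i < n" "j < n"
  shows "W 0 v i j = S (Suc v) * x i j - Z (Suc v) i j"
proof -
  have "AY 0 i k = xt i k" for k
  proof -
    have "AY 0 i k = (\<Sum>p<n. if p = i then xt p k else 0)"
      unfolding AY_Ac using assms by (intro sum.cong) (auto simp: Ac_0)
    then show ?thesis using assms by (simp add: sum.delta)
  qed
  then show ?thesis using xt_Z[OF assms] by (simp add: W_def)
qed

text \<open>The recursion for the adjugate from \<open>Ac_Suc_AY\<close> splits one factor
  \<open>X T^t\<close> off the left adjugate, and \<open>xt_Z\<close> absorbs it into the right one.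
  So \<open>u\<close> is traded for \<open>v\<close> at the cost of two explicit terms.\<close>

lemma W_Suc:
  assumes "i < n" "j < n"
  shows "W (Suc u) v i j = W u (Suc v) i j + S (Suc v) * Z (Suc u) i j - S (Suc u) * Z (Suc v) i j"
proof -
  have "AY (Suc u) i k = S (Suc u) * xt i k - (\<Sum>p<n. AY u i p * xt p k)" for k
  proof -
    have "AY (Suc u) i k = (\<Sum>p<n. (if p = i then S (Suc u) * xt p k else 0) - AY u i p * xt p k)"
      unfolding AY_Ac[of "Suc u"]
    proof (intro sum.cong refl, goal_cases)
      case (1 p)
      then have eq: "Ac (Suc u) i p = of_bool (i = p) * S (Suc u) - AY u i p"
        using Ac_Suc_AY[OF assms(1), of p u] by (simp add: algebra_simps)
      show ?case unfolding eq by (auto simp: left_diff_distrib)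
    qed
    then show ?thesis using assms by (simp add: sum_subtractf sum.delta)
  qed
  then have "W (Suc u) v i j = S (Suc u) * (\<Sum>k<n. xt i k * Z v k j) - (\<Sum>k<n. \<Sum>p<n. AY u i p * (xt p k * Z v k j))"
    by (simp only: W_def left_diff_distrib sum_subtractf sum_distrib_left sum_distrib_right mult.assoc)
  also have "(\<Sum>k<n. \<Sum>p<n. AY u i p * (xt p k * Z v k j)) = (\<Sum>p<n. AY u i p * (\<Sum>k<n. xt p k * Z v k j))"
    unfolding sum_distrib_left by (rule sum.swap)
  also have "\<dots> = (\<Sum>p<n. AY u i p * (S (Suc v) * x p j - Z (Suc v) p j))"
    using assms by (intro sum.cong refl) (simp add: xt_Z)
  also have "\<dots> = S (Suc v) * (\<Sum>p<n. AY u i p * x p j) - W u (Suc v) i j"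
    by (simp only: W_def right_diff_distrib sum_subtractf sum_distrib_left mult_ac)
  finally show ?thesis
    unfolding AY_x[OF assms(1)] xt_Z[OF assms] by (simp add: algebra_simps)
qed

text \<open>This is the origin of the signs in \<open>eps\<close>. Trading \<open>u\<close> for
  \<open>v\<close> until \<open>u = 0\<close> reduces to \<open>W_0\<close>, where only the first
  and the last \<open>p\<close> contribute.\<close>

lemma W_eq:
  assumes "i < n" "j < n"
  shows "W u v i j = (\<Sum>p\<le>Suc (u + v). of_int (of_bool (p \<le> u) + of_bool (p \<le> v) - 1) * (S (Suc (u + v) - p) * Z p i j))"
proof (induction u arbitrary: v)
  case 0
  have "(\<Sum>p\<le>Suc (0 + v). of_int (of_bool (p \<le> 0) + of_bool (p \<le> v) - 1) * (S (Suc (0 + v) - p) * Z p i j))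
    = (\<Sum>p\<le>Suc v. (if p = 0 then S (Suc v) * Z p i j else 0) - (if p = Suc v then Z p i j else 0))"
    by (intro sum.cong) (auto simp: S_def coeff_sg_0)
  also have "\<dots> = S (Suc v) * x i j - Z (Suc v) i j"
    using assms by (simp add: sum_subtractf sum.delta Z_0)
  finally show ?case using W_0[OF assms] by simp
next
  case (Suc u)
  let ?f = "\<lambda>u v p. of_int (of_bool (p \<le> u) + of_bool (p \<le> v) - 1) * (S (Suc (Suc u + v) - p) * Z p i j)"
  have "(\<Sum>p\<le>Suc (Suc u + v). of_int (of_bool (p \<le> Suc u) + of_bool (p \<le> v) - 1) * (S (Suc (Suc u + v) - p) * Z p i j))
    = (\<Sum>p\<le>Suc (u + Suc v). of_int (of_bool (p \<le> u) + of_bool (p \<le> Suc v) - 1) * (S (Suc (u + Suc v) - p) * Z p i j)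
      + (if p = Suc u then S (Suc v) * Z p i j else 0) - (if p = Suc v then S (Suc u) * Z p i j else 0))"
  proof (intro sum.cong, goal_cases)
    case (2 p)
    \<comment> \<open>Replacing \<open>(u, v + 1)\<close> by \<open>(u + 1, v)\<close> changes the
      sign only at \<open>p = u + 1\<close> and \<open>p = v + 1\<close>; these are the two explicit
      terms of \<open>W_Suc\<close>.\<close>
    have 1: "of_bool (p \<le> Suc u) = of_bool (p \<le> u) + (of_bool (p = Suc u) :: int)" by auto
    have 2: "of_bool (p \<le> Suc v) = of_bool (p \<le> v) + (of_bool (p = Suc v) :: int)" by auto
    define c where "c = S (Suc (Suc u + v) - p) * Z p i j"
    have c: "S (Suc (u + Suc v) - p) * Z p i j = c" by (simp add: c_def)
    have e: "(if p = Suc u then S (Suc v) * Z p i j else 0) = of_bool (p = Suc u) * c"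
      "(if p = Suc v then S (Suc u) * Z p i j else 0) = of_bool (p = Suc v) * c"
      by (simp_all add: c_def)
    show ?case unfolding 1 2 c e c_def[symmetric] by (simp add: algebra_simps)
  qed simp
  also have "\<dots> = W u (Suc v) i j + S (Suc v) * Z (Suc u) i j - S (Suc u) * Z (Suc v) i j"
    unfolding Suc.IH by (simp add: sum.distrib sum_subtractf sum.delta del: sum.atMost_Suc)
  finally show ?case using W_Suc[OF assms] by simp
qed

lemma S_eq_0:
  assumes "n < m"
  shows "S m = 0"
proof -
  have "degree sg \<le> 1 * n"
    unfolding sg_def by (rule degree_det_le[OF _ Bm_carrier]) (simp add: Bm_index)
  then show ?thesis using assms by (simp add: S_def coeff_eq_0)
qed

text \<open>\<open>Z m\<close> is a derivative of \<open>S (m + 1)\<close>, which lies beyond the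
  degree of the determinant.\<close>

lemma Z_eq_0: "i < n \<Longrightarrow> j < n \<Longrightarrow> n \<le> m \<Longrightarrow> Z m i j = 0"
  using D_S[of i j m] by (simp add: S_eq_0 derivation_0[OF D])

end

subsection \<open>Chain rule\<close>

lemma sum3_swap:
  "(\<Sum>k\<in>A. \<Sum>l\<in>B. \<Sum>v\<in>C. f k l v) = (\<Sum>v\<in>C. \<Sum>k\<in>A. \<Sum>l\<in>B. f k l v)"
proof -
  have "(\<Sum>k\<in>A. \<Sum>l\<in>B. \<Sum>v\<in>C. f k l v) = (\<Sum>k\<in>A. \<Sum>v\<in>C. \<Sum>l\<in>B. f k l v)"
    by (rule sum.cong[OF refl], rule sum.swap)
  also have "\<dots> = (\<Sum>v\<in>C. \<Sum>k\<in>A. \<Sum>l\<in>B. f k l v)"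
    by (rule sum.swap)
  finally show ?thesis .
qed

lemma sum4_swap:
  "(\<Sum>k\<in>A. \<Sum>l\<in>B. \<Sum>v\<in>C. \<Sum>u\<in>E. f k l v u) = (\<Sum>v\<in>C. \<Sum>u\<in>E. \<Sum>k\<in>A. \<Sum>l\<in>B. f k l v u)"
  by (rule trans[OF sum3_swap], rule sum.cong[OF refl], rule sum3_swap)

locale matrix_derivations_scalars = matrix_derivations n D t x
  for n :: nat and D :: "nat \<Rightarrow> nat \<Rightarrow> 'r::comm_ring_1 \<Rightarrow> 'r" and t x :: "nat \<Rightarrow> nat \<Rightarrow> 'r" +
  fixes cst :: "complex \<Rightarrow> 'r"
  assumes cst_add: "cst (c + c') = cst c + cst c'"
    and cst_mult: "cst (c * c') = cst c * cst c'"
    and cst_1: "cst 1 = 1"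
    and D_cst: "D i j (cst c) = 0"
begin

lemma cst_0: "cst 0 = 0"
  using cst_add[of 0 0] by simp

lemma cst_uminus: "cst (- c) = - cst c"
  using cst_add[of c "- c"] by (simp add: cst_0 eq_neg_iff_add_eq_0 add.commute)

lemma cst_of_nat: "cst (of_nat k) = of_nat k"
  by (induction k) (simp_all add: cst_0 cst_add cst_1)

lemma cst_of_int: "cst (of_int k) = of_int k"
  by (cases k rule: int_cases2) (simp_all add: cst_of_nat cst_uminus)

section \<open>Substituting the \<sigma>'s into finitely supported series\<close>

definition mon :: "nat expo \<Rightarrow> 'r" where
  "mon m = (\<Prod>i\<in>{1..n}. S i ^ Poly_Mapping.lookup m i)"

definition polyn :: "nat mseries \<Rightarrow> bool" where
  "polyn F \<longleftrightarrow> finite {m. F m \<noteq> 0}"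

definition ev :: "nat mseries \<Rightarrow> 'r" where
  "ev F = (\<Sum>m | F m \<noteq> 0. cst (F m) * mon m)"

lemma ev_superset:
  assumes "finite M" "\<And>m. m \<notin> M \<Longrightarrow> F m = 0"
  shows "ev F = (\<Sum>m\<in>M. cst (F m) * mon m)"
  unfolding ev_def using assms by (intro sum.mono_neutral_left) (auto simp: cst_0)

lemma polyn_add: "polyn F \<Longrightarrow> polyn G \<Longrightarrow> polyn (\<lambda>m. F m + G m)"
  unfolding polyn_def by (rule finite_subset[of _ "{m. F m \<noteq> 0} \<union> {m. G m \<noteq> 0}"]) auto

lemma polyn_scale: "polyn F \<Longrightarrow> polyn (\<lambda>m. c * F m)"
  unfolding polyn_def by (rule finite_subset[of _ "{m. F m \<noteq> 0}"]) auto

lemma polyn_0: "polyn (\<lambda>m. 0)"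
  by (simp add: polyn_def)

lemma polyn_sum: "(\<And>i. i \<in> I \<Longrightarrow> polyn (F i)) \<Longrightarrow> polyn (\<lambda>m. \<Sum>i\<in>I. F i m)"
  by (induction I rule: infinite_finite_induct) (simp_all add: polyn_0 polyn_add)

lemma polyn_mderiv:
  assumes "polyn F"
  shows "polyn (mderiv a F)"
  unfolding polyn_def
proof (rule finite_subset)
  show "{m. mderiv a F m \<noteq> 0} \<subseteq> (\<lambda>m. m - Poly_Mapping.single a 1) ` {m. F m \<noteq> 0}"
  proof
    fix m assume "m \<in> {m. mderiv a F m \<noteq> 0}"
    then have "m + Poly_Mapping.single a 1 \<in> {m. F m \<noteq> 0}" by (simp add: mderiv_def)
    then have "m + Poly_Mapping.single a 1 - Poly_Mapping.single a 1 \<in> (\<lambda>m. m - Poly_Mapping.single a 1) ` {m. F m \<noteq> 0}"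
      by (rule imageI)
    then show "m \<in> (\<lambda>m. m - Poly_Mapping.single a 1) ` {m. F m \<noteq> 0}" by simp
  qed
  show "finite ((\<lambda>m. m - Poly_Mapping.single a 1) ` {m. F m \<noteq> 0})"
    using assms by (simp add: polyn_def)
qed

lemma polyn_smult_var:
  assumes "polyn F"
  shows "polyn (smult_var c F)"
proof (cases "c = 0")
  case False
  have "m \<in> (\<lambda>m. m + Poly_Mapping.single c 1) ` {m. F m \<noteq> 0}" if "smult_var c F m \<noteq> 0" for m
  proof
    have "Poly_Mapping.lookup m c \<noteq> 0"
      using that by (rule contrapos_nn) (simp add: smult_var_def False)
    then show "m = m - Poly_Mapping.single c 1 + Poly_Mapping.single c 1"
      by (rule expo_add_diff[symmetric])
    show "m - Poly_Mapping.single c 1 \<in> {m. F m \<noteq> 0}"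
      using that \<open>Poly_Mapping.lookup m c \<noteq> 0\<close> by (simp add: smult_var_def False)
  qed
  then have "{m. smult_var c F m \<noteq> 0} \<subseteq> (\<lambda>m. m + Poly_Mapping.single c 1) ` {m. F m \<noteq> 0}"
    by blast
  moreover have "finite ((\<lambda>m. m + Poly_Mapping.single c 1) ` {m. F m \<noteq> 0})"
    using assms by (simp add: polyn_def)
  ultimately show ?thesis
    unfolding polyn_def by (rule finite_subset)
qed (use assms in \<open>simp add: smult_var_def\<close>)

lemma ev_add:
  assumes "polyn F" "polyn G"
  shows "ev (\<lambda>m. F m + G m) = ev F + ev G"
proof -
  let ?M = "{m. F m \<noteq> 0} \<union> {m. G m \<noteq> 0}"
  have M: "finite ?M" using assms by (simp add: polyn_def)
  have "ev (\<lambda>m. F m + G m) = (\<Sum>m\<in>?M. cst (F m + G m) * mon m)"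
    by (rule ev_superset[OF M]) auto
  also have "\<dots> = (\<Sum>m\<in>?M. cst (F m) * mon m) + (\<Sum>m\<in>?M. cst (G m) * mon m)"
    by (simp add: cst_add distrib_right sum.distrib)
  also have "\<dots> = ev F + ev G"
    by (subst (1 2) ev_superset[OF M]) auto
  finally show ?thesis .
qed

lemma ev_scale:
  assumes "polyn F"
  shows "ev (\<lambda>m. c * F m) = cst c * ev F"
proof -
  have "ev (\<lambda>m. c * F m) = (\<Sum>m | F m \<noteq> 0. cst (c * F m) * mon m)"
    using assms by (intro ev_superset) (auto simp: polyn_def)
  then show ?thesis by (simp add: ev_def cst_mult sum_distrib_left mult.assoc)
qed

lemma ev_0: "ev (\<lambda>m. 0) = 0"
  by (simp add: ev_def)

lemma ev_sum:
  "(\<And>i. i \<in> I \<Longrightarrow> polyn (F i)) \<Longrightarrow> ev (\<lambda>m. \<Sum>i\<in>I. F i m) = (\<Sum>i\<in>I. ev (F i))"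
  by (induction I rule: infinite_finite_induct) (simp_all add: ev_0 ev_add polyn_sum)

lemma mon_add_single:
  assumes "c \<in> {1..n}"
  shows "mon (m + Poly_Mapping.single c 1) = S c * mon m"
proof -
  have "mon (m + Poly_Mapping.single c 1) = S c ^ (Poly_Mapping.lookup m c + 1) *
      (\<Prod>i\<in>{1..n} - {c}. S i ^ Poly_Mapping.lookup m i)"
    unfolding mon_def using assms
    by (subst prod.remove[of _ c]) (auto simp: lookup_add lookup_single when_def intro!: prod.cong)
  also have "\<dots> = S c * mon m"
    unfolding mon_def using assms by (subst (2) prod.remove[of _ c]) (auto simp: power_add mult_ac)
  finally show ?thesis .
qed

lemma ev_smult_var:
  assumes "polyn F" "c \<le> n"
  shows "ev (smult_var c F) = S c * ev F"
proof (cases "c = 0")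
  case True
  then show ?thesis by (simp add: smult_var_def S_def coeff_sg_0)
next
  case False
  let ?f = "\<lambda>m. m + Poly_Mapping.single c (1::nat)"
  have c: "c \<in> {1..n}" using False assms(2) by auto
  have *: "smult_var c F (?f m) = F m" for m
    using False by (simp add: smult_var_def lookup_add)
  have "ev (smult_var c F) = (\<Sum>m\<in>?f ` {m. F m \<noteq> 0}. cst (smult_var c F m) * mon m)"
  proof (rule ev_superset)
    show "finite (?f ` {m. F m \<noteq> 0})" using assms by (simp add: polyn_def)
    show "smult_var c F m = 0" if "m \<notin> ?f ` {m. F m \<noteq> 0}" for m
    proof (rule ccontr)
      assume m: "smult_var c F m \<noteq> 0"
      then have l: "Poly_Mapping.lookup m c \<noteq> 0"
        by (rule contrapos_nn) (simp add: smult_var_def False)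
      then have "m - Poly_Mapping.single c 1 \<in> {m. F m \<noteq> 0}"
        using m by (simp add: smult_var_def False)
      then have "?f (m - Poly_Mapping.single c 1) \<in> ?f ` {m. F m \<noteq> 0}" by (rule imageI)
      then show False using that expo_add_diff[OF l] by simp
    qed
  qed
  also have "\<dots> = (\<Sum>m | F m \<noteq> 0. cst (F m) * (S c * mon m))"
    by (subst sum.reindex) (auto simp: inj_on_def * mon_add_single[OF c] o_def)
  finally show ?thesis by (simp add: ev_def sum_distrib_left mult.left_commute)
qed

lemma D_mon:
  "D i j (mon m) = (\<Sum>a\<in>{1..n}. D i j (S a) * (of_nat (Poly_Mapping.lookup m a) * mon (m - Poly_Mapping.single a 1)))"
proof -
  have pow: "D i j (p ^ k) = of_nat k * (p ^ (k - 1) * D i j p)" for p k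
  proof (induction k)
    case (Suc k)
    then show ?case
      by (cases k) (simp_all add: derivation_mult[OF D] derivation_1[OF D] algebra_simps)
  qed (simp add: derivation_1[OF D])
  have "D i j (mon m) = (\<Sum>a\<in>{1..n}. D i j (S a ^ Poly_Mapping.lookup m a) *
      (\<Prod>b\<in>{1..n} - {a}. S b ^ Poly_Mapping.lookup m b))"
    unfolding mon_def by (rule derivation_prod[OF D]) simp
  also have "\<dots> = (\<Sum>a\<in>{1..n}. D i j (S a) * (of_nat (Poly_Mapping.lookup m a) * mon (m - Poly_Mapping.single a 1)))"
  proof (intro sum.cong refl, goal_cases)
    case (1 a)
    have "mon (m - Poly_Mapping.single a 1) = S a ^ (Poly_Mapping.lookup m a - 1) *
      (\<Prod>b\<in>{1..n} - {a}. S b ^ Poly_Mapping.lookup m b)"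
      unfolding mon_def using 1
      by (subst prod.remove[of _ a]) (auto simp: lookup_minus lookup_single when_def intro!: prod.cong)
    then show ?case by (simp add: pow mult_ac)
  qed
  finally show ?thesis .
qed

lemma ev_mderiv:
  assumes "polyn F"
  shows "ev (mderiv a F) = (\<Sum>m | F m \<noteq> 0. cst (F m) * (of_nat (Poly_Mapping.lookup m a) * mon (m - Poly_Mapping.single a 1)))"
proof -
  let ?A = "{m. F m \<noteq> 0 \<and> Poly_Mapping.lookup m a \<noteq> 0}"
  let ?f = "\<lambda>m. m - Poly_Mapping.single a (1::nat)"
  have fin: "finite {m. F m \<noteq> 0}" using assms by (simp add: polyn_def)
  then have finA: "finite ?A" by (rule rev_finite_subset) auto
  have inj: "inj_on ?f ?A"
    using expo_add_diff[of _ a] by (intro inj_onI) (metis (mono_tags, lifting) mem_Collect_eq)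
  have "ev (mderiv a F) = (\<Sum>m\<in>?f ` ?A. cst (mderiv a F m) * mon m)"
  proof (rule ev_superset)
    show "finite (?f ` ?A)" using finA by simp
    show "mderiv a F m = 0" if "m \<notin> ?f ` ?A" for m
    proof (rule ccontr)
      assume "mderiv a F m \<noteq> 0"
      then have "m + Poly_Mapping.single a 1 \<in> ?A" by (auto simp: mderiv_def lookup_add)
      then have "?f (m + Poly_Mapping.single a 1) \<in> ?f ` ?A" by (rule imageI)
      then show False using that by simp
    qed
  qed
  also have "\<dots> = (\<Sum>m\<in>?A. cst (mderiv a F (?f m)) * mon (?f m))"
    by (subst sum.reindex[OF inj]) (simp add: o_def)
  also have "\<dots> = (\<Sum>m\<in>?A. cst (F m) * (of_nat (Poly_Mapping.lookup m a) * mon (?f m)))"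
  proof (intro sum.cong refl, goal_cases)
    case (1 m)
    then have "mderiv a F (?f m) = of_nat (Poly_Mapping.lookup m a) * F m"
      by (simp add: mderiv_def expo_add_diff lookup_minus)
    then show ?case by (simp add: cst_mult cst_of_nat)
  qed
  also have "\<dots> = (\<Sum>m | F m \<noteq> 0. cst (F m) * (of_nat (Poly_Mapping.lookup m a) * mon (?f m)))"
  proof (rule sum.mono_neutral_left[OF fin])
    have "\<forall>m. Poly_Mapping.lookup m a = 0 \<longrightarrow>
        cst (F m) * (of_nat (Poly_Mapping.lookup m a) * mon (?f m)) = 0" by simp
    then show "\<forall>m\<in>{m. F m \<noteq> 0} - ?A. cst (F m) * (of_nat (Poly_Mapping.lookup m a) * mon (?f m)) = 0"
      by blast
  qed auto
  finally show ?thesis .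
qed

lemma D_ev:
  assumes "polyn F"
  shows "D i j (ev F) = (\<Sum>a\<in>{1..n}. D i j (S a) * ev (mderiv a F))"
proof -
  have "D i j (ev F) = (\<Sum>m | F m \<noteq> 0. \<Sum>a\<in>{1..n}. D i j (S a) *
      (cst (F m) * (of_nat (Poly_Mapping.lookup m a) * mon (m - Poly_Mapping.single a 1))))"
    unfolding ev_def derivation_sum[OF D]
    by (intro sum.cong refl) (simp add: derivation_mult[OF D] D_cst D_mon sum_distrib_left mult.left_commute)
  also have "\<dots> = (\<Sum>a\<in>{1..n}. D i j (S a) * ev (mderiv a F))"
    unfolding ev_mderiv[OF assms] sum_distrib_left by (rule sum.swap)
  finally show ?thesis .
qed

text \<open>\<open>D_ij\<close> acting on polynomials in \<open>X\<close> and \<open>T\<close>, with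
  the entries of \<open>X\<close> as constants.\<close>

definition Dhat :: "complex \<Rightarrow> nat \<Rightarrow> nat \<Rightarrow> 'r \<Rightarrow> 'r" where
  "Dhat \<kappa> i j P = cst \<kappa> * D i j P + (\<Sum>k<n. \<Sum>l<n. t k l * D i l (D k j P))"

text \<open>The shift \<open>r = p + 1\<close> turns the signs of \<open>W_eq\<close> into
  \<open>eps\<close>. The cutoffs agree because \<open>S\<close> vanishes above index
  \<open>n\<close> and \<open>Z\<close> from index \<open>n\<close> on.\<close>

lemma W_eps:
  assumes "i < n" "j < n" "u \<in> {1..n}" "v \<in> {1..n}"
  shows "W (u - 1) (v - 1) i j = (\<Sum>r\<in>{1..n}. of_int (eps n r u v) * (S (u + v - r) * Z (r - 1) i j))"
proof -
  let ?e = "\<lambda>r. of_int (of_bool (r \<le> u) + of_bool (r \<le> v) - 1) :: 'r"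
  have uv: "Suc (u - 1 + (v - 1)) = u + v - 1" using assms by auto
  have "W (u - 1) (v - 1) i j = (\<Sum>p\<le>u + v - 1. ?e (Suc p) * (S (u + v - Suc p) * Z p i j))"
    unfolding W_eq[OF assms(1,2)] uv
  proof (intro sum.cong refl, goal_cases)
    case (1 p)
    have "(p \<le> u - 1) = (Suc p \<le> u)" "(p \<le> v - 1) = (Suc p \<le> v)" "u + v - 1 - p = u + v - Suc p"
      using assms by auto
    then show ?case by (simp only:)
  qed
  also have "\<dots> = (\<Sum>p\<in>{..u + v - 1} \<inter> {..<n}. ?e (Suc p) * (S (u + v - Suc p) * Z p i j))"
    using assms by (intro sum.mono_neutral_right) (auto simp: Z_eq_0)
  also have "\<dots> = (\<Sum>p\<in>{..u + v - 1} \<inter> {..<n}. of_int (eps n (Suc p) u v) * (S (u + v - Suc p) * Z p i j))"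
  proof (intro sum.cong refl, goal_cases)
    case (1 p)
    have "Suc p \<le> u + v" using 1 assms by auto
    then show ?case by (cases "u + v \<le> Suc p + n") (simp_all add: eps_def S_eq_0)
  qed
  also have "\<dots> = (\<Sum>p<n. of_int (eps n (Suc p) u v) * (S (u + v - Suc p) * Z p i j))"
    by (intro sum.mono_neutral_left) (auto simp: eps_def)
  also have "\<dots> = (\<Sum>r\<in>{1..n}. of_int (eps n r u v) * (S (u + v - r) * Z (r - 1) i j))"
    by (simp add: sum.atLeast1_atMost_eq One_nat_def)
  finally show ?thesis .
qed

lemma ev_Lop:
  assumes F: "polyn F"
  shows "ev (Lop \<kappa> n r F) = (cst \<kappa> + 1 - of_nat r) * ev (mderiv r F)
    + (\<Sum>u\<in>{1..n}. \<Sum>v\<in>{1..n}. of_int (eps n r u v) * (S (u + v - r) * ev (mderiv u (mderiv v F))))"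
proof -
  let ?T = "\<lambda>u v m. of_int (eps n r u v) * smult_var (u + v - r) (mderiv u (mderiv v F)) m"
  have p: "polyn (?T u v)" for u v
    by (intro polyn_scale polyn_smult_var polyn_mderiv F)
  have e: "ev (?T u v) = of_int (eps n r u v) * (S (u + v - r) * ev (mderiv u (mderiv v F)))" for u v
  proof (cases "eps n r u v = 0")
    case True
    then show ?thesis by (simp add: ev_0)
  next
    case False
    then have "u + v - r \<le> n" by (auto simp: eps_def split: if_splits)
    then show ?thesis
      by (simp add: ev_scale ev_smult_var polyn_smult_var polyn_mderiv F cst_of_int)
  qed
  have "ev (Lop \<kappa> n r F) = cst (\<kappa> + 1 - of_nat r) * ev (mderiv r F)
    + (\<Sum>u\<in>{1..n}. \<Sum>v\<in>{1..n}. ev (?T u v))"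
    unfolding Lop_def
    by (simp add: ev_add ev_sum ev_scale polyn_scale polyn_sum polyn_mderiv F p)
  moreover have "cst (\<kappa> + 1 - of_nat r) = cst \<kappa> + 1 - of_nat r"
    using cst_add[of "\<kappa> + 1" "- of_nat r"] by (simp add: cst_add cst_1 cst_uminus cst_of_nat)
  ultimately show ?thesis by (simp only: e)
qed

text \<open>First derivatives of \<open>F\<close> collect \<kappa> and, through
  \<open>sum_t_D_Z\<close>, the number \<open>-(r - 1)\<close>; together these are the
  \<open>\<kappa> + 1 - r\<close> of \<open>Lop\<close>. Second derivatives come with
  \<open>W\<close>, and sorting \<open>W_eps\<close> by \<open>Z (r - 1)\<close> gives the second
  order part.\<close>

theorem Dhat_ev:
  assumes F: "polyn F" and ij: "i < n" "j < n"
  shows "Dhat \<kappa> i j (ev F) = (\<Sum>r\<in>{1..n}. Z (r - 1) i j * ev (Lop \<kappa> n r F))"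
proof -
  let ?I = "{1..n}"
  have DS: "D k l (S u) = Z (u - 1) k l" if "k < n" "l < n" "u \<in> ?I" for k l u
    using D_S[OF that(1,2), of "u - 1"] that(3) by simp
  have D1: "D k j (ev F) = (\<Sum>v\<in>?I. Z (v - 1) k j * ev (mderiv v F))" if "k < n" for k
    unfolding D_ev[OF F] using that ij by (intro sum.cong refl) (simp add: DS)
  have D2: "D i l (D k j (ev F)) = (\<Sum>v\<in>?I. D i l (Z (v - 1) k j) * ev (mderiv v F))
     + (\<Sum>v\<in>?I. \<Sum>u\<in>?I. Z (u - 1) i l * Z (v - 1) k j * ev (mderiv u (mderiv v F)))"
    if "k < n" "l < n" for k l
  proof -
    have "D i l (ev (mderiv v F)) = (\<Sum>u\<in>?I. Z (u - 1) i l * ev (mderiv u (mderiv v F)))" for v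
      unfolding D_ev[OF polyn_mderiv[OF F]] using that ij by (intro sum.cong refl) (simp add: DS)
    then show ?thesis
      unfolding D1[OF that(1)] derivation_sum[OF D] derivation_mult[OF D] sum.distrib
      by (simp add: sum_distrib_left mult_ac)
  qed
  have "(\<Sum>k<n. \<Sum>l<n. t k l * D i l (D k j (ev F))) =
     (\<Sum>k<n. \<Sum>l<n. \<Sum>v\<in>?I. t k l * D i l (Z (v - 1) k j) * ev (mderiv v F))
     + (\<Sum>k<n. \<Sum>l<n. \<Sum>v\<in>?I. \<Sum>u\<in>?I. t k l * (Z (u - 1) i l * Z (v - 1) k j) * ev (mderiv u (mderiv v F)))"
    unfolding sum.distrib[symmetric]
    by (intro sum.cong refl) (simp add: D2 distrib_left sum_distrib_left mult.assoc sum.distrib)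
  also have "(\<Sum>k<n. \<Sum>l<n. \<Sum>v\<in>?I. t k l * D i l (Z (v - 1) k j) * ev (mderiv v F))
     = (\<Sum>v\<in>?I. (\<Sum>k<n. \<Sum>l<n. t k l * D i l (Z (v - 1) k j)) * ev (mderiv v F))"
    unfolding sum_distrib_right
    by (rule sum3_swap)
  also have "\<dots> = (\<Sum>v\<in>?I. - (of_nat (v - 1) * Z (v - 1) i j) * ev (mderiv v F))"
    by (simp add: sum_t_D_Z[OF ij])
  also have "(\<Sum>k<n. \<Sum>l<n. \<Sum>v\<in>?I. \<Sum>u\<in>?I. t k l * (Z (u - 1) i l * Z (v - 1) k j) * ev (mderiv u (mderiv v F)))
     = (\<Sum>v\<in>?I. \<Sum>u\<in>?I. W (u - 1) (v - 1) i j * ev (mderiv u (mderiv v F)))"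
    unfolding W_eq_t sum_distrib_right by (rule sum4_swap)
  also have "\<dots> = (\<Sum>v\<in>?I. \<Sum>u\<in>?I. \<Sum>r\<in>?I. Z (r - 1) i j *
      (of_int (eps n r u v) * (S (u + v - r) * ev (mderiv u (mderiv v F)))))"
    by (intro sum.cong refl) (simp add: W_eps[OF ij] sum_distrib_left sum_distrib_right mult_ac)
  also have "\<dots> = (\<Sum>r\<in>?I. \<Sum>v\<in>?I. \<Sum>u\<in>?I. Z (r - 1) i j *
      (of_int (eps n r u v) * (S (u + v - r) * ev (mderiv u (mderiv v F)))))"
    by (rule sum3_swap)
  also have "\<dots> = (\<Sum>r\<in>?I. Z (r - 1) i j * (\<Sum>u\<in>?I. \<Sum>v\<in>?I.
      of_int (eps n r u v) * (S (u + v - r) * ev (mderiv u (mderiv v F)))))"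
    unfolding sum_distrib_left by (rule sum.cong[OF refl], rule sum.swap)
  finally have "Dhat \<kappa> i j (ev F) = cst \<kappa> * (\<Sum>v\<in>?I. Z (v - 1) i j * ev (mderiv v F))
     + ((\<Sum>v\<in>?I. - (of_nat (v - 1) * Z (v - 1) i j) * ev (mderiv v F))
     + (\<Sum>r\<in>?I. Z (r - 1) i j * (\<Sum>u\<in>?I. \<Sum>v\<in>?I.
        of_int (eps n r u v) * (S (u + v - r) * ev (mderiv u (mderiv v F))))))"
    unfolding Dhat_def D1[OF ij(1)] by simp
  also have "\<dots> = (\<Sum>r\<in>{1..n}. Z (r - 1) i j * ev (Lop \<kappa> n r F))"
    unfolding sum_distrib_left[of "cst \<kappa>"] sum.distrib[symmetric]
  proof (intro sum.cong refl, goal_cases)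
    case (1 r)
    then have "(of_nat r :: 'r) = of_nat (r - 1) + 1" by (simp add: of_nat_diff)
    then show ?case unfolding ev_Lop[OF F] by (simp add: algebra_simps)
  qed
  finally show ?thesis .
qed

end

subsection \<open>Polynomials in \<open>X\<close> and \<open>T\<close>\<close>

lemma poly_mapping_sum_singles:
  "(\<Sum>k\<in>Poly_Mapping.keys p. Poly_Mapping.single k (Poly_Mapping.lookup p k)) = (p :: 'a \<Rightarrow>\<^sub>0 'b::comm_monoid_add)"
  by (rule poly_mapping_eqI) (simp add: lookup_sum lookup_single when_def sum.delta in_keys_iff)

lemma poly_mapping_additive_eqI:
  fixes f g :: "('a \<Rightarrow>\<^sub>0 'b::comm_monoid_add) \<Rightarrow> 'c::ab_group_add"
  assumes f: "\<And>p q. f (p + q) = f p + f q" and g: "\<And>p q. g (p + q) = g p + g q"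
    and eq: "\<And>k c. f (Poly_Mapping.single k c) = g (Poly_Mapping.single k c)"
  shows "f p = g p"
proof -
  have 0: "f 0 = 0" "g 0 = 0" using f[of 0 0] g[of 0 0] by simp_all
  have "f (sum h A) = g (sum h A)" if "\<And>k. k \<in> A \<Longrightarrow> f (h k) = g (h k)" for h and A :: "'a set"
    using that by (induction A rule: infinite_finite_induct) (simp_all add: 0 f g)
  from this[of "Poly_Mapping.keys p" "\<lambda>k. Poly_Mapping.single k (Poly_Mapping.lookup p k)"]
  show ?thesis by (simp add: eq poly_mapping_sum_singles)
qed

lemma derivation_poly_mappingI:
  fixes \<delta> :: "('a::comm_monoid_add \<Rightarrow>\<^sub>0 'b::comm_ring_1) \<Rightarrow> ('a \<Rightarrow>\<^sub>0 'b)"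
  assumes add: "\<And>p q. \<delta> (p + q) = \<delta> p + \<delta> q"
    and single: "\<And>k l c d. \<delta> (Poly_Mapping.single k c * Poly_Mapping.single l d) =
      \<delta> (Poly_Mapping.single k c) * Poly_Mapping.single l d + Poly_Mapping.single k c * \<delta> (Poly_Mapping.single l d)"
  shows "derivation \<delta>"
proof -
  have 1: "\<delta> (Poly_Mapping.single k c * q) = \<delta> (Poly_Mapping.single k c) * q + Poly_Mapping.single k c * \<delta> q"
    for k c q
    by (rule poly_mapping_additive_eqI[where f = "\<lambda>q. \<delta> (Poly_Mapping.single k c * q)"])
      (simp_all add: single add distrib_left)
  have "\<delta> (p * q) = \<delta> p * q + p * \<delta> q" for p q
    by (rule poly_mapping_additive_eqI[where f = "\<lambda>p. \<delta> (p * q)"])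
      (simp_all add: 1 add distrib_right)
  then show ?thesis by (simp add: derivation_def add)
qed

lemma lookup_single_0_mult:
  "Poly_Mapping.lookup (Poly_Mapping.single 0 c * p) k = c * Poly_Mapping.lookup p (k :: 'a::comm_monoid_add) "
  for c :: "'b::comm_ring_1"
  by (rule poly_mapping_additive_eqI[where f = "\<lambda>p. Poly_Mapping.lookup (Poly_Mapping.single 0 c * p) k"])
    (simp_all add: distrib_left lookup_add mult_single lookup_single when_def)

text \<open>Reading off coefficients after multiplication by a variable is the source of the shift
  to \<open>\<nu> - e_ij\<close>, and of the value 0 when the variable does not occur.\<close>

lemma lookup_single_var_mult:
  "Poly_Mapping.lookup (Poly_Mapping.single (Poly_Mapping.single v 1) 1 * p) \<nu> =
    (if Poly_Mapping.lookup \<nu> v = 0 then 0 else Poly_Mapping.lookup p (\<nu> - Poly_Mapping.single v 1))"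
  for p :: "'v expo \<Rightarrow>\<^sub>0 'b::comm_ring_1"
proof (rule poly_mapping_additive_eqI[where
      f = "\<lambda>p. Poly_Mapping.lookup (Poly_Mapping.single (Poly_Mapping.single v 1) 1 * p) \<nu>"], goal_cases)
  case (3 k c)
  have "Poly_Mapping.single v 1 + k = \<nu> \<longleftrightarrow> Poly_Mapping.lookup \<nu> v \<noteq> 0 \<and> k = \<nu> - Poly_Mapping.single v 1"
    using expo_add_diff[of \<nu> v] by (auto simp: lookup_add add.commute)
  then show ?case by (auto simp: mult_single lookup_single when_def)
qed (simp_all add: distrib_left lookup_add)

lemma tpderiv_superset:
  "finite M \<Longrightarrow> Poly_Mapping.keys p \<subseteq> M \<Longrightarrow> tpderiv v p = (\<Sum>m\<in>M.
     Poly_Mapping.single (m - Poly_Mapping.single v 1) (of_nat (Poly_Mapping.lookup m v) * Poly_Mapping.lookup p m))"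
  unfolding tpderiv_def by (rule sum.mono_neutral_left) (auto simp: in_keys_iff)

lemma tpderiv_add: "tpderiv v (p + q) = tpderiv v p + tpderiv v q"
proof -
  let ?M = "Poly_Mapping.keys p \<union> Poly_Mapping.keys q"
  have M: "finite ?M" by simp
  show ?thesis
    using keys_add[of p q]
    by (simp add: tpderiv_superset[OF M] lookup_add distrib_left single_add sum.distrib)
qed

lemma tpderiv_single:
  "tpderiv v (Poly_Mapping.single m c) = Poly_Mapping.single (m - Poly_Mapping.single v 1) (of_nat (Poly_Mapping.lookup m v) * c)"
  by (subst tpderiv_superset[of "{m}"]) auto

lemma derivation_tpderiv: "derivation (tpderiv v)"
proof (rule derivation_poly_mappingI)
  fix m m' :: "idx expo" and c c' :: complex
  let ?e = "Poly_Mapping.single v (1::nat)"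
  \<comment> \<open>If \<open>v\<close> does not occur in \<open>m\<close>, the truncated exponents
    may differ, but the coefficient is 0 on both sides.\<close>
  have *: "Poly_Mapping.single (m + m' - ?e) (of_nat (Poly_Mapping.lookup m v) * c * c') =
      Poly_Mapping.single (m - ?e + m') (of_nat (Poly_Mapping.lookup m v) * c * c')" for m m' and c c' :: complex
    by (cases "Poly_Mapping.lookup m v = 0") (simp_all add: expo_diff_add)
  show "tpderiv v (Poly_Mapping.single m c * Poly_Mapping.single m' c') =
    tpderiv v (Poly_Mapping.single m c) * Poly_Mapping.single m' c'
    + Poly_Mapping.single m c * tpderiv v (Poly_Mapping.single m' c')"
    using *[of m m' c c'] *[of m' m c' c]
    by (simp add: mult_single tpderiv_single lookup_add distrib_right distrib_left single_add mult_ac add.commute)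
qed (rule tpderiv_add)

definition Dx :: "idx \<Rightarrow> xtpoly \<Rightarrow> xtpoly" where
  "Dx v = Poly_Mapping.map (tpderiv v)"

lemma lookup_Dx: "Poly_Mapping.lookup (Dx v p) \<nu> = tpderiv v (Poly_Mapping.lookup p \<nu>)"
  by (simp add: Dx_def map.rep_eq when_def derivation_0[OF derivation_tpderiv])

lemma Dx_single: "Dx v (Poly_Mapping.single \<nu> P) = Poly_Mapping.single \<nu> (tpderiv v P)"
  by (rule poly_mapping_eqI) (simp add: lookup_Dx lookup_single when_def derivation_0[OF derivation_tpderiv])

lemma derivation_Dx: "derivation (Dx v)"
proof (rule derivation_poly_mappingI)
  show "Dx v (p + q) = Dx v p + Dx v q" for p q
    by (rule poly_mapping_eqI) (simp add: lookup_Dx lookup_add tpderiv_add)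
qed (simp add: Dx_single mult_single derivation_mult[OF derivation_tpderiv] single_add)

definition Tv :: "nat \<Rightarrow> nat \<Rightarrow> xtpoly" where
  "Tv i j = Poly_Mapping.single 0 (tvar (i, j))"

definition Xv :: "nat list \<Rightarrow> nat \<Rightarrow> nat \<Rightarrow> xtpoly" where
  "Xv ns i j = (if (i, j) \<in> same_block ns then 0
     else Poly_Mapping.single (Poly_Mapping.single (i, j) 1) 1)"

definition xconst :: "complex \<Rightarrow> xtpoly" where
  "xconst c = Poly_Mapping.single 0 (tconst c)"

interpretation xt: matrix_derivations_scalars n "\<lambda>i j. Dx (i, j)" Tv "Xv ns" xconst for n ns
proof
  show "derivation (Dx (i, j))" for i j by (rule derivation_Dx)
  show "Dx (i, j) (Tv k l) = of_bool (i = k \<and> j = l)" for i j k l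
  proof -
    have "tpderiv (i, j) (tvar (k, l)) = Poly_Mapping.single (Poly_Mapping.single (k, l) 1 - Poly_Mapping.single (i, j) 1) (of_bool ((i, j) = (k, l)))"
      by (simp add: tvar_def tpderiv_single lookup_single when_def)
    then show ?thesis by (auto simp: Tv_def Dx_single)
  qed
  show "Dx (i, j) (Xv ns k l) = 0" for i j k l
    by (auto simp: Xv_def Dx_single derivation_0[OF derivation_Dx] derivation_1[OF derivation_tpderiv])
  show "xconst (c + c') = xconst c + xconst c'" for c c'
    by (simp add: xconst_def tconst_def single_add)
  show "xconst (c * c') = xconst c * xconst c'" for c c'
    by (simp add: xconst_def tconst_def mult_single)
  show "xconst 1 = 1" by (simp add: xconst_def tconst_def)
  show "Dx (i, j) (xconst c) = 0" for i j c
    by (simp add: xconst_def tconst_def Dx_single tpderiv_single)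
qed

lemma sigma_eq_S: "sigma n ns i = xt.S n ns i"
proof -
  have "1\<^sub>m n + [:0, 1:] \<cdot>\<^sub>m map_mat (\<lambda>p. [:p:]) (Xmat n ns * transpose_mat (Tmat n)) = xt.Bm n ns"
  proof (rule eq_matI)
    fix i j assume "i < dim_row (xt.Bm n ns)" "j < dim_col (xt.Bm n ns)"
    then have ij: "i < n" "j < n" by (simp_all add: xt.Bm_def)
    have "(Xmat n ns * transpose_mat (Tmat n)) $$ (i, j) = xt.xt n ns i j"
      using ij by (auto simp: scalar_prod_def xt.xt_def Xmat_def Tmat_def Xv_def Tv_def atLeast0LessThan intro!: sum.cong)
    then show "(1\<^sub>m n + [:0, 1:] \<cdot>\<^sub>m map_mat (\<lambda>p. [:p:]) (Xmat n ns * transpose_mat (Tmat n))) $$ (i, j)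
        = xt.Bm n ns $$ (i, j)"
      using ij by (auto simp: xt.Bm_def Xmat_def Tmat_def one_pCons)
  qed (auto simp: xt.Bm_def Xmat_def Tmat_def)
  then show ?thesis by (simp add: sigma_def xt.S_def xt.sg_def)
qed

section \<open>Homogeneity in \<open>X\<close>\<close>

abbreviation xdeg :: "idx expo \<Rightarrow> nat" where "xdeg \<equiv> weight (\<lambda>_. 1)"

text \<open>Degree and support are tracked together: the degree identifies the relevant weight, and
  the support in \<open>N0\<close> gives the required shape of the generating function.\<close>

definition homog :: "nat \<Rightarrow> nat list \<Rightarrow> nat \<Rightarrow> xtpoly \<Rightarrow> bool" where
  "homog n ns w P \<longleftrightarrow> (\<forall>\<nu>. Poly_Mapping.lookup P \<nu> \<noteq> 0 \<longrightarrow> \<nu> \<in> N0 n ns \<and> xdeg \<nu> = w)"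

lemma homog_0: "homog n ns w 0"
  by (simp add: homog_def)

lemma homog_1: "homog n ns 0 1"
  by (auto simp: homog_def lookup_one when_def N0_def)

lemma homog_add: "homog n ns w P \<Longrightarrow> homog n ns w Q \<Longrightarrow> homog n ns w (P + Q)"
  unfolding homog_def lookup_add by (metis add.right_neutral add.left_neutral)

lemma homog_uminus: "homog n ns w P \<Longrightarrow> homog n ns w (- P)"
  by (simp add: homog_def)

lemma homog_sum: "(\<And>i. i \<in> I \<Longrightarrow> homog n ns w (P i)) \<Longrightarrow> homog n ns w (sum P I)"
  by (induction I rule: infinite_finite_induct) (simp_all add: homog_0 homog_add)

lemma homog_mult:
  assumes "homog n ns w P" "homog n ns w' Q"
  shows "homog n ns (w + w') (P * Q)"
  unfolding homog_def
proof (intro allI impI)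
  fix \<nu> assume "Poly_Mapping.lookup (P * Q) \<nu> \<noteq> 0"
  then have "\<nu> \<in> Poly_Mapping.keys (P * Q)" by (simp add: in_keys_iff)
  then obtain a b where ab: "\<nu> = a + b" "a \<in> Poly_Mapping.keys P" "b \<in> Poly_Mapping.keys Q"
    using keys_mult[of P Q] by blast
  then have "a \<in> N0 n ns \<and> xdeg a = w" "b \<in> N0 n ns \<and> xdeg b = w'"
    using assms by (auto simp: homog_def in_keys_iff)
  then show "\<nu> \<in> N0 n ns \<and> xdeg \<nu> = w + w'"
    by (auto simp: ab(1) weight_add N0_def keys_add_nat)
qed

lemma homog_power: "homog n ns w P \<Longrightarrow> homog n ns (w * k) (P ^ k)"
  by (induction k) (auto simp: homog_1 intro: homog_mult)

lemma homog_prod: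
  "finite I \<Longrightarrow> (\<And>i. i \<in> I \<Longrightarrow> homog n ns (w i) (P i)) \<Longrightarrow> homog n ns (sum w I) (prod P I)"
  by (induction I rule: finite_induct) (auto simp: homog_1 intro: homog_mult)

text \<open>Homogeneity when \<lambda> is matched with the degree in \<open>X\<close>. The property
  is closed under the ring operations, so it passes from the entries of the matrix to its
  determinant.\<close>

definition graded_poly :: "nat \<Rightarrow> nat list \<Rightarrow> xtpoly poly \<Rightarrow> bool" where
  "graded_poly n ns p \<longleftrightarrow> (\<forall>i. homog n ns i (coeff p i))"

lemma graded_poly_add: "graded_poly n ns p \<Longrightarrow> graded_poly n ns q \<Longrightarrow> graded_poly n ns (p + q)"
  by (simp add: graded_poly_def homog_add)

lemma graded_poly_0: "graded_poly n ns 0"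
  by (simp add: graded_poly_def homog_0)

lemma graded_poly_1: "graded_poly n ns 1"
  by (auto simp: graded_poly_def homog_0 homog_1 coeff_1)

lemma graded_poly_uminus: "graded_poly n ns p \<Longrightarrow> graded_poly n ns (- p)"
  by (simp add: graded_poly_def homog_uminus)

lemma graded_poly_mult:
  assumes "graded_poly n ns p" "graded_poly n ns q"
  shows "graded_poly n ns (p * q)"
  unfolding graded_poly_def coeff_mult
proof (intro allI homog_sum)
  fix i j :: nat assume "j \<in> {..i}"
  then show "homog n ns i (coeff p j * coeff q (i - j))"
    using homog_mult[of n ns j "coeff p j" "i - j" "coeff q (i - j)"] assms by (simp add: graded_poly_def)
qed

lemma graded_poly_sum: "(\<And>i. i \<in> I \<Longrightarrow> graded_poly n ns (p i)) \<Longrightarrow> graded_poly n ns (sum p I)"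
  by (induction I rule: infinite_finite_induct) (simp_all add: graded_poly_0 graded_poly_add)

lemma graded_poly_prod: "(\<And>i. i \<in> I \<Longrightarrow> graded_poly n ns (p i)) \<Longrightarrow> graded_poly n ns (prod p I)"
  by (induction I rule: infinite_finite_induct) (simp_all add: graded_poly_1 graded_poly_mult)

lemma graded_poly_of_int: "graded_poly n ns (of_int k)"
proof -
  have "graded_poly n ns (of_nat m)" for m
    by (induction m) (simp_all add: graded_poly_0 graded_poly_add graded_poly_1)
  then show ?thesis by (cases k rule: int_cases2) (simp_all add: graded_poly_uminus)
qed

lemma homog_Xv: "i < n \<Longrightarrow> j < n \<Longrightarrow> homog n ns 1 (Xv ns i j)"
  by (auto simp: homog_def Xv_def lookup_single when_def N0_def)

lemma homog_single_0: "homog n ns 0 (Poly_Mapping.single 0 P)"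
  by (auto simp: homog_def lookup_single when_def N0_def)

lemma homog_S: "homog n ns i (xt.S n ns i)"
proof -
  have xt: "homog n ns 1 (xt.xt n ns i j)" if "i < n" for i j
    unfolding xt.xt_def
  proof (rule homog_sum)
    fix k assume "k \<in> {..<n}"
    then show "homog n ns 1 (Xv ns i k * Tv j k)"
      using homog_mult[OF homog_Xv[of i n k ns] homog_single_0] that by (simp add: Tv_def)
  qed
  have "graded_poly n ns (xt.Bm n ns $$ (i, j))" if "i < n" "j < n" for i j
    using that xt[of i j]
    by (auto simp: graded_poly_def xt.Bm_index coeff_pCons homog_0 homog_1 One_nat_def split: nat.split)
  then have "graded_poly n ns (xt.sg n ns)"
    unfolding xt.sg_def det_def'[OF xt.Bm_carrier]
    by (intro graded_poly_sum graded_poly_mult graded_poly_of_int graded_poly_prod)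
      (auto dest: permutes_in_image)
  then show ?thesis by (simp add: graded_poly_def xt.S_def)
qed

lemma homog_mon: "Poly_Mapping.keys m \<subseteq> {1..n} \<Longrightarrow> homog n ns (wt m) (xt.mon n ns m)"
  unfolding xt.mon_def weight_superset[OF finite_atLeastAtMost]
  by (intro homog_prod homog_power homog_S) simp

text \<open>All indices are at least 1, so the weight bounds every single exponent.\<close>

lemma finite_wt: "finite {m :: nat expo. Poly_Mapping.keys m \<subseteq> {1..n} \<and> wt m = w}"
proof -
  let ?M = "{m :: nat expo. Poly_Mapping.keys m \<subseteq> {1..n} \<and> wt m = w}"
  have "Poly_Mapping.lookup ` ?M \<subseteq> {f. \<forall>x. (x \<in> {1..n} \<longrightarrow> f x \<in> {..w}) \<and> (x \<notin> {1..n} \<longrightarrow> f x = 0)}"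
  proof (rule image_subsetI, rule CollectI, intro allI conjI impI)
    fix m x assume m: "m \<in> ?M" and "x \<in> {1..n}"
    then have "x * Poly_Mapping.lookup m x \<le> (\<Sum>i\<in>{1..n}. i * Poly_Mapping.lookup m i)"
      by (intro member_le_sum) auto
    also have "\<dots> = w" using m weight_superset[of "{1..n}" m "\<lambda>i. i"] by simp
    finally have "x * Poly_Mapping.lookup m x \<le> w" .
    moreover have "1 * Poly_Mapping.lookup m x \<le> x * Poly_Mapping.lookup m x"
      using \<open>x \<in> {1..n}\<close> by (intro mult_le_mono1) simp
    ultimately show "Poly_Mapping.lookup m x \<in> {..w}" by (simp only: atMost_iff mult_1_left)
  next
    fix m x assume "m \<in> ?M" "x \<notin> {1..n}"
    then show "Poly_Mapping.lookup m x = 0" by (auto simp: in_keys_iff)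
  qed
  moreover have "finite {f. \<forall>x. (x \<in> {1..n} \<longrightarrow> f x \<in> {..w}) \<and> (x \<notin> {1..n} \<longrightarrow> f x = (0::nat))}"
    by (rule finite_set_of_finite_funs) auto
  ultimately have "finite (Poly_Mapping.lookup ` ?M)" by (rule finite_subset)
  then show ?thesis
    by (rule finite_imageD) (rule inj_onI, simp only: poly_mapping.lookup_inject)
qed

text \<open>A weight part of \<open>G^(n)\<close> is finitely supported, so it can be evaluated at
  the \<sigma>'s.\<close>

definition trunc :: "nat \<Rightarrow> nat mseries \<Rightarrow> nat mseries" where
  "trunc w F = (\<lambda>m. of_bool (wt m = w) * F m)"

section \<open>Weight parts of \<open>G^(n)\<close> and the coefficients of
  \<open>X^\<nu>\<close>\<close>

lemma Gser_eq_0: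
  assumes "0 < n" "\<not> Poly_Mapping.keys m \<subseteq> {1..n}"
  shows "Gser \<kappa> G n m = 0"
proof -
  obtain i where "i \<in> Poly_Mapping.keys m" "i \<notin> {1..n}" using assms(2) by blast
  then have "Poly_Mapping.lookup m i \<noteq> 0" "i = 0 \<or> n < i" by (auto simp: in_keys_iff)
  then show ?thesis using indep_Gser[OF assms(1), of i \<kappa> G] by (simp add: indep_def)
qed

lemma trunc_Gser_eq_0:
  "0 < n \<Longrightarrow> m \<notin> {m. Poly_Mapping.keys m \<subseteq> {1..n} \<and> wt m = w} \<Longrightarrow> trunc w (Gser \<kappa> G n) m = 0"
  using Gser_eq_0[of n m \<kappa> G] by (auto simp: trunc_def)

lemma polyn_trunc_Gser: "0 < n \<Longrightarrow> xt.polyn (trunc w (Gser \<kappa> G n))"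
  unfolding xt.polyn_def
  by (rule finite_subset[OF _ finite_wt[of n w]]) (use trunc_Gser_eq_0[of n _ w \<kappa> G] in blast)

text \<open>A monomial of weight \<open>w\<close> in the \<sigma>'s is homogeneous of degree
  \<open>w\<close> in \<open>X\<close>, so \<open>X^\<nu>\<close> only sees the weight equal to the
  degree of \<nu>.\<close>

lemma Gtilde_coeff_eq:
  assumes n: "0 < n"
  shows "Gtilde_coeff n ns \<kappa> G \<nu> = Poly_Mapping.lookup (xt.ev n ns (trunc (xdeg \<nu>) (Gser \<kappa> G n))) \<nu>"
proof -
  let ?M = "{m. Poly_Mapping.keys m \<subseteq> {1..n} \<and> wt m = xdeg \<nu>}"
  let ?f = "\<lambda>m. tconst (Gser \<kappa> G n m) *
     Poly_Mapping.lookup (\<Prod>i\<in>Poly_Mapping.keys m. sigma n ns i ^ Poly_Mapping.lookup m i) \<nu>"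
  have mon: "(\<Prod>i\<in>Poly_Mapping.keys m. sigma n ns i ^ Poly_Mapping.lookup m i) = xt.mon n ns m"
    if "Poly_Mapping.keys m \<subseteq> {1..n}" for m
    unfolding xt.mon_def sigma_eq_S using that
    by (intro prod.mono_neutral_left) (auto simp: in_keys_iff)
  have "?f m = 0" if "m \<notin> ?M" for m
  proof (cases "Poly_Mapping.keys m \<subseteq> {1..n}")
    case True
    then have "Poly_Mapping.lookup (xt.mon n ns m) \<nu> = 0"
      using that homog_mon[OF True, of ns] by (auto simp: homog_def)
    then show ?thesis by (simp add: mon[OF True])
  next
    case False
    then show ?thesis by (simp add: Gser_eq_0[OF n False] tconst_def)
  qed
  then have "{m. ?f m \<noteq> 0} \<subseteq> ?M" by blast
  then have "Gtilde_coeff n ns \<kappa> G \<nu> = (\<Sum>m\<in>?M. ?f m)"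
    unfolding Gtilde_coeff_def subst_coeff_def by (intro Sum_any.expand_superset finite_wt)
  also have "\<dots> = (\<Sum>m\<in>?M. Poly_Mapping.lookup (xconst (trunc (xdeg \<nu>) (Gser \<kappa> G n) m) * xt.mon n ns m) \<nu>)"
    by (intro sum.cong refl) (auto simp: mon xconst_def lookup_single_0_mult trunc_def)
  also have "\<dots> = Poly_Mapping.lookup (xt.ev n ns (trunc (xdeg \<nu>) (Gser \<kappa> G n))) \<nu>"
    using trunc_Gser_eq_0[OF n, of _ "xdeg \<nu>" \<kappa> G]
    by (subst xt.ev_superset[OF finite_wt[of n "xdeg \<nu>"]]) (simp_all only: lookup_sum)
  finally show ?thesis .
qed

lemma Gtilde_coeff_eq_0:
  assumes n: "0 < n" and \<nu>: "\<nu> \<notin> N0 n ns"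
  shows "Gtilde_coeff n ns \<kappa> G \<nu> = 0"
proof -
  let ?F = "trunc (xdeg \<nu>) (Gser \<kappa> G n)"
  have "homog n ns (xdeg \<nu>) (xt.ev n ns ?F)"
    unfolding xt.ev_def
  proof (rule homog_sum)
    fix m assume "m \<in> {m. ?F m \<noteq> 0}"
    then have "Poly_Mapping.keys m \<subseteq> {1..n}" "wt m = xdeg \<nu>"
      using trunc_Gser_eq_0[OF n, of m "xdeg \<nu>" \<kappa> G] by auto
    then show "homog n ns (xdeg \<nu>) (xconst (?F m) * xt.mon n ns m)"
      using homog_mult[OF homog_single_0 homog_mon, of m n ns] by (simp add: xconst_def)
  qed
  then show ?thesis
    using \<nu> unfolding Gtilde_coeff_eq[OF n] homog_def by blast
qed

lemma graded_eq_Lop: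
  assumes "graded_eq g 0 F F'"
  shows "graded_eq g r (Lop \<kappa> N r F) (Lop \<kappa> N r F')"
proof -
  have 1: "graded_eq g r (mderiv r F) (mderiv r F')"
    using graded_eq_mderiv[OF assms, of r] by simp
  have 2: "graded_eq g r (\<lambda>m. of_int (eps N r a b) * smult_var (a + b - r) (mderiv a (mderiv b F)) m)
     (\<lambda>m. of_int (eps N r a b) * smult_var (a + b - r) (mderiv a (mderiv b F')) m)" for a b
  proof (cases "eps N r a b = 0")
    case True
    then show ?thesis by (simp add: graded_eq_def)
  next
    case False
    then have "r + (a + b - r) = 0 + b + a" by (auto simp: eps_def split: if_splits)
    moreover have "graded_eq g (0 + b + a) (mderiv a (mderiv b F)) (mderiv a (mderiv b F'))"
      by (intro graded_eq_mderiv assms)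
    ultimately have "graded_eq g r (smult_var (a + b - r) (mderiv a (mderiv b F))) (smult_var (a + b - r) (mderiv a (mderiv b F')))"
      by (intro graded_eq_smult_var) (simp only:)
    then show ?thesis by (simp add: graded_eq_def)
  qed
  have "graded_eq g r (\<lambda>m. \<Sum>a\<in>{1..N}. \<Sum>b\<in>{1..N}. of_int (eps N r a b) * smult_var (a + b - r) (mderiv a (mderiv b F)) m)
    (\<lambda>m. \<Sum>a\<in>{1..N}. \<Sum>b\<in>{1..N}. of_int (eps N r a b) * smult_var (a + b - r) (mderiv a (mderiv b F')) m)"
    by (intro graded_eq_sum 2)
  then show ?thesis
    using 1 by (simp add: graded_eq_def Lop_def algebra_simps)
qed

lemma Lop_trunc_Gser:
  assumes n: "0 < n" and \<kappa>: "\<And>z. z < int n \<Longrightarrow> \<kappa> \<noteq> of_int z"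
    and G: "\<forall>k. fps_nth G k \<noteq> 0" and w: "0 < w" and r: "r \<in> {1..n}"
  shows "Lop \<kappa> n r (trunc w (Gser \<kappa> G n)) = (\<lambda>m. of_bool (r = 1) *
    (of_nat w * (\<kappa> + of_nat (w - 1)) * fps_nth G w / fps_nth G (w - 1)) * trunc (w - 1) (Gser \<kappa> G n) m)"
proof -
  \<comment> \<open>Truncation is itself a rescaling by weight, namely by the indicator of
    \<open>w\<close>; so \<open>L_r\<close> carries it to truncation at weight
    \<open>w - r\<close>.\<close>
  have "graded_eq (\<lambda>k. of_bool (k = w)) 0 (trunc w (Gser \<kappa> G n)) (Gser \<kappa> G n)"
    by (simp add: graded_eq_def trunc_def)
  then have L: "Lop \<kappa> n r (trunc w (Gser \<kappa> G n)) m = of_bool (wt m + r = w) * Lop \<kappa> n r (Gser \<kappa> G n) m" for m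
    using graded_eq_Lop[of _ _ _ r \<kappa> n] by (fastforce simp: graded_eq_def)
  show ?thesis
  proof (cases "r = 1")
    case False
    then have "Lop \<kappa> n r (Gser \<kappa> G n) = (\<lambda>m. 0)"
      using Lop_Gser(2)[OF n \<kappa>, where r = r] r by simp
    then show ?thesis using False L by (simp add: fun_eq_iff)
  next
    case True
    show ?thesis
    proof
      fix m
      have "Lop \<kappa> n r (trunc w (Gser \<kappa> G n)) m = of_bool (wt m + 1 = w) * Gser \<kappa> (L1_shift \<kappa> G) n m"
        by (simp add: L[unfolded True] True Lop_Gser(1)[OF n \<kappa>])
      also have "\<dots> = of_bool (wt m + 1 = w) * (of_nat w * (\<kappa> + of_nat (w - 1)) * fps_nth G w * Gser \<kappa> (Abs_fps (\<lambda>_. 1)) n m)"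
        unfolding Gser_graded[OF n, of \<kappa> "L1_shift \<kappa> G"] by (auto simp: L1_shift_def)
      \<comment> \<open>In weight \<open>w - 1\<close> both series are multiples of the reference
        series. Expressing one through the other divides by the nonzero coefficient
        \<open>fps_nth G (w - 1)\<close>.\<close>
      also have "\<dots> = of_bool (wt m + 1 = w) * (of_nat w * (\<kappa> + of_nat (w - 1)) * fps_nth G w / fps_nth G (w - 1)) * Gser \<kappa> G n m"
        using G unfolding Gser_graded[OF n, of \<kappa> G] by auto
      also have "\<dots> = of_bool (r = 1) * (of_nat w * (\<kappa> + of_nat (w - 1)) * fps_nth G w / fps_nth G (w - 1)) * trunc (w - 1) (Gser \<kappa> G n) m"
        using w by (auto simp: trunc_def True)
      finally show "Lop \<kappa> n r (trunc w (Gser \<kappa> G n)) m = of_bool (r = 1) *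
        (of_nat w * (\<kappa> + of_nat (w - 1)) * fps_nth G w / fps_nth G (w - 1)) * trunc (w - 1) (Gser \<kappa> G n) m" .
    qed
  qed
qed

text \<open>The operator does not involve \<open>X\<close>, so it acts on each coefficient of
  \<open>X^\<nu>\<close> separately.\<close>

lemma Dop_lookup:
  "Dop n \<kappa> i j (Poly_Mapping.lookup P \<nu>) = Poly_Mapping.lookup (xt.Dhat n \<kappa> i j P) \<nu>"
  by (simp add: Dop_def xt.Dhat_def lookup_add lookup_sum Tv_def xconst_def lookup_single_0_mult lookup_Dx)

theorem theorem4p23:
  fixes n :: nat and ns :: "nat list" and \<kappa> :: complex and G1 :: "complex fps"
  assumes "n > 0"
    and "is_partition ns n"
    and "\<kappa> \<notin> {of_int z |z. z < int n}"
    and "\<forall>k. fps_nth G1 k \<noteq> 0"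
  shows "descending_generating_function n ns \<kappa> (Gtilde_coeff n ns \<kappa> G1)"
proof -
  note n = assms(1) and G = assms(4)
  have \<kappa>: "\<kappa> \<noteq> of_int z" if "z < int n" for z using assms(3) that by blast
  let ?F = "\<lambda>w. trunc w (Gser \<kappa> G1 n)" and ?P = "Gtilde_coeff n ns \<kappa> G1"
  define c where "c w = of_nat w * (\<kappa> + of_nat (w - 1)) * fps_nth G1 w / fps_nth G1 (w - 1)" for w
  have "Dop n \<kappa> i j (?P \<nu>) = tconst (c (xdeg \<nu>)) *
      (if Poly_Mapping.lookup \<nu> (i, j) = 0 then 0 else ?P (\<nu> - Poly_Mapping.single (i, j) 1))"
    if \<nu>: "\<nu> \<in> N0 n ns" "\<nu> \<noteq> 0" and ij: "i < n" "j < n" for \<nu> i j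
  proof -
    define w where "w = xdeg \<nu>"
    \<comment> \<open>A nonzero \<nu> has positive degree, so \<open>w - 1\<close> is the true
      predecessor of \<open>w\<close>.\<close>
    obtain v where "v \<in> Poly_Mapping.keys \<nu>" using \<nu>(2) by (metis all_not_in_conv keys_eq_empty)
    then have w: "0 < w" unfolding w_def weight_def by (intro sum_pos2[of _ v]) (auto simp: in_keys_iff)
    have "xt.Dhat n \<kappa> i j (xt.ev n ns (?F w)) =
       (\<Sum>r\<in>{1..n}. xt.Z n ns (r - 1) i j * xt.ev n ns (Lop \<kappa> n r (?F w)))"
      by (rule xt.Dhat_ev[OF polyn_trunc_Gser[OF n] ij])
    \<comment> \<open>Only \<open>L_1\<close> survives, and its factor is \<open>Z_0 = X\<close>:
      this is where the multiplication by \<open>x_ij\<close> comes from.\<close>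
    also have "\<dots> = (\<Sum>r\<in>{1..n}. if r = 1 then Xv ns i j * (xconst (c w) * xt.ev n ns (?F (w - 1))) else 0)"
    proof (intro sum.cong refl, goal_cases)
      case (1 r)
      have L: "Lop \<kappa> n r (?F w) = (\<lambda>m. of_bool (r = 1) * c w * ?F (w - 1) m)"
        unfolding c_def by (rule Lop_trunc_Gser[OF n _ G w 1]) (rule \<kappa>)
      show ?case
        unfolding L
        by (auto simp: xt.cst_0 xt.Z_0[OF ij(1)] xt.ev_scale[OF polyn_trunc_Gser[OF n]])
    qed
    also have "\<dots> = Xv ns i j * (xconst (c w) * xt.ev n ns (?F (w - 1)))"
      using n by (simp add: sum.delta)
    finally have D: "Dop n \<kappa> i j (?P \<nu>) =
        Poly_Mapping.lookup (Xv ns i j * (xconst (c w) * xt.ev n ns (?F (w - 1)))) \<nu>"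
      unfolding Gtilde_coeff_eq[OF n] w_def[symmetric] Dop_lookup by simp
    show ?thesis
    proof (cases "Poly_Mapping.lookup \<nu> (i, j) = 0")
      case True
      then show ?thesis unfolding D by (auto simp: Xv_def lookup_single_var_mult)
    next
      case False
      then have "(i, j) \<in> Poly_Mapping.keys \<nu>" by (simp add: in_keys_iff)
      \<comment> \<open>Since \<nu> contains \<open>(i, j)\<close>, the entry \<open>x_ij\<close> is
        a genuine variable and not one of the zeros in the diagonal blocks.\<close>
      then have "(i, j) \<notin> same_block ns" using \<nu>(1) by (auto simp: N0_def)
      moreover have "xdeg (\<nu> - Poly_Mapping.single (i, j) 1) = w - 1"
        using weight_diff_single[OF False, of "\<lambda>_. 1"] by (simp add: w_def)
      ultimately show ?thesis
        unfolding D using False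
        by (simp add: Xv_def lookup_single_var_mult xconst_def lookup_single_0_mult Gtilde_coeff_eq[OF n] w_def)
    qed
  qed
  then show ?thesis
    unfolding descending_generating_function_def using Gtilde_coeff_eq_0[OF n]
    by (intro conjI exI[of _ "\<lambda>\<nu>. c (xdeg \<nu>)"]) auto
qed

end
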